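(* Let $n\ge1$, $\gamma=(\gamma_1,\dots,\gamma_n)$ with $\gamma_i>0$, $|\gamma|=\sum_i\gamma_i$, and let $f\in C^2_{ev}$ (a twice continuously differentiable function on $\mathbb{R}^n_+$, even with respect to each variable). Consider the Cauchy problem for the general Euler--Poisson--Darboux equation $$(B_k)_t u=(\Delta_\gamma)_x u,\quad u=u(x,t;k),\ x\in\mathbb{R}^n_+,\ t>0,\qquad u(x,0;k)=f(x),\quad u_t(x,0;k)=0.$$ If $k>n+|\gamma|-1$, the solution is $$u(x,t;k)=\frac{2^n\Gamma(\frac{k+1}{2})}{\Gamma(\frac{k-n-|\gamma|+1}{2})\prod_{i=1}^n\Gamma(\frac{\gamma_i+1}{2})}\int_{B^+_1(n)}\big[{}^\gamma T^{ty}_x f(x)\big](1-|y|^2)^{\frac{k-n-|\gamma|-1}{2}}y^\gamma\,dy,$$ where $B^+_1(n)=\{y\in\mathbb{R}^n_+:|y|\le 1\}$. If $k=n+|\gamma|-1$, the solution is the weighted spherical mean $M^\gamma_t[f(x)]$.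
   Context: $\mathbb{R}^n_+=\{x\in\mathbb{R}^n: x_i>0\ \forall i\}$. $C^m_{ev}$: functions on $\mathbb{R}^n_+$, $m$ times differentiable, with all derivatives continuous up to $x_i=0$, and $\frac{\partial^{2j+1}f}{\partial x_i^{2j+1}}=0$ at $x_i=0$ for all $i$ and integers $j\ge0$, $2j+1\le m$. $(B_\nu)_t=\partial_t^2+\frac{\nu}{t}\partial_t$; $(\Delta_\gamma)_x=\sum_{i=1}^n\big(\partial_{x_i}^2+\frac{\gamma_i}{x_i}\partial_{x_i}\big)$. $y^\gamma=\prod_i y_i^{\gamma_i}$. Generalized translation: ${}^{\gamma_i}T^{y_i}_{x_i}f(x)=\frac{\Gamma(\frac{\gamma_i+1}{2})}{\Gamma(\frac{\gamma_i}{2})\Gamma(\frac12)}\int_0^\pi f(x_1,\dots,\sqrt{x_i^2+y_i^2-2x_iy_i\cos\alpha},\dots,x_n)\sin^{\gamma_i-1}\alpha\,d\alpha$, and ${}^\gamma T^y_x=\prod_{i=1}^n{}^{\gamma_i}T^{y_i}_{x_i}$. Weighted spherical mean: $M^\gamma_t[f(x)]=\frac{1}{|S^+_1(n)|_\gamma}\int_{S^+_1(n)}{}^\gamma T^{t\theta}_xf(x)\,\theta^\gamma dS_\theta$ with $S^+_1(n)=\{\theta\in\mathbb{R}^n_+:|\theta|=1\}$ and $|S^+_1(n)|_\gamma=\frac{\prod_{i}\Gamma(\frac{\gamma_i+1}{2})}{2^{n-1}\Gamma(\frac{n+|\gamma|}{2})}$. *)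

theory Defs
  imports "HOL-Analysis.Analysis"
begin

definition orth_open :: "(real ^ 'n) set" where
  "orth_open = {x. \<forall>i. x $ i > 0}"

definition orth_closed :: "(real ^ 'n) set" where
  "orth_closed = {x. \<forall>i. x $ i \<ge> 0}"

definition abs_multi :: "real ^ 'n \<Rightarrow> real" where
  "abs_multi g = (\<Sum>i\<in>UNIV. g $ i)"

definition mpow :: "real ^ 'n \<Rightarrow> real ^ 'n \<Rightarrow> real" where
  "mpow y g = (\<Prod>i\<in>UNIV. y $ i powr g $ i)"

text \<open>The class C^2_ev: twice differentiable on the open orthant, f and all first and
  second partial derivatives continuous up to the boundary, and the first partial
  derivative in x_i vanishes at x_i = 0 (the only odd order 2j+1 \<le> 2).\<close>
definition C2_ev :: "(real ^ 'n \<Rightarrow> real) \<Rightarrow> bool" where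
  "C2_ev f \<longleftrightarrow> continuous_on orth_closed f \<and>
     (\<exists>d1 d2.
        (\<forall>i. continuous_on orth_closed (d1 i)) \<and>
        (\<forall>i j. continuous_on orth_closed (d2 i j)) \<and>
        (\<forall>x\<in>orth_open. \<forall>i.
           ((\<lambda>s. f (x + s *\<^sub>R axis i 1)) has_real_derivative d1 i x) (at 0)) \<and>
        (\<forall>x\<in>orth_open. \<forall>i j.
           ((\<lambda>s. d1 j (x + s *\<^sub>R axis i 1)) has_real_derivative d2 i j x) (at 0)) \<and>
        (\<forall>x\<in>orth_closed. \<forall>i. x $ i = 0 \<longrightarrow> d1 i x = 0))"

text \<open>Multidimensional generalized translation: the product (composition) of the
  one-dimensional operators, written as one iterated integral over [0,pi]^n.\<close>
definition gtrans :: "real ^ 'n \<Rightarrow> real ^ 'n \<Rightarrow> (real ^ 'n \<Rightarrow> real) \<Rightarrow> real ^ 'n \<Rightarrow> real" where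
  "gtrans g y f x =
     (\<Prod>i\<in>UNIV. Gamma ((g $ i + 1) / 2) / (Gamma (g $ i / 2) * Gamma (1 / 2))) *
     integral (cbox 0 (\<chi> i. pi))
       (\<lambda>a. f (\<chi> i. sqrt ((x $ i)\<^sup>2 + (y $ i)\<^sup>2 - 2 * x $ i * y $ i * cos (a $ i))) *
            (\<Prod>i\<in>UNIV. sin (a $ i) powr (g $ i - 1)))"

text \<open>Integral over the positive part of the unit sphere with respect to surface
  measure, via the cone-measure identity  int_S h dS = n * int_{|y|<1} h(y/|y|) dy.\<close>
definition sph_pos_integral :: "(real ^ 'n \<Rightarrow> real) \<Rightarrow> real" where
  "sph_pos_integral h =
     real CARD('n) * integral {y \<in> orth_open. norm y < 1} (\<lambda>y. h (y /\<^sub>R norm y))"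

definition sph_pos_weight :: "real ^ 'n \<Rightarrow> real" where
  "sph_pos_weight g =
     (\<Prod>i\<in>UNIV. Gamma ((g $ i + 1) / 2)) /
     (2 ^ (CARD('n) - 1) * Gamma ((real CARD('n) + abs_multi g) / 2))"

definition wmean :: "real ^ 'n \<Rightarrow> (real ^ 'n \<Rightarrow> real) \<Rightarrow> real ^ 'n \<Rightarrow> real \<Rightarrow> real" where
  "wmean g f x t =
     sph_pos_integral (\<lambda>th. gtrans g (t *\<^sub>R th) f x * mpow th g) / sph_pos_weight g"

definition epd_ball :: "real ^ 'n \<Rightarrow> real \<Rightarrow> (real ^ 'n \<Rightarrow> real) \<Rightarrow> real ^ 'n \<Rightarrow> real \<Rightarrow> real" where
  "epd_ball g k f x t =
     (2 ^ CARD('n) * Gamma ((k + 1) / 2) /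
      (Gamma ((k - real CARD('n) - abs_multi g + 1) / 2) * (\<Prod>i\<in>UNIV. Gamma ((g $ i + 1) / 2)))) *
     integral {y \<in> orth_open. norm y \<le> 1}
       (\<lambda>y. gtrans g (t *\<^sub>R y) f x *
            (1 - (norm y)\<^sup>2) powr ((k - real CARD('n) - abs_multi g - 1) / 2) * mpow y g)"

definition EPD_solves ::
  "real ^ 'n \<Rightarrow> real \<Rightarrow> (real ^ 'n \<Rightarrow> real) \<Rightarrow> (real ^ 'n \<Rightarrow> real \<Rightarrow> real) \<Rightarrow> bool" where
  "EPD_solves g k f u \<longleftrightarrow>
     (\<exists>ut utt ux uxx.
        (\<forall>x\<in>orth_open. \<forall>t>0.
           ((\<lambda>s. u x s) has_real_derivative ut x t) (at t) \<and>
           ((\<lambda>s. ut x s) has_real_derivative utt x t) (at t) \<and>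
           (\<forall>i. ((\<lambda>s. u (x + s *\<^sub>R axis i 1) t) has_real_derivative ux i x t) (at 0) \<and>
                ((\<lambda>s. ux i (x + s *\<^sub>R axis i 1) t) has_real_derivative uxx i x t) (at 0)) \<and>
           utt x t + k / t * ut x t = (\<Sum>i\<in>UNIV. uxx i x t + g $ i / x $ i * ux i x t)) \<and>
        (\<forall>x\<in>orth_open. ((\<lambda>t. u x t) \<longlongrightarrow> f x) (at_right 0) \<and>
                        ((\<lambda>t. ut x t) \<longlongrightarrow> 0) (at_right 0)))"

end

theory Submission
  imports Defs "HOL-Probability.Giry_Monad"
begin

text \<open>
  The generalized translation \<open>v(x, y)\<close> is symmetric in \<open>x, y\<close> and, by an integration by parts in the
  angle \<open>a\<^sub>i\<close>, satisfies \<open>\<partial>\<^sub>x\<^sup>2 v + (g\<^sub>i/x\<^sub>i) \<partial>\<^sub>x v = \<partial>\<^sub>y\<^sup>2 v + (g\<^sub>i/y\<^sub>i) \<partial>\<^sub>y v\<close> in each coordinate. Hence the weighted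
  Laplacian in \<open>x\<close> of the spherical mean \<open>\<Phi>(x, t)\<close> of \<open>v(x, t\<theta>)\<close> is the spherical mean \<open>H(x, t)\<close> of the weighted
  Laplacian in \<open>y\<close>. Integrating the latter against \<open>(T\<^sup>2 - |y|\<^sup>2)\<^sub>+\<close> over the orthant and passing to polar
  coordinates gives \<open>T\<^sup>m \<partial>\<^sub>t\<Phi>(x, T) = \<integral>\<^sub>0\<^sup>T r\<^sup>m H(x, r) dr\<close> with \<open>m = n + |g| - 1\<close>, which is the equation with
  \<open>k = m\<close>. For \<open>k > m\<close> the ball integral is the average of
  \<open>\<Phi>(x, tr)\<close> against \<open>r\<^sup>m (1 - r\<^sup>2)\<^sup>p dr\<close>, \<open>2(p + 1) = k - m\<close>, and the equation with parameter \<open>k\<close> follows by one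
  more integration by parts in \<open>r\<close>.
\<close>


section \<open>Integration against compactly supported measures\<close>

text \<open>The argument of \<open>f\<close> in the translation is a square root, not differentiable
  where it vanishes. Evenness helps through the factor \<open>z_i\<close> in the first partial
  derivative of \<open>f\<close>, which cancels the denominator produced by the root.

  The cutoff \<open>T^2 - |y|^2\<close> vanishes on the sphere and the weight \<open>y^g\<close> on
  the faces of the orthant, so integration by parts leaves no boundary terms and needs no surface
  integral; the price is one differentiation in \<open>T\<close> to remove the cutoff.

  The second time derivative is never computed by differentiating twice under the spherical
  integral, which would bring in mixed second derivatives of \<open>v\<close>. It is read off from
  the formula for the first one, which contains only pure second derivatives.

  Angles, spheres, balls and radii all carry finite measures on compact sets. Every continuous
  function is integrable against them, and one continuity lemma and one Leibniz rule serve all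
  cases. These rules ask for formulas valid on the whole space and the whole time line, which is why
  data are extended evenly in space and time.\<close>

definition compact_measure :: "'a::euclidean_space measure \<Rightarrow> bool" where
  "compact_measure M \<longleftrightarrow> sets M = sets borel \<and> finite_measure M \<and> (\<exists>K. compact K \<and> (AE x in M. x \<in> K))"

lemma compact_measure_measurable:
  fixes q :: "'a::euclidean_space \<Rightarrow> real"
  assumes "compact_measure M" "continuous_on UNIV q"
  shows "q \<in> borel_measurable M"
proof -
  have "q \<in> borel_measurable borel" by (rule borel_measurable_continuous_onI[OF assms(2)])
  thus ?thesis using assms(1) measurable_cong_sets unfolding compact_measure_def by blast
qed

lemma compact_measure_integrable:
  fixes q :: "'a::euclidean_space \<Rightarrow> real"
  assumes "compact_measure M" "continuous_on UNIV q"
  shows "integrable M q"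
proof -
  obtain K where K: "compact K" "AE x in M. x \<in> K" and fin: "finite_measure M"
    using assms(1) unfolding compact_measure_def by blast
  have "compact (q ` K)" using K(1) assms(2) compact_continuous_image continuous_on_subset by blast
  then obtain B where B: "\<And>x. x \<in> K \<Longrightarrow> norm (q x) \<le> B"
    by (meson bounded_iff compact_imp_bounded imageI)
  show ?thesis
    using B K(2) by (intro finite_measure.integrable_const_bound[OF fin, of _ B] 
      compact_measure_measurable assms) (auto elim: eventually_mono)
qed

lemma continuous_on_slice:
  assumes "continuous_on UNIV (\<lambda>(x,w). q x w)"
  shows "continuous_on UNIV (q x)"
proof -
  have "continuous_on UNIV (\<lambda>w. (case (x,w) of (x,w) \<Rightarrow> q x w))"
    by (rule continuous_on_compose2[OF assms]) (auto intro!: continuous_intros)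
  thus ?thesis by simp
qed

text \<open>Dominated convergence along sequences: a convergent sequence of parameters stays in a
  ball, and on this ball times the compact carrier of \<open>M\<close> the continuous integrand is
  bounded.\<close>

lemma continuous_compact_measure_integral:
  fixes q :: "'b::euclidean_space \<Rightarrow> 'a::euclidean_space \<Rightarrow> real"
  assumes M: "compact_measure M" and q: "continuous_on UNIV (\<lambda>(x,w). q x w)"
  shows "continuous_on UNIV (\<lambda>x. \<integral>w. q x w \<partial>M)"
proof -
  obtain K where K: "compact K" "AE x in M. x \<in> K" and fin: "finite_measure M"
    using M unfolding compact_measure_def by blast
  interpret finite_measure M by fact
  have "((\<lambda>x. \<integral>w. q x w \<partial>M) \<longlongrightarrow> (\<integral>w. q x0 w \<partial>M)) (at x0)" for x0
  proof (unfold tendsto_at_iff_sequentially comp_def, intro allI impI)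
    fix X :: "nat \<Rightarrow> 'b" assume X: "\<forall>i. X i \<in> UNIV - {x0}" "X \<longlonglongrightarrow> x0"
    have "bounded (range X)" using X(2) convergent_imp_bounded by blast
    then obtain R where R: "\<And>n. norm (X n) \<le> R" by (auto simp: bounded_iff)
    have "compact ((\<lambda>(x,w). q x w) ` (cball 0 R \<times> K))"
      by (intro compact_continuous_image compact_Times K compact_cball continuous_on_subset[OF q]) auto
    then obtain B where B: "\<And>z. z \<in> cball 0 R \<times> K \<Longrightarrow> norm ((\<lambda>(x,w). q x w) z) \<le> B"
      by (meson bounded_iff compact_imp_bounded imageI)
    show "(\<lambda>n. \<integral>w. q (X n) w \<partial>M) \<longlonglongrightarrow> (\<integral>w. q x0 w \<partial>M)"
    proof (rule integral_dominated_convergence[where w="\<lambda>_. B"])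
      show "AE w in M. (\<lambda>n. q (X n) w) \<longlonglongrightarrow> q x0 w"
      proof (intro AE_I2)
        fix w
        have "continuous_on UNIV (\<lambda>x. (case (x,w) of (x,w) \<Rightarrow> q x w))"
          by (rule continuous_on_compose2[OF q]) (auto intro!: continuous_intros)
        hence "isCont (\<lambda>x. q x w) x0" by (simp add: continuous_on_eq_continuous_at)
        thus "(\<lambda>n. q (X n) w) \<longlonglongrightarrow> q x0 w" using X(2) isCont_tendsto_compose by blast
      qed
      show "AE x in M. norm (q (X n) x) \<le> B" for n
        using K(2) by eventually_elim (use B[of "(X n, _)"] R in \<open>auto simp: dist_norm\<close>)
    qed (auto intro!: compact_measure_measurable[OF M] continuous_on_slice[OF q])
  qed
  thus ?thesis by (simp add: continuous_on_eq_continuous_at isCont_def)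
qed

text \<open>The difference quotient is \<open>\<integral>\<^sub>0\<^sup>1 D (s\<^sub>0 + r (s - s\<^sub>0)) w dr\<close>, which is jointly continuous,
  so differentiation under the integral reduces to continuity of a parametric integral.\<close>

lemma leibniz_compact_measure:
  fixes q :: "real \<Rightarrow> 'a::euclidean_space \<Rightarrow> real"
  assumes M: "compact_measure M" and D: "continuous_on UNIV (\<lambda>(s,w). D s w)"
    and q: "\<And>s. continuous_on UNIV (q s)"
    and qD: "\<And>s w. ((\<lambda>s. q s w) has_real_derivative D s w) (at s)"
  shows "((\<lambda>s. \<integral>w. q s w \<partial>M) has_real_derivative (\<integral>w. D s w \<partial>M)) (at s)"
proof -
  define Q where "Q x w = integral (cbox 0 (1::real)) (\<lambda>r. D (s + r * (x - s)) w)" for x w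
  have "continuous_on (UNIV \<times> cbox 0 1) (\<lambda>((x,w),r). (case (s + r * (x - s), w) of (s,w) \<Rightarrow> D s w))"
    unfolding case_prod_unfold
    by (rule continuous_on_compose2[OF D[unfolded case_prod_unfold]]) (auto intro!: continuous_intros)
  hence "continuous_on UNIV (\<lambda>z. integral (cbox 0 (1::real)) (\<lambda>r. (\<lambda>(x,w) r. D (s + r * (x - s)) w) z r))"
    by (intro integral_continuous_on_param) (auto simp: case_prod_unfold)
  hence Qc: "continuous_on UNIV (\<lambda>(x,w). Q x w)" unfolding Q_def by (simp add: case_prod_unfold)
  have qQ: "q x w - q s w = Q x w * (x - s)" for x w
  proof -
    have "((\<lambda>r. D (s + r * (x - s)) w * (x - s)) has_integral (q (s + 1 * (x - s)) w - q (s + 0 * (x - s)) w)) {0..1}"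
    proof (rule fundamental_theorem_of_calculus)
      fix r :: real
      have "((\<lambda>r. q (s + r * (x - s)) w) has_real_derivative (D (s + r * (x - s)) w * (x - s))) (at r within {0..1})"
        by (rule DERIV_chain2[OF qD]) (auto intro!: derivative_eq_intros)
      thus "((\<lambda>r. q (s + r * (x - s)) w) has_vector_derivative D (s + r * (x - s)) w * (x - s)) (at r within {0..1})"
        by (simp add: has_real_derivative_iff_has_vector_derivative)
    qed simp
    from integral_unique[OF this] show ?thesis unfolding Q_def by simp
  qed
  have "isCont (\<lambda>x. \<integral>w. Q x w \<partial>M) s"
    using continuous_compact_measure_integral[OF M Qc] by (simp add: continuous_on_eq_continuous_at)
  moreover have "(\<integral>w. Q s w \<partial>M) = (\<integral>w. D s w \<partial>M)" by (simp add: Q_def)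
  moreover have "(\<integral>w. q x w \<partial>M) - (\<integral>w. q s w \<partial>M) = (\<integral>w. Q x w \<partial>M) * (x - s)" for x
  proof -
    have "(\<integral>w. q x w \<partial>M) - (\<integral>w. q s w \<partial>M) = (\<integral>w. q x w - q s w \<partial>M)"
      by (rule Bochner_Integration.integral_diff[symmetric])
        (auto intro!: compact_measure_integrable M q)
    thus ?thesis by (simp add: qQ)
  qed
  \<comment> \<open>Caratheodory's criterion: the increment is the step \<open>x - s\<close> times a
    function continuous at \<open>s\<close>.\<close>
  ultimately show ?thesis
    unfolding CARAT_DERIV by (intro exI[of _ "\<lambda>x. \<integral>w. Q x w \<partial>M"]) auto
qed

text \<open>The fundamental theorem tolerates the point \<open>b\<close> and gives \<open>p\<close>
  as a constant plus an integral of \<open>D\<close>; continuity of \<open>D\<close> makes that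
  integral differentiable at \<open>b\<close> as well. This carries derivative formulas across the
  zeros of the square root and across time 0 for functions of \<open>\<bar>t\<bar>\<close>.\<close>

lemma DERIV_remove_point:
  fixes p D :: "real \<Rightarrow> real"
  assumes p: "continuous_on UNIV p" and D: "continuous_on UNIV D"
    and der: "\<And>s. s \<noteq> b \<Longrightarrow> (p has_real_derivative D s) (at s)"
  shows "(p has_real_derivative D s) (at s)"
proof -
  \<comment> \<open>Starting at \<open>s-1\<close> makes \<open>s\<close> an interior point of the
    interval of integration.\<close>
  define I where "I x = integral {s-1..x} D" for x
  have I: "I x = p x - p (s-1)" if "x \<ge> s-1" for x
  proof -
    have "(D has_integral (p x - p (s-1))) {s-1..x}"
      by (rule fundamental_theorem_of_calculus_interior_strong[of "{b}"])
        (use that der in \<open>auto intro!: continuous_on_subset[OF p] simp: has_real_derivative_iff_has_vector_derivative\<close>)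
    thus ?thesis unfolding I_def by (simp add: integral_unique)
  qed
  have "(I has_real_derivative D s) (at s within {s-1..s+1})" unfolding I_def
    by (rule integral_has_real_derivative) (auto intro: continuous_on_subset[OF D])
  hence "(I has_real_derivative D s) (at s)"
    using at_within_interior[of s "{s-1..s+1}"] by auto
  hence "((\<lambda>x. I x + p (s-1)) has_real_derivative D s) (at s)"
    by (auto intro!: derivative_eq_intros)
  thus ?thesis
  proof (rule has_field_derivative_transform_within_open[where S="{s-1<..}"])
    fix x assume "x \<in> {s-1<..}"
    thus "I x + p (s-1) = p x" using I[of x] by simp
  qed auto
qed

section \<open>Integration by parts and derivatives along rays\<close>

lemma
  fixes h :: "'a::euclidean_space \<Rightarrow> real"
  assumes "integrable lborel h"
  shows integrable_lborel_translate: "integrable lborel (\<lambda>y. h (y + c))"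
    and integral_lborel_translate: "(\<integral>y. h (y + c) \<partial>lborel) = (\<integral>y. h y \<partial>lborel)"
proof -
  have *: "integrable (distr lborel borel ((+) c)) h" unfolding lborel_distr_plus by fact
  show "integrable lborel (\<lambda>y. h (y + c))"
    using integrable_distr[OF _ *] by (simp add: add.commute)
  have "(\<integral>y. h y \<partial>distr lborel borel ((+) c)) = (\<integral>y. h (c + y) \<partial>lborel)"
    by (rule integral_distr) (use assms in auto)
  thus "(\<integral>y. h (y + c) \<partial>lborel) = (\<integral>y. h y \<partial>lborel)"
    by (simp add: add.commute lborel_distr_plus)
qed

text \<open>Averaging over translates by \<open>s b\<close> with \<open>0 \<le> s \<le> 1\<close> does not change the integral of \<open>H\<close>;
  by Fubini it becomes the integral of \<open>K (y + b) - K y\<close>, which vanishes by translation invariance.\<close>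

lemma integral_directional_derivative_eq_0:
  fixes K H :: "'a::euclidean_space \<Rightarrow> real"
  assumes K: "integrable lborel K" and H: "integrable lborel H"
    and cont: "\<And>y. continuous_on UNIV (\<lambda>s. K (y + s *\<^sub>R b))"
    and fin: "\<And>y. finite (S y)"
    and der: "\<And>y s. s \<notin> S y \<Longrightarrow> ((\<lambda>s. K (y + s *\<^sub>R b)) has_real_derivative H (y + s *\<^sub>R b)) (at s)"
  shows "(\<integral>y. H y \<partial>lborel) = 0"
proof -
  define h where "h s y = indicator {0..1} s * H (y + s *\<^sub>R b)" for s :: real and y
  have [measurable]: "H \<in> borel_measurable borel" using H by auto
  \<comment> \<open>For fixed \<open>s\<close> the section is a translate of \<open>H\<close>, so
    its norm has the same integral for every \<open>s\<close> in the unit interval.\<close>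
  have hint: "integrable (lborel \<Otimes>\<^sub>M lborel) (case_prod h)"
  proof (rule lborel_pair.Fubini_integrable)
    show "case_prod h \<in> borel_measurable (lborel \<Otimes>\<^sub>M lborel)" unfolding h_def by measurable
    have "(\<integral>y. norm (case_prod h (s,y)) \<partial>lborel) = indicator {0..1} s * (\<integral>y. norm (H y) \<partial>lborel)" for s
      unfolding h_def using integral_lborel_translate[of "\<lambda>y. norm (H y)" "s *\<^sub>R b"] H
      by (auto simp: abs_mult indicator_def)
    thus "integrable lborel (\<lambda>s. \<integral>y. norm (case_prod h (s,y)) \<partial>lborel)"
      by (simp only:) (auto intro!: integrable_mult_left integrable_real_indicator)
    show "AE s in lborel. integrable lborel (\<lambda>y. case_prod h (s,y))"
      unfolding h_def using integrable_lborel_translate[OF H] by (auto intro!: integrable_mult_right)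
  qed
  have "(\<integral>y. H y \<partial>lborel) = (\<integral>s. indicator {0..1} (s::real) * (\<integral>y. H y \<partial>lborel) \<partial>lborel)"
    by simp
  also have "\<dots> = (\<integral>s. (\<integral>y. h s y \<partial>lborel) \<partial>lborel)"
    unfolding h_def using integral_lborel_translate[OF H] by simp
  also have "\<dots> = (\<integral>y. (\<integral>s. h s y \<partial>lborel) \<partial>lborel)"
    using lborel_pair.Fubini_integral[OF hint] by simp
  also have "\<dots> = (\<integral>y. K (y + b) - K y \<partial>lborel)"
  proof (rule integral_cong_AE)
    show "AE y in lborel. (\<integral>s. h s y \<partial>lborel) = K (y + b) - K y"
      using lborel_pair.AE_integrable_snd[OF hint]
    proof eventually_elim
      fix y assume "integrable lborel (\<lambda>s. h s y)"
      hence "set_integrable lborel {0..1} (\<lambda>s. H (y + s *\<^sub>R b))"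
        unfolding h_def set_integrable_def by simp
      from set_borel_integral_eq_integral(2)[OF this]
      have "(\<integral>s. h s y \<partial>lborel) = integral {0..1} (\<lambda>s. H (y + s *\<^sub>R b))"
        unfolding h_def set_lebesgue_integral_def by simp
      also have "((\<lambda>s. H (y + s *\<^sub>R b)) has_integral (K (y + 1 *\<^sub>R b) - K (y + 0 *\<^sub>R b))) {0..1}"
        by (rule fundamental_theorem_of_calculus_interior_strong[OF fin[of y]])
          (use der in \<open>auto intro!: continuous_on_subset[OF cont] simp: has_real_derivative_iff_has_vector_derivative[symmetric]\<close>)
      hence "integral {0..1} (\<lambda>s. H (y + s *\<^sub>R b)) = K (y + b) - K y"
        by (simp add: integral_unique)
      finally show "(\<integral>s. h s y \<partial>lborel) = K (y + b) - K y" .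
    qed
    show "(\<lambda>y. \<integral>s. h s y \<partial>lborel) \<in> borel_measurable lborel"
      using lborel_pair.integrable_snd[OF hint] by auto
    show "(\<lambda>y. K (y + b) - K y) \<in> borel_measurable lborel"
      using integrable_lborel_translate[OF K, of b] K by auto
  qed
  also have "\<dots> = 0"
    using integral_lborel_translate[OF K, of b] integrable_lborel_translate[OF K, of b] K by simp
  finally show ?thesis .
qed

lemma vec_sum_axis:
  fixes x :: "real ^ 'n"
  shows "(\<Sum>i\<in>UNIV. x $ i *\<^sub>R axis i 1) = x"
  by (simp add: vec_eq_iff sum_component axis_def if_distrib cong: if_cong)

text \<open>Continuous first partials suffice for the chain rule. Coordinates of \<open>z\<close>
  are added one at a time: the induction hypothesis differentiates in the old directions at one
  point, and continuity of the new partial derivative joins the two.\<close>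

lemma DERIV_along_ray:
  fixes F :: "real ^ 'n \<Rightarrow> real"
  assumes F1: "\<And>i. continuous_on UNIV (F1 i)"
    and der: "\<And>i x. ((\<lambda>s. F (x + s *\<^sub>R axis i 1)) has_real_derivative F1 i x) (at 0)"
  shows "((\<lambda>t. F (t *\<^sub>R z)) has_real_derivative (\<Sum>i\<in>UNIV. z $ i * F1 i (t *\<^sub>R z))) (at t)"
proof -
  define zz where "zz A = (\<Sum>i\<in>A. z $ i *\<^sub>R axis i 1 :: real ^ 'n)" for A :: "'n set"
  have der': "((\<lambda>s. F (x + s *\<^sub>R axis i 1)) has_real_derivative F1 i (x + r *\<^sub>R axis i 1)) (at r)" for i x r
    using DERIV_shift[of "\<lambda>s. F (x + s *\<^sub>R axis i 1)" _ 0 r] der[of "x + r *\<^sub>R axis i 1" i]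
    by (simp add: algebra_simps)
  have "((\<lambda>h. F (p + h *\<^sub>R zz A)) has_real_derivative (\<Sum>i\<in>A. z $ i * F1 i p)) (at 0)"
    if "finite A" for A p using that
  proof induction
    case empty
    show ?case by (simp add: zz_def)
  next
    case (insert j A)
    have zi: "zz (insert j A) = z $ j *\<^sub>R axis j 1 + zz A" using insert by (simp add: zz_def)
    let ?f = "\<lambda>h r. F (p + h *\<^sub>R zz A + r *\<^sub>R axis j 1)"
    let ?fy = "\<lambda>h r. blinfun_scaleR_left (F1 j (p + h *\<^sub>R zz A + r *\<^sub>R axis j 1)) :: real \<Rightarrow>\<^sub>L real"
    have "((\<lambda>(h, r). ?f h r) has_derivative (\<lambda>(th, tr). (\<Sum>i\<in>A. z $ i * F1 i p) * th + ?fy 0 0 tr)) (at (0,0) within UNIV \<times> UNIV)"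
    proof (rule has_derivative_partialsI[where fy="?fy"])
      show "((\<lambda>h. ?f h 0) has_derivative (\<lambda>th. (\<Sum>i\<in>A. z $ i * F1 i p) * th)) (at 0 within UNIV)"
        using insert.IH by (simp add: has_field_derivative_def)
      show "((\<lambda>r. ?f h r) has_derivative blinfun_apply (?fy h r)) (at r within UNIV)" for h r
        using der'[of "p + h *\<^sub>R zz A" j r] by (simp add: has_field_derivative_def mult_commute_abs)
      have "continuous_on UNIV (\<lambda>(h, r). ?fy h r)" unfolding case_prod_unfold
        by (intro bounded_linear.continuous_on[OF bounded_linear_blinfun_scaleR_left] continuous_on_compose2[OF F1])
          (auto intro!: continuous_intros)
      thus "continuous (at (0,0) within UNIV \<times> UNIV) (\<lambda>(h, r). ?fy h r)"
        by (simp add: continuous_on_eq_continuous_within)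
    qed auto
    \<comment> \<open>The base point is written \<open>(0, z $ j * 0)\<close> to match the line
      \<open>(h, z $ j * h)\<close> at \<open>h = 0\<close> in the composition below.\<close>
    hence D: "((\<lambda>(h, r). ?f h r) has_derivative (\<lambda>(th, tr). (\<Sum>i\<in>A. z $ i * F1 i p) * th + F1 j p * tr)) (at (0, z $ j * 0))"
      by (simp add: mult.commute)
    have "((\<lambda>h. (\<lambda>(h, r). ?f h r) (h, z $ j * h)) has_derivative
        (\<lambda>h. (\<lambda>(th, tr). (\<Sum>i\<in>A. z $ i * F1 i p) * th + F1 j p * tr) (h, z $ j * h))) (at 0)"
      by (rule has_derivative_compose[where f="\<lambda>h. (h, z $ j * h)", OF _ D]) (auto intro!: derivative_eq_intros)
    moreover have "(\<lambda>h. (\<lambda>(th, tr). (\<Sum>i\<in>A. z $ i * F1 i p) * th + F1 j p * tr) (h, z $ j * h)) =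
        (*) (\<Sum>i\<in>insert j A. z $ i * F1 i p)"
      using insert by (simp add: fun_eq_iff algebra_simps)
    ultimately show ?case
      by (simp add: has_field_derivative_def zi algebra_simps)
  qed
  from this[of UNIV "t *\<^sub>R z"]
  have "((\<lambda>h. F (t *\<^sub>R z + h *\<^sub>R z)) has_real_derivative (\<Sum>i\<in>UNIV. z $ i * F1 i (t *\<^sub>R z))) (at 0)"
    by (simp add: zz_def vec_sum_axis)
  thus ?thesis
    using DERIV_shift[of "\<lambda>s. F (s *\<^sub>R z)" _ 0 t] by (simp add: algebra_simps)
qed

section \<open>Polar coordinates\<close>

lemma nn_integral_scale_euclidean:
  fixes Q :: "'a::euclidean_space \<Rightarrow> ennreal"
  assumes [measurable]: "Q \<in> borel_measurable borel" and "c \<noteq> 0"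
  shows "(\<integral>\<^sup>+y. Q y \<partial>lborel) = ennreal (\<bar>c\<bar> ^ DIM('a)) * (\<integral>\<^sup>+y. Q (c *\<^sub>R y) \<partial>lborel)"
proof -
  have "(\<integral>\<^sup>+y. Q y \<partial>lborel) = (\<integral>\<^sup>+y. Q y \<partial>density (distr lborel borel (\<lambda>x. 0 + c *\<^sub>R x)) (\<lambda>_. ennreal (\<bar>c\<bar>^DIM('a))))"
    using lborel_affine[OF assms(2), of "0::'a"] by simp
  also have "\<dots> = ennreal (\<bar>c\<bar> ^ DIM('a)) * (\<integral>\<^sup>+y. Q (c *\<^sub>R y) \<partial>lborel)"
    by (simp add: nn_integral_density nn_integral_distr nn_integral_cmult)
  finally show ?thesis .
qed

lemma nn_integral_power_tail:
  fixes a :: real assumes "a > 0" "d > 0"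
  shows "(\<integral>\<^sup>+s. ennreal (indicator {a<..} s * (real d * a ^ d / s ^ (d+1))) \<partial>lborel) = 1"
proof -
  have *: "(\<integral>\<^sup>+s. ennreal (real d * a ^ d / s ^ (d+1)) * indicator {a..} s \<partial>lborel) = ennreal (0 - (- (a ^ d / a ^ d)))"
  proof (rule nn_integral_FTC_atLeast[where F="\<lambda>s. - (a ^ d / s ^ d)"])
    fix s assume s: "a \<le> s"
    hence "s > 0" using assms by simp
    have "((\<lambda>s. - (a ^ d / s ^ d)) has_real_derivative (a ^ d * (real d * s ^ (d - Suc 0)) / (s ^ d * s ^ d))) (at s)"
      using \<open>s > 0\<close> by (auto intro!: derivative_eq_intros)
    moreover have "a ^ d * (real d * s ^ (d - Suc 0)) / (s ^ d * s ^ d) = real d * a ^ d / s ^ (d+1)"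
      using \<open>s > 0\<close> \<open>d > 0\<close> by (cases d) (auto simp: field_simps)
    ultimately show "((\<lambda>s. - (a ^ d / s ^ d)) has_real_derivative real d * a ^ d / s ^ (d+1)) (at s)" by simp
    show "0 \<le> real d * a ^ d / s ^ (d+1)" using \<open>s > 0\<close> assms by simp
  next
    have "((\<lambda>s. - (a ^ d / s ^ d)) \<longlongrightarrow> - 0) at_top"
      by (intro tendsto_minus tendsto_divide_0[OF tendsto_const] filterlim_at_top_imp_at_infinity filterlim_pow_at_top)
        (use assms in \<open>auto intro: filterlim_ident\<close>)
    thus "((\<lambda>s. - (a ^ d / s ^ d)) \<longlongrightarrow> 0) at_top" by simp
  qed simp
  have "(\<integral>\<^sup>+s. ennreal (indicator {a<..} s * (real d * a ^ d / s ^ (d+1))) \<partial>lborel) =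
    (\<integral>\<^sup>+s. ennreal (real d * a ^ d / s ^ (d+1)) * indicator {a..} s \<partial>lborel)"
  proof (rule nn_integral_cong_AE)
    have "AE s in lborel. s \<noteq> a" by (rule AE_lborel_singleton)
    thus "AE s in lborel. ennreal (indicator {a<..} s * (real d * a ^ d / s ^ (d+1))) = ennreal (real d * a ^ d / s ^ (d+1)) * indicator {a..} s"
      by eventually_elim (auto simp: indicator_def)
  qed
  thus ?thesis using * assms by simp
qed

text \<open>Only scaling and Tonelli are used: with \<open>r = s |y|\<close> and then \<open>z = s y\<close> the right-hand side
  becomes \<open>\<integral> Q z (\<integral>\<^bsub>s > |z|\<^esub> d |z|\<^sup>d / s\<^bsup>d+1\<^esup> ds) dz\<close>, whose inner integral is 1.\<close>

lemma nn_integral_polar: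
  fixes Q :: "'a::euclidean_space \<Rightarrow> ennreal"
  assumes [measurable]: "Q \<in> borel_measurable borel"
  shows "(\<integral>\<^sup>+z. Q z \<partial>lborel) =
    (\<integral>\<^sup>+r. \<integral>\<^sup>+y. ennreal (indicator {0<..} r * r ^ (DIM('a) - 1) * (real DIM('a) * indicator {y. norm y < 1} y)) *
       Q (r *\<^sub>R (y /\<^sub>R norm y)) \<partial>lborel \<partial>lborel)"
proof -
  let ?d = "DIM('a)"
  have d: "?d > 0" by simp
  have dS: "a ^ (?d - 1) * a = a ^ ?d" for a :: real using power_minus_mult[OF d, of a] by simp
  have "(\<integral>\<^sup>+r. \<integral>\<^sup>+y. ennreal (indicator {0<..} r * r ^ (?d - 1) * (real ?d * indicator {y. norm y < 1} y)) *
       Q (r *\<^sub>R (y /\<^sub>R norm y)) \<partial>lborel \<partial>lborel) =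
    (\<integral>\<^sup>+y. \<integral>\<^sup>+r. ennreal (indicator {0<..} r * r ^ (?d - 1) * (real ?d * indicator {y. norm y < 1} y)) *
       Q (r *\<^sub>R (y /\<^sub>R norm y)) \<partial>lborel \<partial>lborel)"
    by (rule lborel_pair.Fubini'[symmetric]) measurable
  also have "\<dots> = (\<integral>\<^sup>+y. \<integral>\<^sup>+s. ennreal (indicator {0<..} s * s ^ (?d - 1) * norm y ^ ?d * (real ?d * indicator {y. norm y < 1} y)) *
       Q (s *\<^sub>R y) \<partial>lborel \<partial>lborel)"
  proof (rule nn_integral_cong_AE)
    have "AE y in lborel. y \<noteq> (0::'a)" by (rule AE_lborel_singleton)
    thus "AE y in lborel. (\<integral>\<^sup>+r. ennreal (indicator {0<..} r * r ^ (?d - 1) * (real ?d * indicator {y. norm y < 1} y)) *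
         Q (r *\<^sub>R (y /\<^sub>R norm y)) \<partial>lborel) =
       (\<integral>\<^sup>+s. ennreal (indicator {0<..} s * s ^ (?d - 1) * norm y ^ ?d * (real ?d * indicator {y. norm y < 1} y)) *
         Q (s *\<^sub>R y) \<partial>lborel)"
    proof eventually_elim
      case (elim y)
      hence y: "norm y > 0" by simp
      have "(\<integral>\<^sup>+r. ennreal (indicator {0<..} r * r ^ (?d - 1) * (real ?d * indicator {y. norm y < 1} y)) *
         Q (r *\<^sub>R (y /\<^sub>R norm y)) \<partial>lborel) =
        ennreal \<bar>norm y\<bar> * (\<integral>\<^sup>+s. ennreal (indicator {0<..} (0 + norm y * s) * (0 + norm y * s) ^ (?d - 1) * (real ?d * indicator {y. norm y < 1} y)) *
         Q ((0 + norm y * s) *\<^sub>R (y /\<^sub>R norm y)) \<partial>lborel)"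
        using y by (intro nn_integral_real_affine) auto
      also have "\<dots> = (\<integral>\<^sup>+s. ennreal (norm y) * (ennreal (indicator {0<..} (norm y * s) * (norm y * s) ^ (?d - 1) * (real ?d * indicator {y. norm y < 1} y)) *
         Q ((norm y * s) *\<^sub>R (y /\<^sub>R norm y))) \<partial>lborel)"
        by (subst nn_integral_cmult) auto
      also have "\<dots> = (\<integral>\<^sup>+s. ennreal (indicator {0<..} s * s ^ (?d - 1) * norm y ^ ?d * (real ?d * indicator {y. norm y < 1} y)) *
         Q (s *\<^sub>R y) \<partial>lborel)"
      proof (rule nn_integral_cong)
        fix s :: real
        have 1: "(norm y * s) *\<^sub>R (y /\<^sub>R norm y) = s *\<^sub>R y" using y by simp
        have 2: "indicator {0<..} (norm y * s) = (indicator {0<..} s :: real)"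
          using y by (auto simp: indicator_def zero_less_mult_iff)
        have "ennreal (norm y) * ennreal (indicator {0<..} s * (norm y * s) ^ (?d - 1) * (real ?d * indicator {y. norm y < 1} y)) =
           ennreal (norm y * (indicator {0<..} s * (norm y * s) ^ (?d - 1) * (real ?d * indicator {y. norm y < 1} y)))"
          by (subst ennreal_mult[symmetric]) (auto simp: indicator_def)
        also have "norm y * (indicator {0<..} s * (norm y * s) ^ (?d - 1) * (real ?d * indicator {y. norm y < 1} y)) =
           indicator {0<..} s * s ^ (?d - 1) * (norm y ^ (?d - 1) * norm y) * (real ?d * indicator {y. norm y < 1} y)"
          by (simp only: power_mult_distrib mult_ac)
        finally show "ennreal (norm y) * (ennreal (indicator {0<..} (norm y * s) * (norm y * s) ^ (?d - 1) * (real ?d * indicator {y. norm y < 1} y)) *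
         Q ((norm y * s) *\<^sub>R (y /\<^sub>R norm y))) = ennreal (indicator {0<..} s * s ^ (?d - 1) * norm y ^ ?d * (real ?d * indicator {y. norm y < 1} y)) *
         Q (s *\<^sub>R y)" unfolding 1 2 dS by (simp add: mult.assoc[symmetric])
      qed
      finally show ?case .
    qed
  qed
  also have "\<dots> = (\<integral>\<^sup>+s. \<integral>\<^sup>+y. ennreal (indicator {0<..} s * s ^ (?d - 1) * norm y ^ ?d * (real ?d * indicator {y. norm y < 1} y)) *
       Q (s *\<^sub>R y) \<partial>lborel \<partial>lborel)"
    by (rule lborel_pair.Fubini') measurable
  also have "\<dots> = (\<integral>\<^sup>+s. \<integral>\<^sup>+z. ennreal (indicator {norm z<..} s * (real ?d * norm z ^ ?d / s ^ (?d + 1))) * Q z \<partial>lborel \<partial>lborel)"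
  proof (rule nn_integral_cong)
    fix s :: real
    show "(\<integral>\<^sup>+y. ennreal (indicator {0<..} s * s ^ (?d - 1) * norm y ^ ?d * (real ?d * indicator {y. norm y < 1} y)) *
       Q (s *\<^sub>R y) \<partial>lborel) = (\<integral>\<^sup>+z. ennreal (indicator {norm z<..} s * (real ?d * norm z ^ ?d / s ^ (?d + 1))) * Q z \<partial>lborel)"
    proof (cases "s > 0")
      case False
      hence "indicator {0<..} s = (0::real)" "\<And>z::'a. indicator {norm z<..} s = (0::real)"
        by (auto simp: indicator_def not_less intro: order_trans)
      thus ?thesis by simp
    next
      case True
      have "(\<integral>\<^sup>+z. ennreal (indicator {norm z<..} s * (real ?d * norm z ^ ?d / s ^ (?d + 1))) * Q z \<partial>lborel) =
        ennreal (\<bar>s\<bar> ^ ?d) * (\<integral>\<^sup>+y. ennreal (indicator {norm (s *\<^sub>R y)<..} s * (real ?d * norm (s *\<^sub>R y) ^ ?d / s ^ (?d + 1))) * Q (s *\<^sub>R y) \<partial>lborel)"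
        using True by (intro nn_integral_scale_euclidean) (auto simp: greaterThan_def)
      also have "\<dots> = (\<integral>\<^sup>+y. ennreal (\<bar>s\<bar> ^ ?d) * (ennreal (indicator {norm (s *\<^sub>R y)<..} s * (real ?d * norm (s *\<^sub>R y) ^ ?d / s ^ (?d + 1))) * Q (s *\<^sub>R y)) \<partial>lborel)"
        by (subst nn_integral_cmult) (auto simp: greaterThan_def)
      also have "\<dots> = (\<integral>\<^sup>+y. ennreal (indicator {0<..} s * s ^ (?d - 1) * norm y ^ ?d * (real ?d * indicator {y. norm y < 1} y)) *
       Q (s *\<^sub>R y) \<partial>lborel)"
      proof (rule nn_integral_cong)
        fix y :: 'a
        have 1: "indicator {norm (s *\<^sub>R y)<..} s = (indicator {y. norm y < 1} y :: real)"
          using True by (auto simp: indicator_def)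
        have "ennreal (\<bar>s\<bar> ^ ?d) * ennreal (indicator {y. norm y < 1} y * (real ?d * norm (s *\<^sub>R y) ^ ?d / s ^ (?d + 1))) =
          ennreal (s ^ ?d * (indicator {y. norm y < 1} y * (real ?d * norm (s *\<^sub>R y) ^ ?d / s ^ (?d + 1))))"
          using True by (subst ennreal_mult[symmetric]) (auto simp: indicator_def)
        also have "s ^ ?d * (indicator {y. norm y < 1} y * (real ?d * norm (s *\<^sub>R y) ^ ?d / s ^ (?d + 1))) =
           indicator {y. norm y < 1} y * real ?d * norm y ^ ?d * (s ^ ?d / s)"
          using True by (simp add: power_mult_distrib field_simps)
        also have "s ^ ?d / s = s ^ (?d - 1)" using dS[of s] True by (simp add: field_simps)
        finally show "ennreal (\<bar>s\<bar> ^ ?d) * (ennreal (indicator {norm (s *\<^sub>R y)<..} s * (real ?d * norm (s *\<^sub>R y) ^ ?d / s ^ (?d + 1))) * Q (s *\<^sub>R y)) =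
           ennreal (indicator {0<..} s * s ^ (?d - 1) * norm y ^ ?d * (real ?d * indicator {y. norm y < 1} y)) * Q (s *\<^sub>R y)"
          unfolding 1 using True by (simp add: mult_ac)
      qed
      finally show ?thesis by simp
    qed
  qed
  also have "\<dots> = (\<integral>\<^sup>+z. \<integral>\<^sup>+s. ennreal (indicator {norm z<..} s * (real ?d * norm z ^ ?d / s ^ (?d + 1))) * Q z \<partial>lborel \<partial>lborel)"
    by (rule lborel_pair.Fubini') (auto simp: greaterThan_def)
  also have "\<dots> = (\<integral>\<^sup>+z. Q z \<partial>lborel)"
  proof (rule nn_integral_cong_AE)
    have "AE z in lborel. z \<noteq> (0::'a)" by (rule AE_lborel_singleton)
    thus "AE z in lborel. (\<integral>\<^sup>+s. ennreal (indicator {norm z<..} s * (real ?d * norm z ^ ?d / s ^ (?d + 1))) * Q z \<partial>lborel) = Q z"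
    proof eventually_elim
      case (elim z)
      thus ?case using nn_integral_power_tail[of "norm z" ?d]
        by (subst nn_integral_multc) (auto simp: greaterThan_def)
    qed
  qed
  finally show ?thesis by simp
qed

section \<open>Beta integrals\<close>

text \<open>The Gamma and Beta integrals are gauge integrals, while masses of measures are
  nonnegative Lebesgue integrals. A nonnegative integrand is absolutely integrable, so a single
  change of variables links the two.\<close>

lemma nn_integral_substitution_has_integral:
  fixes f h h' :: "real \<Rightarrow> real"
  assumes S: "S \<in> sets borel" and inj: "inj_on h S"
    and der: "\<And>x. x \<in> S \<Longrightarrow> (h has_real_derivative h' x) (at x)"
    and f: "(f has_integral I) (h ` S)" and nonneg: "\<And>x. x \<in> S \<Longrightarrow> 0 \<le> f (h x)"
    and eq: "\<And>x. x \<in> S \<Longrightarrow> q x = \<bar>h' x\<bar> * f (h x)"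
  shows "(\<integral>\<^sup>+x. ennreal (q x) * indicator S x \<partial>lborel) = ennreal I"
proof -
  have "f absolutely_integrable_on (h ` S)"
    using f nonneg by (intro nonnegative_absolutely_integrable_1) auto
  moreover have "integral (h ` S) f = I" using f by (rule integral_unique)
  ultimately have "(\<lambda>x. \<bar>h' x\<bar> * f (h x)) absolutely_integrable_on S \<and> integral S (\<lambda>x. \<bar>h' x\<bar> * f (h x)) = I"
    by (subst has_absolute_integral_change_of_variables_1'[OF _ _ inj])
      (use S der in \<open>auto intro: has_field_derivative_at_within\<close>)
  hence "((\<lambda>x. \<bar>h' x\<bar> * f (h x)) has_integral I) S"
    by (auto simp: has_integral_integral set_lebesgue_integral_eq_integral(1) dest: set_lebesgue_integral_eq_integral(1))
  hence "(\<integral>\<^sup>+x. ennreal (\<bar>h' x\<bar> * f (h x)) * indicator S x \<partial>lborel) = ennreal I"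
    using nonneg by (intro nn_integral_has_integral_lebesgue') auto
  moreover have "ennreal (q x) * indicator S x = ennreal (\<bar>h' x\<bar> * f (h x)) * indicator S x" for x
    using eq by (auto simp: indicator_def)
  ultimately show ?thesis by simp
qed

lemma power2_powr: "(s\<^sup>2) powr e = s powr e'" if "s > 0" "2 * e = e'" for s e e' :: real
proof -
  have "s\<^sup>2 = s powr 2" using that by simp
  thus ?thesis using that(2) by (simp only: powr_powr)
qed

text \<open>The Gamma integral under \<open>t = s^2\<close>. These moments serve both as the
  coordinate factors and as the radial factor in the computation of the mass of the weighted
  sphere.\<close>

lemma nn_integral_powr_gaussian:
  fixes a :: real assumes "a > -1"
  shows "(\<integral>\<^sup>+s. ennreal (indicator {0<..} s * (s powr a * exp (- s\<^sup>2))) \<partial>lborel) = ennreal (Gamma ((a + 1) / 2) / 2)"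
proof -
  have im: "(\<lambda>s::real. s\<^sup>2) ` {0<..} = {0<..}"
  proof (intro equalityI subsetI)
    fix x :: real assume "x \<in> {0<..}"
    thus "x \<in> (\<lambda>s::real. s\<^sup>2) ` {0<..}" by (intro image_eqI[of _ _ "sqrt x"]) auto
  qed auto
  have "((\<lambda>t. t powr ((a+1)/2 - 1) / exp t) has_integral Gamma ((a+1)/2)) {0..}"
    using assms by (intro Gamma_integral_real) auto
  \<comment> \<open>The substitution runs over positive \<open>s\<close>, so the null endpoint 0 of
    the Gamma integral is discarded.\<close>
  moreover have "negligible {t \<in> {0..} - {0<..}. t powr ((a+1)/2 - 1) / exp t \<noteq> 0}"
    by (rule negligible_subset[of "{0}"]) auto
  moreover have "negligible {t \<in> {0<..} - {0..}. t powr ((a+1)/2 - 1) / exp t \<noteq> 0}"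
    by (rule negligible_subset[of "{}"]) auto
  ultimately have "((\<lambda>t. t powr ((a+1)/2 - 1) / exp t) has_integral Gamma ((a+1)/2)) {0<..}"
    using has_integral_spike_set_eq[of "{0..}" "{0<..}" "\<lambda>t. t powr ((a+1)/2 - 1) / exp t"] by blast
  hence G: "((\<lambda>t. (t powr ((a+1)/2 - 1) / exp t) / 2) has_integral (Gamma ((a+1)/2) / 2)) {0<..}"
    by (rule has_integral_divide)
  have "(\<integral>\<^sup>+s. ennreal (s powr a * exp (- s\<^sup>2)) * indicator {0<..} s \<partial>lborel) = ennreal (Gamma ((a + 1) / 2) / 2)"
  proof (rule nn_integral_substitution_has_integral)
    show "((\<lambda>t. (t powr ((a+1)/2 - 1) / exp t) / 2) has_integral (Gamma ((a+1)/2) / 2)) ((\<lambda>s. s\<^sup>2) ` {0<..})"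
      using G im by simp
    show "inj_on (\<lambda>s::real. s\<^sup>2) {0<..}" by (auto simp: inj_on_def power2_eq_iff)
    show "((\<lambda>s. s\<^sup>2) has_real_derivative 2 * s) (at s)" for s :: real
      by (auto intro!: derivative_eq_intros)
    fix s :: real assume s: "s \<in> {0<..}"
    have "(s\<^sup>2) powr ((a+1)/2 - 1) = s powr (a - 1)"
      using s by (intro power2_powr) (auto simp: field_simps)
    moreover have "s * s powr (a - 1) = s powr a" using s by (simp add: powr_mult_base)
    ultimately show "s powr a * exp (- s\<^sup>2) = \<bar>2 * s\<bar> * ((s\<^sup>2) powr ((a+1)/2 - 1) / exp (s\<^sup>2) / 2)"
      using s by (simp add: exp_minus field_simps)
  qed auto
  moreover have "ennreal (indicator {0<..} s * (s powr a * exp (- s\<^sup>2))) = ennreal (s powr a * exp (- s\<^sup>2)) * indicator {0<..} s" for s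
    by (auto simp: indicator_def)
  ultimately show ?thesis by simp
qed

text \<open>The Beta integral under \<open>t = s^2\<close>; with \<open>a = sph_dim g\<close> it
  gives the mass of the radial profile in the ball formula.\<close>

lemma nn_integral_powr_ball:
  fixes a p :: real assumes "a > -1" "p > -1"
  shows "(\<integral>\<^sup>+s. ennreal (s powr a * (1 - s\<^sup>2) powr p) * indicator {0<..<1} s \<partial>lborel) = ennreal (Beta ((a + 1) / 2) (p + 1) / 2)"
proof -
  have im: "(\<lambda>s::real. s\<^sup>2) ` {0<..<1} = {0<..<1}"
  proof (intro equalityI subsetI)
    fix x :: real assume "x \<in> {0<..<1}"
    thus "x \<in> (\<lambda>s::real. s\<^sup>2) ` {0<..<1}" by (intro image_eqI[of _ _ "sqrt x"]) auto
  qed (auto simp: power_less_one_iff)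
  have "((\<lambda>t. t powr ((a+1)/2 - 1) * (1 - t) powr (p + 1 - 1)) has_integral Beta ((a+1)/2) (p+1)) {0<..<1}"
    using has_integral_Beta_real[of "(a+1)/2" "p+1"] assms by (simp add: has_integral_Icc_iff_Ioo)
  hence G: "((\<lambda>t. t powr ((a+1)/2 - 1) * (1 - t) powr (p + 1 - 1) / 2) has_integral (Beta ((a+1)/2) (p+1) / 2)) {0<..<1}"
    by (rule has_integral_divide)
  show ?thesis
  proof (rule nn_integral_substitution_has_integral)
    show "((\<lambda>t. t powr ((a+1)/2 - 1) * (1 - t) powr (p + 1 - 1) / 2) has_integral (Beta ((a+1)/2) (p+1) / 2)) ((\<lambda>s. s\<^sup>2) ` {0<..<1})"
      using G im by simp
    show "inj_on (\<lambda>s::real. s\<^sup>2) {0<..<1}" by (auto simp: inj_on_def power2_eq_iff)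
    show "((\<lambda>s. s\<^sup>2) has_real_derivative 2 * s) (at s)" for s :: real
      by (auto intro!: derivative_eq_intros)
    fix s :: real assume s: "s \<in> {0<..<1}"
    have "(s\<^sup>2) powr ((a+1)/2 - 1) = s powr (a - 1)"
      using s by (intro power2_powr) (auto simp: field_simps)
    moreover have "s * s powr (a - 1) = s powr a" using s by (simp add: powr_mult_base)
    ultimately show "s powr a * (1 - s\<^sup>2) powr p = \<bar>2 * s\<bar> * ((s\<^sup>2) powr ((a+1)/2 - 1) * (1 - s\<^sup>2) powr (p + 1 - 1) / 2)"
      using s by (simp add: field_simps)
  qed auto
qed

lemma nn_integral_sin_powr_half:
  fixes c :: real assumes "c > 0"
  shows "(\<integral>\<^sup>+s. ennreal (sin s powr (c - 1)) * indicator {0<..<pi/2} s \<partial>lborel) = ennreal (Beta (c / 2) (1 / 2) / 2)"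
proof -
  have sc: "sin s > 0 \<and> cos s > 0" if "s \<in> {0<..<pi/2}" for s
    using that by (auto intro!: sin_gt_zero cos_gt_zero_pi)
  have im: "(\<lambda>s::real. (sin s)\<^sup>2) ` {0<..<pi/2} = {0<..<1}"
  proof (intro equalityI subsetI)
    fix x :: real assume x: "x \<in> {0<..<1}"
    hence sq: "0 < sqrt x" "sqrt x < 1" by auto
    hence "arcsin (sqrt x) \<in> {0<..<pi/2}"
      using arcsin_less_arcsin[of "sqrt x" 1] arcsin_less_arcsin[of 0 "sqrt x"] arcsin_1 arcsin_0
      unfolding greaterThanLessThan_iff by linarith
    moreover have "sin (arcsin (sqrt x)) = sqrt x" using sq by (intro sin_arcsin) linarith+
    ultimately show "x \<in> (\<lambda>s::real. (sin s)\<^sup>2) ` {0<..<pi/2}"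
      using x by (intro image_eqI[of _ _ "arcsin (sqrt x)"]) auto
  next
    fix x assume "x \<in> (\<lambda>s::real. (sin s)\<^sup>2) ` {0<..<pi/2}"
    then obtain s where s: "s \<in> {0<..<pi/2}" "x = (sin s)\<^sup>2" by auto
    have "(sin s)\<^sup>2 = 1 - (cos s)\<^sup>2" by (simp add: sin_squared_eq)
    moreover have "0 < (sin s)\<^sup>2" "0 < (cos s)\<^sup>2" using sc[OF s(1)] by simp_all
    ultimately show "x \<in> {0<..<1}" unfolding s(2) greaterThanLessThan_iff by linarith
  qed
  have "((\<lambda>t. t powr (c/2 - 1) * (1 - t) powr (1/2 - 1)) has_integral Beta (c/2) (1/2)) {0<..<1}"
    using has_integral_Beta_real[of "c/2" "1/2"] assms by (simp add: has_integral_Icc_iff_Ioo)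
  hence G: "((\<lambda>t. t powr (c/2 - 1) * (1 - t) powr (1/2 - 1) / 2) has_integral (Beta (c/2) (1/2) / 2)) {0<..<1}"
    by (rule has_integral_divide)
  show ?thesis
  proof (rule nn_integral_substitution_has_integral)
    show "((\<lambda>t. t powr (c/2 - 1) * (1 - t) powr (1/2 - 1) / 2) has_integral (Beta (c/2) (1/2) / 2)) ((\<lambda>s. (sin s)\<^sup>2) ` {0<..<pi/2})"
      using G im by simp
    show "inj_on (\<lambda>s::real. (sin s)\<^sup>2) {0<..<pi/2}"
    proof (rule inj_onI)
      fix x y assume xy: "x \<in> {0<..<pi/2}" "y \<in> {0<..<pi/2}" "(sin x)\<^sup>2 = (sin y)\<^sup>2"
      hence "sin x = sin y" using sc[of x] sc[of y] by (simp add: power2_eq_iff)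
      moreover have "0 < x" "x < pi/2" "0 < y" "y < pi/2" using xy by auto
      ultimately show "x = y" using pi_gt_zero by - (rule sin_inj_pi, linarith+)
    qed
    show "((\<lambda>s. (sin s)\<^sup>2) has_real_derivative 2 * sin s * cos s) (at s)" for s :: real
      by (auto intro!: derivative_eq_intros)
    fix s :: real assume s: "s \<in> {0<..<pi/2}"
    note sc = sc[OF s]
    have "((sin s)\<^sup>2) powr (c/2 - 1) = sin s powr (c - 2)"
      using sc by (intro power2_powr) (auto simp: field_simps)
    moreover have "sin s * sin s powr (c - 2) = sin s powr (c - 1)" using sc by (simp add: powr_mult_base)
    moreover have "(1 - (sin s)\<^sup>2) powr (1/2 - 1) = cos s powr (-1)"
      unfolding cos_squared_eq[symmetric] using sc by (intro power2_powr) auto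
    moreover have "cos s powr (-1) = 1 / cos s" using sc by (simp add: powr_minus_divide)
    moreover have "\<bar>2 * sin s * cos s\<bar> = 2 * sin s * cos s" using sc by simp
    ultimately show "sin s powr (c - 1) = \<bar>2 * sin s * cos s\<bar> * (((sin s)\<^sup>2) powr (c/2 - 1) * (1 - (sin s)\<^sup>2) powr (1/2 - 1) / 2)"
      using sc by simp
  qed auto
qed

text \<open>The substitution \<open>t = sin^2 s\<close> behind the half-range formula is injective
  only up to \<open>pi/2\<close>; the reflection \<open>pi - s\<close> supplies the other
  half.\<close>

lemma nn_integral_sin_powr:
  fixes c :: real assumes "c > 0"
  shows "(\<integral>\<^sup>+s. ennreal (indicator {0..pi} s * sin s powr (c - 1)) \<partial>lborel) = ennreal (Beta (c / 2) (1 / 2))"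
proof -
  let ?w = "\<lambda>s. ennreal (sin s powr (c - 1))"
  have 1: "(\<integral>\<^sup>+s. ?w s * indicator {0<..<pi/2} s \<partial>lborel) = (\<integral>\<^sup>+s. ?w s * indicator {pi/2<..<pi} s \<partial>lborel)"
  proof -
    have "(\<integral>\<^sup>+s. ?w s * indicator {0<..<pi/2} s \<partial>lborel) = 
       ennreal \<bar>-1\<bar> * (\<integral>\<^sup>+s. ?w (pi + (-1) * s) * indicator {0<..<pi/2} (pi + (-1) * s) \<partial>lborel)"
      by (rule nn_integral_real_affine) auto
    also have "\<dots> = (\<integral>\<^sup>+s. ?w s * indicator {pi/2<..<pi} s \<partial>lborel)"
      by simp (intro nn_integral_cong, auto simp: indicator_def)
    finally show ?thesis .
  qed
  have "(\<integral>\<^sup>+s. ennreal (indicator {0..pi} s * sin s powr (c - 1)) \<partial>lborel) =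
     (\<integral>\<^sup>+s. ?w s * indicator {0<..<pi/2} s + ?w s * indicator {pi/2<..<pi} s \<partial>lborel)"
  proof (rule nn_integral_cong_AE)
    have "AE s in lborel. s \<noteq> 0" "AE s in lborel. s \<noteq> pi/2" "AE s in lborel. s \<noteq> pi"
      by (rule AE_lborel_singleton)+
    thus "AE s in lborel. ennreal (indicator {0..pi} s * sin s powr (c - 1)) = ?w s * indicator {0<..<pi/2} s + ?w s * indicator {pi/2<..<pi} s"
      by eventually_elim (auto simp: indicator_def)
  qed
  also have "\<dots> = (\<integral>\<^sup>+s. ?w s * indicator {0<..<pi/2} s \<partial>lborel) + (\<integral>\<^sup>+s. ?w s * indicator {pi/2<..<pi} s \<partial>lborel)"
    by (rule nn_integral_add) auto
  also have "\<dots> = ennreal (Beta (c / 2) (1 / 2) / 2) + ennreal (Beta (c / 2) (1 / 2) / 2)"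
    using 1 nn_integral_sin_powr_half[OF assms] by simp
  also have "\<dots> = ennreal (Beta (c / 2) (1 / 2))"
    using assms by (subst ennreal_plus[symmetric]) (auto simp: Beta_def intro!: divide_nonneg_pos mult_nonneg_nonneg less_imp_le Gamma_real_pos)
  finally show ?thesis .
qed

lemma nn_integral_vec_prod:
  fixes h :: "'n::finite \<Rightarrow> real \<Rightarrow> ennreal"
  assumes [measurable]: "\<And>i. h i \<in> borel_measurable borel"
  shows "(\<integral>\<^sup>+y. (\<Prod>i\<in>UNIV. h i (y $ i)) \<partial>(lborel :: (real ^ 'n) measure)) = (\<Prod>i\<in>UNIV. \<integral>\<^sup>+s. h i s \<partial>lborel)"
proof -
  \<comment> \<open>Products over Lebesgue measure are indexed by basis vectors; \<open>ix\<close>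
    recovers the coordinate from its basis vector.\<close>
  define ix where "ix b = (THE i. b = axis i (1::real))" for b :: "real ^ 'n"
  have ix: "ix (axis i 1) = i" for i unfolding ix_def by (auto simp: axis_eq_axis)
  have B: "(Basis :: (real ^ 'n) set) = range (\<lambda>i. axis i 1)"
    by (auto simp: Basis_vec_def)
  have inj: "inj (\<lambda>i. axis i (1::real) :: real ^ 'n)" by (auto simp: inj_def axis_eq_axis)
  have "(\<integral>\<^sup>+y. (\<Prod>b\<in>Basis. h (ix b) (y \<bullet> b)) \<partial>(lborel :: (real ^ 'n) measure)) = (\<Prod>b\<in>(Basis :: (real ^ 'n) set). \<integral>\<^sup>+s. h (ix b) s \<partial>lborel)"
    by (rule nn_integral_lborel_prod) auto
  thus ?thesis unfolding B by (simp add: prod.reindex[OF inj] ix inner_axis)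
qed

section \<open>The weighted sphere and orthant measures\<close>

text \<open>\<open>mpow\<close> extended by zero. Truncating each coordinate at 0 puts the
  restriction to the orthant into the density, and for positive exponents the result is continuous
  on the whole space.\<close>

definition orth_weight :: "real ^ 'n \<Rightarrow> real ^ 'n \<Rightarrow> real" where
  "orth_weight g z = (\<Prod>i\<in>UNIV. max 0 (z $ i) powr g $ i)"

lemma orth_weight_nonneg [simp]: "0 \<le> orth_weight g z"
  unfolding orth_weight_def by (intro prod_nonneg) auto

lemma orth_weight_eq: "orth_weight g z = indicator orth_open z * mpow z g"
proof (cases "z \<in> orth_open")
  case True
  hence "max 0 (z $ i) = z $ i" for i by (auto simp: orth_open_def max_def less_imp_le)
  thus ?thesis using True by (simp add: orth_weight_def mpow_def)
next
  case False
  then obtain i where "z $ i \<le> 0" by (auto simp: orth_open_def not_less)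
  hence "max 0 (z $ i) powr g $ i = 0" by simp
  thus ?thesis using False by (auto simp: orth_weight_def intro!: prod_zero)
qed

lemma continuous_on_orth_weight:
  assumes "\<forall>i. g $ i > 0"
  shows "continuous_on A (orth_weight g)"
  unfolding orth_weight_def
proof (intro continuous_on_prod)
  fix i
  have "g $ i > 0" using assms by blast
  thus "continuous_on A (\<lambda>z. max 0 (z $ i) powr g $ i)"
    by (intro continuous_on_powr') (auto intro!: continuous_intros)
qed

lemma borel_measurable_orth_weight [measurable]: "orth_weight g \<in> borel_measurable borel"
proof -
  have "(\<lambda>z. z $ i) \<in> borel_measurable (borel :: (real ^ 'n) measure)" for i
    by (intro borel_measurable_continuous_onI continuous_intros)
  thus ?thesis unfolding orth_weight_def by measurable
qed

lemma orth_weight_scale: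
  assumes "r > 0"
  shows "orth_weight g (r *\<^sub>R z) = r powr abs_multi g * orth_weight g z"
proof -
  have "max 0 (r * a) powr b = r powr b * max 0 a powr b" for a b
  proof -
    have "max 0 (r * a) = r * max 0 a" using assms by (simp add: max_mult_distrib_left)
    thus ?thesis using assms by (simp add: powr_mult)
  qed
  thus ?thesis using assms
    by (simp add: orth_weight_def prod.distrib abs_multi_def powr_sum)
qed

text \<open>Surface measure of the positive part of the sphere, weighted by \<open>\<theta>\<^sup>g\<close>, as the push-forward
  of a cone measure.\<close>

definition sph_measure :: "real ^ 'n \<Rightarrow> (real ^ 'n) measure" where
  "sph_measure g = distr (density lborel
     (\<lambda>y. ennreal (real CARD('n) * indicator {y. norm y < 1} y * orth_weight g (y /\<^sub>R norm y)))) borel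
     (\<lambda>y. y /\<^sub>R norm y)"

definition radial_measure :: "real \<Rightarrow> (real \<Rightarrow> real) \<Rightarrow> real measure" where
  "radial_measure m c = density lborel (\<lambda>r. ennreal (indicator {0<..} r * r powr m * c r))"

definition orth_measure :: "real ^ 'n \<Rightarrow> (real \<Rightarrow> real) \<Rightarrow> (real ^ 'n) measure" where
  "orth_measure g c = density lborel (\<lambda>y. ennreal (orth_weight g y * c (norm y)))"

text \<open>The power of \<open>r\<close> in weighted polar coordinates: \<open>n - 1\<close> from
  the surface and \<open>|g|\<close> from the homogeneity of the weight. It is the critical value of
  \<open>k\<close> in the theorem.\<close>

definition sph_dim :: "real ^ 'n \<Rightarrow> real" where
  "sph_dim g = real CARD('n) + abs_multi g - 1"

lemma sets_sph_measure [simp, measurable_cong]: "sets (sph_measure g) = sets borel"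
  and sets_radial_measure [simp, measurable_cong]: "sets (radial_measure m c) = sets borel"
  and sets_orth_measure [simp, measurable_cong]: "sets (orth_measure g c) = sets borel"
  by (simp_all add: sph_measure_def radial_measure_def orth_measure_def)

lemma space_sph_measure [simp]: "space (sph_measure g) = UNIV"
  and space_radial_measure [simp]: "space (radial_measure m c) = UNIV"
  and space_orth_measure [simp]: "space (orth_measure g c) = UNIV"
  by (simp_all add: sph_measure_def radial_measure_def orth_measure_def)

lemma nn_integral_sph_measure:
  fixes g :: "real ^ 'n"
  assumes [measurable]: "Q \<in> borel_measurable borel"
  shows "(\<integral>\<^sup>+z. Q z \<partial>sph_measure g) =
    (\<integral>\<^sup>+y. ennreal (real CARD('n) * indicator {y. norm y < 1} y * orth_weight g (y /\<^sub>R norm y)) * Q (y /\<^sub>R norm y) \<partial>lborel)"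
  unfolding sph_measure_def by (simp add: nn_integral_distr nn_integral_density)

lemma AE_sph_measure: "AE z in sph_measure g. norm z = 1"
proof -
  have "AE y in lborel. y \<noteq> (0 :: real ^ 'n)" by (rule AE_lborel_singleton)
  hence "AE y in lborel. norm ((y :: real ^ 'n) /\<^sub>R norm y) = 1" by eventually_elim simp
  hence "AE y in density lborel
     (\<lambda>y. ennreal (real CARD('n) * indicator {y. norm y < 1} y * orth_weight g (y /\<^sub>R norm y))). norm (y /\<^sub>R norm y) = 1"
    by (subst AE_density) auto
  thus ?thesis unfolding sph_measure_def by (subst AE_distr_iff) auto
qed

text \<open>Polar coordinates combined with homogeneity: the weight at \<open>r z\<close>
  contributes \<open>r powr abs_multi g\<close>, which merges with \<open>r^(n-1)\<close> into
  \<open>r powr sph_dim g\<close>.\<close>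

lemma nn_integral_orth_measure_polar:
  fixes g :: "real ^ 'n" and Q :: "real ^ 'n \<Rightarrow> ennreal"
  assumes [measurable]: "Q \<in> borel_measurable borel" "c \<in> borel_measurable borel" and c: "\<And>r. 0 \<le> c r"
  shows "(\<integral>\<^sup>+y. Q y \<partial>orth_measure g c) = (\<integral>\<^sup>+r. \<integral>\<^sup>+z. Q (r *\<^sub>R z) \<partial>sph_measure g \<partial>radial_measure (sph_dim g) c)"
proof -
  have "(\<integral>\<^sup>+y. Q y \<partial>orth_measure g c) = (\<integral>\<^sup>+y. ennreal (orth_weight g y * c (norm y)) * Q y \<partial>lborel)"
    unfolding orth_measure_def by (rule nn_integral_density) auto
  also have "\<dots> = (\<integral>\<^sup>+r. \<integral>\<^sup>+y. ennreal (indicator {0<..} r * r ^ (CARD('n) - 1) * (real CARD('n) * indicator {y. norm y < 1} y)) *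
       (ennreal (orth_weight g (r *\<^sub>R (y /\<^sub>R norm y)) * c (norm (r *\<^sub>R (y /\<^sub>R norm y)))) * Q (r *\<^sub>R (y /\<^sub>R norm y))) \<partial>lborel \<partial>lborel)"
    by (subst nn_integral_polar) auto
  also have "\<dots> = (\<integral>\<^sup>+r. \<integral>\<^sup>+y. ennreal (indicator {0<..} r * r powr sph_dim g * c r) *
       (ennreal (real CARD('n) * indicator {y. norm y < 1} y * orth_weight g (y /\<^sub>R norm y)) * Q (r *\<^sub>R (y /\<^sub>R norm y))) \<partial>lborel \<partial>lborel)"
  proof (rule nn_integral_cong, rule nn_integral_cong_AE)
    fix r :: real
    have "AE y in lborel. y \<noteq> (0 :: real ^ 'n)" by (rule AE_lborel_singleton)
    thus "AE y in lborel. ennreal (indicator {0<..} r * r ^ (CARD('n) - 1) * (real CARD('n) * indicator {y. norm y < 1} y)) *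
       (ennreal (orth_weight g (r *\<^sub>R (y /\<^sub>R norm y)) * c (norm (r *\<^sub>R (y /\<^sub>R norm y)))) * Q (r *\<^sub>R (y /\<^sub>R norm y))) =
       ennreal (indicator {0<..} r * r powr sph_dim g * c r) *
       (ennreal (real CARD('n) * indicator {y. norm y < 1} y * orth_weight g (y /\<^sub>R norm y)) * Q (r *\<^sub>R (y /\<^sub>R norm y)))"
    proof eventually_elim
      case (elim y)
      show ?case
      proof (cases "r > 0")
        case False
        thus ?thesis by simp
      next
        case True
        have n: "norm (r *\<^sub>R (y /\<^sub>R norm y)) = r" using elim True by simp
        have "r ^ (CARD('n) - 1) = r powr (real CARD('n) - 1)"
          using True by (simp add: powr_realpow[symmetric] of_nat_diff)
        hence pw: "r ^ (CARD('n) - 1) * r powr abs_multi g = r powr sph_dim g"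
          by (simp add: sph_dim_def powr_add[symmetric] algebra_simps)
        let ?i = "indicator {y. norm y < 1} y :: real" and ?o = "orth_weight g (y /\<^sub>R norm y)"
        have "ennreal (indicator {0<..} r * r ^ (CARD('n) - 1) * (real CARD('n) * ?i)) *
           ennreal (orth_weight g (r *\<^sub>R (y /\<^sub>R norm y)) * c (norm (r *\<^sub>R (y /\<^sub>R norm y)))) =
           ennreal (r ^ (CARD('n) - 1) * (real CARD('n) * ?i) * (r powr abs_multi g * ?o * c r))"
          unfolding n orth_weight_scale[OF True] using True c[of r]
          by (subst ennreal_mult[symmetric]) auto
        also have "r ^ (CARD('n) - 1) * (real CARD('n) * ?i) * (r powr abs_multi g * ?o * c r) =
           (r ^ (CARD('n) - 1) * r powr abs_multi g * c r) * (real CARD('n) * ?i * ?o)" by (simp only: mult_ac)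
        also have "ennreal \<dots> = ennreal (indicator {0<..} r * r powr sph_dim g * c r) * ennreal (real CARD('n) * ?i * ?o)"
          unfolding pw using True c[of r] by (subst ennreal_mult[symmetric]) auto
        finally show ?thesis by (simp only: mult.assoc[symmetric])
      qed
    qed
  qed
  also have "\<dots> = (\<integral>\<^sup>+r. ennreal (indicator {0<..} r * r powr sph_dim g * c r) *
       (\<integral>\<^sup>+z. Q (r *\<^sub>R z) \<partial>sph_measure g) \<partial>lborel)"
    by (intro nn_integral_cong) (subst nn_integral_cmult, simp, simp add: nn_integral_sph_measure)
  also have "\<dots> = (\<integral>\<^sup>+r. \<integral>\<^sup>+z. Q (r *\<^sub>R z) \<partial>sph_measure g \<partial>radial_measure (sph_dim g) c)"
    unfolding radial_measure_def
  proof (subst nn_integral_density)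
    have "(\<lambda>r. \<integral>\<^sup>+z. Q (r *\<^sub>R z) \<partial>sph_measure g) = (\<lambda>r. (\<integral>\<^sup>+y. ennreal (real CARD('n) * indicator {y. norm y < 1} y * orth_weight g (y /\<^sub>R norm y)) * Q (r *\<^sub>R (y /\<^sub>R norm y)) \<partial>lborel))"
      by (simp add: nn_integral_sph_measure)
    also have "\<dots> \<in> borel_measurable lborel"
      by (rule lborel.borel_measurable_nn_integral) measurable
    finally show "(\<lambda>r. \<integral>\<^sup>+z. Q (r *\<^sub>R z) \<partial>sph_measure g) \<in> borel_measurable lborel" .
  qed auto
  finally show ?thesis .
qed

lemma sph_dim_pos:
  fixes g :: "real ^ 'n"
  assumes "\<forall>i. g $ i > 0"
  shows "0 < sph_dim g"
proof -
  have "abs_multi g > 0" unfolding abs_multi_def using assms by (intro sum_pos) auto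
  moreover have "real CARD('n) \<ge> 1" by (simp add: Suc_leI)
  ultimately show ?thesis unfolding sph_dim_def by linarith
qed

text \<open>The Gaussian is integrated against the weight in two ways: as a product over the
  coordinates and as the mass of the sphere times a radial integral. The quotient of the two values
  is the mass.\<close>

lemma emeasure_sph_measure:
  fixes g :: "real ^ 'n"
  assumes g: "\<forall>i. g $ i > 0"
  shows "emeasure (sph_measure g) UNIV = ennreal (sph_pos_weight g)"
proof -
  let ?c = "\<lambda>r::real. exp (- r\<^sup>2)"
  let ?G = "(\<Prod>i\<in>UNIV. Gamma ((g $ i + 1) / 2) / 2)"
  let ?r = "Gamma ((sph_dim g + 1) / 2) / 2"
  have m: "sph_dim g > 0" by (rule sph_dim_pos[OF g])
  have gp: "Gamma ((g $ i + 1) / 2) > 0" for i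
    using g by (intro Gamma_real_pos) (auto intro!: add_pos_pos)
  have "(\<integral>\<^sup>+y. 1 \<partial>orth_measure g ?c) = (\<integral>\<^sup>+y. ennreal (orth_weight g y * ?c (norm y)) \<partial>lborel)"
    unfolding orth_measure_def by (subst nn_integral_density) auto
  also have "\<dots> = (\<integral>\<^sup>+y. (\<Prod>i\<in>UNIV. ennreal (indicator {0<..} (y $ i) * ((y $ i) powr (g $ i) * exp (- (y $ i)\<^sup>2)))) \<partial>(lborel :: (real ^ 'n) measure))"
  proof (rule nn_integral_cong)
    fix y :: "real ^ 'n"
    have "(norm y)\<^sup>2 = (\<Sum>i\<in>UNIV. (y $ i)\<^sup>2)" by (simp add: norm_vec_def L2_set_def sum_nonneg)
    hence "exp (- (norm y)\<^sup>2) = (\<Prod>i\<in>UNIV. exp (- (y $ i)\<^sup>2))"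
      by (simp add: exp_sum[symmetric] sum_negf)
    hence "orth_weight g y * ?c (norm y) = (\<Prod>i\<in>UNIV. max 0 (y $ i) powr g $ i * exp (- (y $ i)\<^sup>2))"
      by (simp add: orth_weight_def prod.distrib)
    also have "\<dots> = (\<Prod>i\<in>UNIV. indicator {0<..} (y $ i) * ((y $ i) powr (g $ i) * exp (- (y $ i)\<^sup>2)))"
      by (intro prod.cong) (auto simp: indicator_def max_def)
    finally show "ennreal (orth_weight g y * ?c (norm y)) = (\<Prod>i\<in>UNIV. ennreal (indicator {0<..} (y $ i) * ((y $ i) powr (g $ i) * exp (- (y $ i)\<^sup>2))))"
      by (simp add: prod_ennreal)
  qed
  also have "\<dots> = (\<Prod>i\<in>UNIV. \<integral>\<^sup>+s. ennreal (indicator {0<..} s * (s powr (g $ i) * exp (- s\<^sup>2))) \<partial>lborel)"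
    by (rule nn_integral_vec_prod) auto
  also have "\<dots> = (\<Prod>i\<in>UNIV. ennreal (Gamma ((g $ i + 1) / 2) / 2))"
    using g by (intro prod.cong nn_integral_powr_gaussian refl) (auto intro: less_trans[of _ 0])
  also have "\<dots> = ennreal ?G" using gp by (intro prod_ennreal) (auto intro: less_imp_le)
  finally have 1: "(\<integral>\<^sup>+y. 1 \<partial>orth_measure g ?c) = ennreal ?G" .
  have "(\<integral>\<^sup>+y. 1 \<partial>orth_measure g ?c) = (\<integral>\<^sup>+r. \<integral>\<^sup>+z. 1 \<partial>sph_measure g \<partial>radial_measure (sph_dim g) ?c)"
    by (rule nn_integral_orth_measure_polar) auto
  also have "\<dots> = emeasure (sph_measure g) UNIV * (\<integral>\<^sup>+r. 1 \<partial>radial_measure (sph_dim g) ?c)"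
    by simp
  also have "(\<integral>\<^sup>+r. 1 \<partial>radial_measure (sph_dim g) ?c) = (\<integral>\<^sup>+s. ennreal (indicator {0<..} s * (s powr sph_dim g * exp (- s\<^sup>2))) \<partial>lborel)"
    unfolding radial_measure_def by (subst nn_integral_density) (auto simp: mult.assoc)
  also have "\<dots> = ennreal ?r" using m by (intro nn_integral_powr_gaussian) auto
  finally have 2: "emeasure (sph_measure g) UNIV * ennreal ?r = ennreal ?G" using 1 by simp
  have rp: "?r > 0" using m by (auto intro!: Gamma_real_pos)
  \<comment> \<open>Each of the \<open>n\<close> coordinate moments brings a factor 1/2 and so does
    the radial one, which leaves the power \<open>2^(n-1)\<close> in the denominator.\<close>
  have "sph_pos_weight g = ?G / ?r"
  proof -
    have "(2::real) ^ CARD('n) = 2 ^ (CARD('n) - 1) * 2"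
      using power_minus_mult[of "CARD('n)" "2::real"] by simp
    thus ?thesis
      by (simp add: sph_pos_weight_def sph_dim_def prod_dividef power_one_right)
  qed
  moreover have "emeasure (sph_measure g) UNIV = ennreal ?G / ennreal ?r"
    using 2 rp by (metis ennreal_eq_0_iff ennreal_neq_top mult_divide_eq_ennreal not_less)
  ultimately show ?thesis using rp gp
    by (simp add: divide_ennreal prod_nonneg less_imp_le)
qed

lemma compact_measure_sph_measure:
  assumes "\<forall>i. g $ i > 0"
  shows "compact_measure (sph_measure g)"
  unfolding compact_measure_def
proof (intro conjI exI[of _ "cball 0 1"])
  show "finite_measure (sph_measure g)"
    using emeasure_sph_measure[OF assms] by (intro finite_measureI) auto
  show "AE x in sph_measure g. x \<in> cball 0 1"
    using AE_sph_measure[of g] by eventually_elim simp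
qed auto

lemma compact_measure_radial_measure:
  assumes [measurable]: "c \<in> borel_measurable borel" and R: "\<And>r. r > R \<Longrightarrow> c r = 0"
    and fin: "(\<integral>\<^sup>+r. ennreal (indicator {0<..} r * r powr m * c r) \<partial>lborel) < \<infinity>"
  shows "compact_measure (radial_measure m c)"
  unfolding compact_measure_def
proof (intro conjI exI[of _ "{0..R}"])
  have R': "r \<le> R" if "c r \<noteq> 0" for r using R[of r] that by force
  show "finite_measure (radial_measure m c)"
    using fin by (intro finite_measureI) (simp add: radial_measure_def emeasure_density)
  show "AE x in radial_measure m c. x \<in> {0..R}"
    unfolding radial_measure_def by (subst AE_density) (auto simp: indicator_def intro!: AE_I2 R')
qed auto

text \<open>Turning the polar formula into an equality of measures makes it usable for integrands of
  either sign, through Fubini on the product.\<close>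

lemma orth_measure_eq_distr:
  fixes g :: "real ^ 'n"
  assumes g: "\<forall>i. g $ i > 0" and [measurable]: "c \<in> borel_measurable borel" and c: "\<And>r. 0 \<le> c r"
  shows "orth_measure g c = distr (radial_measure (sph_dim g) c \<Otimes>\<^sub>M sph_measure g) borel (\<lambda>(r, z). r *\<^sub>R z)"
proof (rule measure_eqI)
  interpret S: finite_measure "sph_measure g"
    using compact_measure_sph_measure[OF g] by (simp add: compact_measure_def)
  fix A assume "A \<in> sets (orth_measure g c)"
  hence A[measurable]: "A \<in> sets borel" by simp
  have "emeasure (orth_measure g c) A = (\<integral>\<^sup>+y. indicator A y \<partial>orth_measure g c)" by simp
  also have "\<dots> = (\<integral>\<^sup>+r. \<integral>\<^sup>+z. indicator A (r *\<^sub>R z) \<partial>sph_measure g \<partial>radial_measure (sph_dim g) c)"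
    using c by (intro nn_integral_orth_measure_polar) auto
  also have "\<dots> = (\<integral>\<^sup>+p. indicator A (fst p *\<^sub>R snd p) \<partial>(radial_measure (sph_dim g) c \<Otimes>\<^sub>M sph_measure g))"
    by (subst S.nn_integral_fst[symmetric]) auto
  also have "\<dots> = (\<integral>\<^sup>+y. indicator A y \<partial>distr (radial_measure (sph_dim g) c \<Otimes>\<^sub>M sph_measure g) borel (\<lambda>(r, z). r *\<^sub>R z))"
    by (subst nn_integral_distr) (auto simp: case_prod_unfold)
  finally show "emeasure (orth_measure g c) A = emeasure (distr (radial_measure (sph_dim g) c \<Otimes>\<^sub>M sph_measure g) borel (\<lambda>(r, z). r *\<^sub>R z)) A"
    by simp
qed auto

lemma
  fixes g :: "real ^ 'n" and q :: "real ^ 'n \<Rightarrow> real"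
  assumes g: "\<forall>i. g $ i > 0" and c_meas[measurable]: "c \<in> borel_measurable borel" and c: "\<And>r. 0 \<le> c r"
    and R: "\<And>r. r > R \<Longrightarrow> c r = 0" and cm: "compact_measure (radial_measure (sph_dim g) c)"
  shows compact_measure_orth_measure: "compact_measure (orth_measure g c)"
    and integral_orth_measure_polar: "continuous_on UNIV q \<Longrightarrow>
      (\<integral>y. q y \<partial>orth_measure g c) = (\<integral>r. (\<integral>z. q (r *\<^sub>R z) \<partial>sph_measure g) \<partial>radial_measure (sph_dim g) c)"
proof -
  have R': "r \<le> R" if "c r \<noteq> 0" for r using R[of r] that by force
  interpret S: finite_measure "sph_measure g"
    using compact_measure_sph_measure[OF g] by (simp add: compact_measure_def)
  interpret Rm: finite_measure "radial_measure (sph_dim g) c"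
    using cm by (simp add: compact_measure_def)
  interpret P: pair_sigma_finite "radial_measure (sph_dim g) c" "sph_measure g" ..
  show orth: "compact_measure (orth_measure g c)"
    unfolding compact_measure_def
  proof (intro conjI exI[of _ "cball 0 R"])
    have "emeasure (orth_measure g c) UNIV = (\<integral>\<^sup>+y. 1 \<partial>orth_measure g c)" by simp
    also have "\<dots> = (\<integral>\<^sup>+r. \<integral>\<^sup>+z. 1 \<partial>sph_measure g \<partial>radial_measure (sph_dim g) c)"
      using c by (intro nn_integral_orth_measure_polar) auto
    also have "\<dots> \<noteq> \<infinity>"
      using S.emeasure_finite[of UNIV] Rm.emeasure_finite[of UNIV] by (simp add: ennreal_mult_eq_top_iff)
    finally show "finite_measure (orth_measure g c)" by (intro finite_measureI) simp
    show "AE x in orth_measure g c. x \<in> cball 0 R"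
      unfolding orth_measure_def by (subst AE_density) (auto intro!: AE_I2 R')
  qed auto
  assume q: "continuous_on UNIV q"
  hence qm[measurable]: "q \<in> borel_measurable borel" by (rule borel_measurable_continuous_onI)
  note eq = orth_measure_eq_distr[OF g c_meas c]
  have "integrable (orth_measure g c) q" using orth q by (rule compact_measure_integrable)
  hence int: "integrable (radial_measure (sph_dim g) c \<Otimes>\<^sub>M sph_measure g) (\<lambda>p. q (case p of (r,z) \<Rightarrow> r *\<^sub>R z))"
    unfolding eq by (subst (asm) integrable_distr_eq) auto
  have "(\<integral>y. q y \<partial>orth_measure g c) = (\<integral>p. q (case p of (r,z) \<Rightarrow> r *\<^sub>R z) \<partial>(radial_measure (sph_dim g) c \<Otimes>\<^sub>M sph_measure g))"
    unfolding eq by (subst integral_distr) auto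
  also have "\<dots> = (\<integral>r. (\<integral>z. q (r *\<^sub>R z) \<partial>sph_measure g) \<partial>radial_measure (sph_dim g) c)"
    using P.integral_fst'[OF int] by simp
  finally show "(\<integral>y. q y \<partial>orth_measure g c) = (\<integral>r. (\<integral>z. q (r *\<^sub>R z) \<partial>sph_measure g) \<partial>radial_measure (sph_dim g) c)" .
qed

section \<open>Even extension\<close>

lemma orth_closed_add_axis:
  assumes "z \<in> orth_closed" "0 \<le> z $ i + s"
  shows "z + s *\<^sub>R axis i 1 \<in> orth_closed"
  using assms by (auto simp: orth_closed_def axis_def)

text \<open>Derivatives are given only in the open orthant, but the translation evaluates
  \<open>f\<close> on the faces too. The formula holds at interior base points; its defect
  \<open>J\<close> is continuous in the base point and hence vanishes on the closure.\<close>

lemma closed_orthant_FTC: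
  fixes q q' :: "real ^ 'n \<Rightarrow> real"
  assumes q: "continuous_on orth_closed q" and q': "continuous_on orth_closed q'"
    and der: "\<And>x. x \<in> orth_open \<Longrightarrow> ((\<lambda>s. q (x + s *\<^sub>R axis i 1)) has_real_derivative q' x) (at 0)"
    and z: "z \<in> orth_closed" and h: "0 \<le> h"
  shows "q (z + h *\<^sub>R axis i 1) = q z + integral {0..h} (\<lambda>s. q' (z + s *\<^sub>R axis i 1))"
proof -
  define J where "J z = q (z + h *\<^sub>R axis i 1) - q z - integral (cbox 0 h) (\<lambda>s. q' (z + s *\<^sub>R axis i 1))" for z
  have J0: "J x = 0" if x: "x \<in> orth_open" for x
  proof -
    have "((\<lambda>s. q' (x + s *\<^sub>R axis i 1)) has_integral (q (x + h *\<^sub>R axis i 1) - q (x + 0 *\<^sub>R axis i 1))) {0..h}"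
    proof (rule fundamental_theorem_of_calculus[OF h])
      fix r assume r: "r \<in> {0..h}"
      have xr: "x + r *\<^sub>R axis i 1 \<in> orth_open" using x r by (auto simp: orth_open_def axis_def add_pos_nonneg)
      have "((\<lambda>s. q (x + s *\<^sub>R axis i 1)) has_real_derivative q' (x + r *\<^sub>R axis i 1)) (at r)"
        using DERIV_shift[of "\<lambda>s. q (x + s *\<^sub>R axis i 1)" _ 0 r] der[OF xr]
        by (simp add: algebra_simps)
      thus "((\<lambda>s. q (x + s *\<^sub>R axis i 1)) has_vector_derivative q' (x + r *\<^sub>R axis i 1)) (at r within {0..h})"
        by (simp add: has_real_derivative_iff_has_vector_derivative has_vector_derivative_at_within)
    qed
    from integral_unique[OF this] show ?thesis by (simp add: J_def)
  qed
  have "continuous_on (orth_closed \<times> cbox 0 h) (\<lambda>(z, s). q' (z + s *\<^sub>R axis i 1))"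
    unfolding case_prod_unfold
  proof (rule continuous_on_compose2[OF q'])
    show "(\<lambda>p. fst p + snd p *\<^sub>R axis i 1) ` (orth_closed \<times> cbox 0 h) \<subseteq> orth_closed"
      by (auto intro!: orth_closed_add_axis) (auto simp: orth_closed_def intro: add_nonneg_nonneg)
  qed (auto intro!: continuous_intros)
  hence c1: "continuous_on orth_closed (\<lambda>z. integral (cbox 0 h) (\<lambda>s. q' (z + s *\<^sub>R axis i 1)))"
    by (rule integral_continuous_on_param)
  have c2: "continuous_on orth_closed (\<lambda>z. q (z + h *\<^sub>R axis i 1))"
  proof (rule continuous_on_compose2[OF q])
    show "(\<lambda>z. z + h *\<^sub>R axis i 1) ` orth_closed \<subseteq> orth_closed"
      using h by (auto intro!: orth_closed_add_axis) (auto simp: orth_closed_def intro: add_nonneg_nonneg)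
  qed (auto intro!: continuous_intros)
  have Jc: "continuous_on orth_closed J" unfolding J_def by (intro continuous_intros c1 c2 q)
  \<comment> \<open>Interior points converging to \<open>z\<close>: all coordinates are pushed up by
    \<open>1/(k+1)\<close>.\<close>
  define X where "X k = z + (1 / real (Suc k)) *\<^sub>R (\<chi> i. 1)" for k
  have Xo: "X k \<in> orth_open" for k
    using z by (auto simp: X_def orth_open_def orth_closed_def intro!: add_nonneg_pos)
  have Xc: "X k \<in> orth_closed" for k using Xo[of k] by (auto simp: orth_open_def orth_closed_def less_imp_le)
  have "(\<lambda>k. 1 / real (Suc k)) \<longlonglongrightarrow> 0" by (rule lim_1_over_n[THEN LIMSEQ_Suc])
  hence "X \<longlonglongrightarrow> z + 0 *\<^sub>R (\<chi> i. 1)" unfolding X_def by (intro tendsto_intros)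
  hence "(\<lambda>k. J (X k)) \<longlonglongrightarrow> J z"
    by (intro continuous_on_tendsto_compose[OF Jc]) (use z Xc in auto)
  hence "J z = 0" using J0[OF Xo] by (simp add: LIMSEQ_const_iff)
  thus ?thesis by (simp add: J_def)
qed

text \<open>Other coordinates of \<open>z\<close> may vanish. The base point \<open>w\<close> is the
  projection of \<open>z\<close> to the face \<open>z_i = 0\<close>, and the integral formula
  started there is differentiated at the interior parameter \<open>z $ i\<close>.\<close>

lemma closed_orthant_DERIV:
  fixes q q' :: "real ^ 'n \<Rightarrow> real"
  assumes q: "continuous_on orth_closed q" and q': "continuous_on orth_closed q'"
    and der: "\<And>x. x \<in> orth_open \<Longrightarrow> ((\<lambda>s. q (x + s *\<^sub>R axis i 1)) has_real_derivative q' x) (at 0)"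
    and z: "z \<in> orth_closed" and zi: "0 < z $ i"
  shows "((\<lambda>s. q (z + s *\<^sub>R axis i 1)) has_real_derivative q' z) (at 0)"
proof -
  define w where "w = z - (z $ i) *\<^sub>R axis i 1"
  have w: "w \<in> orth_closed" using z by (auto simp: w_def orth_closed_def axis_def)
  have wi: "w $ i = 0" by (simp add: w_def)
  have eq: "q (w + h *\<^sub>R axis i 1) = q w + integral {0..h} (\<lambda>s. q' (w + s *\<^sub>R axis i 1))" if "h \<ge> 0" for h
    by (rule closed_orthant_FTC[OF q q' der w that])
  have "continuous_on {0..2 * z $ i} (\<lambda>s. q' (w + s *\<^sub>R axis i 1))"
    by (rule continuous_on_compose2[OF q']) (auto intro!: continuous_intros orth_closed_add_axis w simp: wi)
  hence "((\<lambda>h. integral {0..h} (\<lambda>s. q' (w + s *\<^sub>R axis i 1))) has_real_derivative q' (w + (z $ i) *\<^sub>R axis i 1)) (at (z $ i) within {0..2 * z $ i})"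
    using zi by (intro integral_has_real_derivative) auto
  hence "((\<lambda>h. integral {0..h} (\<lambda>s. q' (w + s *\<^sub>R axis i 1))) has_real_derivative q' z) (at (z $ i))"
    using at_within_interior[of "z $ i" "{0..2 * z $ i}"] zi by (simp add: w_def)
  hence "((\<lambda>h. q w + integral {0..h} (\<lambda>s. q' (w + s *\<^sub>R axis i 1))) has_real_derivative q' z) (at (z $ i))"
    by (auto intro!: derivative_eq_intros)
  hence "((\<lambda>h. q (w + h *\<^sub>R axis i 1)) has_real_derivative q' z) (at (z $ i))"
    by (rule has_field_derivative_transform_within_open[where S="{0<..}"]) (use zi eq in auto)
  thus ?thesis
    using DERIV_shift[of "\<lambda>h. q (w + h *\<^sub>R axis i 1)" _ 0 "z $ i"] by (simp add: w_def algebra_simps)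
qed

text \<open>Composition with \<open>vabs\<close> reflects a function on the closed orthant evenly in
  every coordinate, so that it becomes continuous on the whole space without changing on the closed
  orthant.\<close>

definition vabs :: "real ^ 'n \<Rightarrow> real ^ 'n" where
  "vabs z = (\<chi> i. \<bar>z $ i\<bar>)"

lemma vabs_orth_closed [simp]: "vabs z \<in> orth_closed"
  by (simp add: vabs_def orth_closed_def)

lemma vabs_eq [simp]: "z \<in> orth_closed \<Longrightarrow> vabs z = z"
  by (simp add: vabs_def orth_closed_def vec_eq_iff)

lemma continuous_on_vabs: "continuous_on A vabs"
  unfolding vabs_def by (intro continuous_intros)

lemma vabs_add_axis:
  assumes "0 \<le> z $ i" "0 \<le> z $ i + s"
  shows "vabs (z + s *\<^sub>R axis i 1) = vabs z + s *\<^sub>R axis i 1"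
  using assms by (auto simp: vabs_def vec_eq_iff axis_def)

text \<open>Data of a function that is even and \<open>C\<^sup>2\<close> in each variable: \<open>\<partial>\<^sub>i f = z\<^sub>i G\<^sub>i\<close> and
  \<open>\<partial>\<^sub>i\<^sup>2 f = E\<^sub>i\<close>, where \<open>G\<^sub>i\<close> extends continuously to \<open>z\<^sub>i = 0\<close>.\<close>

locale even_C2 =
  fixes f :: "real ^ 'n \<Rightarrow> real" and G E :: "'n \<Rightarrow> real ^ 'n \<Rightarrow> real"
  assumes f_cont: "continuous_on UNIV f"
    and G_cont: "continuous_on UNIV (G i)" and E_cont: "continuous_on UNIV (E i)"
    and f_deriv: "0 < z $ i \<Longrightarrow> ((\<lambda>s. f (z + s *\<^sub>R axis i 1)) has_real_derivative z $ i * G i z) (at 0)"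
    and zG_deriv: "0 < z $ i \<Longrightarrow>
      ((\<lambda>s. (z $ i + s) * G i (z + s *\<^sub>R axis i 1)) has_real_derivative E i z) (at 0)"
    and E_eq_G: "z $ i = 0 \<Longrightarrow> E i z = G i z"

text \<open>Hadamard's quotient: \<open>d1 i\<close> vanishes on the face \<open>z_i = 0\<close>, so
  it equals \<open>z_i\<close> times the average of \<open>d2 i i\<close> over the segment from that
  face to \<open>z\<close>. The average is continuous up to the face, where it reduces to
  \<open>d2 i i\<close> itself.\<close>

lemma C2_ev_imp_even_C2:
  fixes f :: "real ^ 'n \<Rightarrow> real"
  assumes "C2_ev f"
  shows "\<exists>G E. even_C2 (f \<circ> vabs) G E"
proof -
  from assms obtain d1 d2 where f: "continuous_on orth_closed f"
    and d1: "\<And>i. continuous_on orth_closed (d1 i)" and d2: "\<And>i j. continuous_on orth_closed (d2 i j)"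
    and D1: "\<And>i x. x \<in> orth_open \<Longrightarrow> ((\<lambda>s. f (x + s *\<^sub>R axis i 1)) has_real_derivative d1 i x) (at 0)"
    and D2: "\<And>i j x. x \<in> orth_open \<Longrightarrow> ((\<lambda>s. d1 j (x + s *\<^sub>R axis i 1)) has_real_derivative d2 i j x) (at 0)"
    and d0: "\<And>i x. x \<in> orth_closed \<Longrightarrow> x $ i = 0 \<Longrightarrow> d1 i x = 0"
    unfolding C2_ev_def by blast
  \<comment> \<open>The point has \<open>i\<close>-th coordinate \<open>s z_i\<close>; writing it as
    a displacement along the axis fits the axis derivatives.\<close>
  define Gc where "Gc i z = integral (cbox 0 1) (\<lambda>s. d2 i i (z + (- (1 - s) * z $ i) *\<^sub>R axis i 1))" for i z
  have in_closed: "z + (- (1 - s) * z $ i) *\<^sub>R axis i 1 \<in> orth_closed" if "z \<in> orth_closed" "s \<ge> 0" for z :: "real ^ 'n" and s i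
    using that by (intro orth_closed_add_axis) (auto simp: algebra_simps orth_closed_def)
  have Gc_cont: "continuous_on orth_closed (Gc i)" for i
    unfolding Gc_def
  proof (rule integral_continuous_on_param)
    show "continuous_on (orth_closed \<times> cbox 0 1) (\<lambda>(z, s). d2 i i (z + (- (1 - s) * z $ i) *\<^sub>R axis i 1))"
      unfolding case_prod_unfold
    proof (rule continuous_on_compose2[OF d2])
      show "(\<lambda>p. fst p + (- (1 - snd p) * fst p $ i) *\<^sub>R axis i 1) ` (orth_closed \<times> cbox 0 1) \<subseteq> orth_closed"
        using in_closed by (auto simp del: mult_minus_left minus_diff_eq)
    qed (auto intro!: continuous_intros)
  qed
  have zG: "z $ i * Gc i z = d1 i z" if z: "z \<in> orth_closed" for z i
  proof (cases "z $ i = 0")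
    case True
    thus ?thesis using d0[OF z] by simp
  next
    case False
    hence zi: "z $ i > 0" using z by (auto simp: orth_closed_def less_le)
    let ?w = "\<lambda>s. z + (- (1 - s) * z $ i) *\<^sub>R axis i 1"
    have "((\<lambda>s. z $ i * d2 i i (?w s)) has_integral (d1 i (?w 1) - d1 i (?w 0))) {0..1}"
    proof (rule fundamental_theorem_of_calculus_interior)
      show "continuous_on {0..1} (\<lambda>s. d1 i (?w s))"
        by (rule continuous_on_compose2[OF d1]) (use in_closed[OF z] in \<open>auto intro!: continuous_intros simp del: mult_minus_left minus_diff_eq\<close>)
      fix s :: real assume s: "s \<in> {0<..<1}"
      have "?w s \<in> orth_closed" using in_closed[OF z] s by simp
      moreover have "0 < ?w s $ i" using s zi by (simp add: algebra_simps)
      \<comment> \<open>The parameter 0 appears as \<open>(s - s) * z $ i\<close>, the value at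
        \<open>r = s\<close> of the inner function in the chain rule below.\<close>
      ultimately have D: "((\<lambda>h. d1 i (?w s + h *\<^sub>R axis i 1)) has_real_derivative d2 i i (?w s)) (at ((s - s) * z $ i))"
        using closed_orthant_DERIV[OF d1 d2 D2] by simp
      have "((\<lambda>r. d1 i (?w s + ((r - s) * z $ i) *\<^sub>R axis i 1)) has_real_derivative (d2 i i (?w s) * z $ i)) (at s)"
        by (rule DERIV_chain2[where g="\<lambda>r. (r - s) * z $ i", OF D]) (auto intro!: derivative_eq_intros)
      moreover have "?w s + ((r - s) * z $ i) *\<^sub>R axis i 1 = ?w r" for r
        by (simp add: vec_eq_iff algebra_simps)
      ultimately show "((\<lambda>s. d1 i (?w s)) has_vector_derivative z $ i * d2 i i (?w s)) (at s)"
        by (simp only: has_real_derivative_iff_has_vector_derivative[symmetric] mult.commute[of "z $ i"])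
    qed simp
    from integral_unique[OF this] have "z $ i * Gc i z = d1 i (?w 1) - d1 i (?w 0)"
      by (simp add: Gc_def)
    moreover have "d1 i (?w 0) = 0" using in_closed[OF z, of 0 i] by (intro d0) auto
    ultimately show ?thesis by simp
  qed
  have "even_C2 (f \<circ> vabs) (\<lambda>i z. Gc i (vabs z)) (\<lambda>i z. d2 i i (vabs z))"
  proof
    show "continuous_on UNIV (f \<circ> vabs)" unfolding comp_def
      by (rule continuous_on_compose2[OF f continuous_on_vabs]) auto
    show "continuous_on UNIV (\<lambda>z. Gc i (vabs z))" for i
      by (rule continuous_on_compose2[OF Gc_cont continuous_on_vabs]) auto
    show "continuous_on UNIV (\<lambda>z. d2 i i (vabs z))" for i
      by (rule continuous_on_compose2[OF d2 continuous_on_vabs]) auto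
    fix z :: "real ^ 'n" and i
    show "d2 i i (vabs z) = Gc i (vabs z)" if "z $ i = 0"
      using that by (simp add: Gc_def vabs_def)
    assume zi: "0 < z $ i"
    have vi: "vabs z $ i = z $ i" using zi by (simp add: vabs_def)
    have "((\<lambda>s. f (vabs z + s *\<^sub>R axis i 1)) has_real_derivative d1 i (vabs z)) (at 0)"
      using zi by (intro closed_orthant_DERIV[OF f d1 D1]) (auto simp: vi)
    hence "((\<lambda>s. (f \<circ> vabs) (z + s *\<^sub>R axis i 1)) has_real_derivative d1 i (vabs z)) (at 0)"
      by (rule has_field_derivative_transform_within_open[where S="{- z $ i <..}"]) (use zi in \<open>auto simp: vabs_add_axis\<close>)
    thus "((\<lambda>s. (f \<circ> vabs) (z + s *\<^sub>R axis i 1)) has_real_derivative z $ i * Gc i (vabs z)) (at 0)"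
      using zG[of "vabs z" i] by (simp add: vi)
    have "((\<lambda>s. d1 i (vabs z + s *\<^sub>R axis i 1)) has_real_derivative d2 i i (vabs z)) (at 0)"
      using zi by (intro closed_orthant_DERIV[OF d1 d2 D2]) (auto simp: vi)
    thus "((\<lambda>s. (z $ i + s) * Gc i (vabs (z + s *\<^sub>R axis i 1))) has_real_derivative d2 i i (vabs z)) (at 0)"
    proof (rule has_field_derivative_transform_within_open[where S="{- z $ i <..}"])
      fix s assume s: "s \<in> {- z $ i <..}"
      have "vabs (z + s *\<^sub>R axis i 1) $ i = z $ i + s" using s zi by (simp add: vabs_def)
      thus "d1 i (vabs z + s *\<^sub>R axis i 1) = (z $ i + s) * Gc i (vabs (z + s *\<^sub>R axis i 1))"
        using s zi zG[OF vabs_orth_closed, of "z + s *\<^sub>R axis i 1" i] by (simp add: vabs_add_axis)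
    qed (use zi in auto)
  qed
  thus ?thesis by blast
qed

section \<open>The kernel of the generalized translation\<close>

definition tr_arg :: "real ^ 'n \<Rightarrow> real ^ 'n \<Rightarrow> real ^ 'n \<Rightarrow> real ^ 'n" where
  "tr_arg x y a = (\<chi> i. sqrt ((x $ i)\<^sup>2 + (y $ i)\<^sup>2 - 2 * x $ i * y $ i * cos (a $ i)))"

text \<open>Law of cosines as a sum of squares: the root is real, its zeros are located by two
  equations, and \<open>x - y cos a\<close> is the numerator of its derivative in
  \<open>x\<close>.\<close>

lemma tr_radicand: "x\<^sup>2 + y\<^sup>2 - 2 * x * y * cos a = (x - y * cos a)\<^sup>2 + (y * sin a)\<^sup>2" for x y a :: real
proof -
  have "(y * sin a)\<^sup>2 = y\<^sup>2 * (1 - (cos a)\<^sup>2)" by (simp add: power_mult_distrib sin_squared_eq)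
  thus ?thesis by (simp add: power2_eq_square algebra_simps)
qed

lemma tr_arg_nth: "tr_arg x y a $ i = sqrt ((x $ i - y $ i * cos (a $ i))\<^sup>2 + (y $ i * sin (a $ i))\<^sup>2)"
  by (simp add: tr_arg_def tr_radicand)

lemma tr_arg_nonneg [simp]: "0 \<le> tr_arg x y a $ i"
  by (simp add: tr_arg_nth)

lemma tr_arg_commute: "tr_arg x y a = tr_arg y x a"
  by (simp add: tr_arg_def algebra_simps)

lemma tr_arg_orth_closed [simp]: "tr_arg x y a \<in> orth_closed"
  by (simp add: orth_closed_def)

lemma tr_arg_0:
  assumes "x \<in> orth_closed" shows "tr_arg x 0 a = x"
  using assms by (simp add: tr_arg_def vec_eq_iff orth_closed_def)

lemma continuous_on_tr_arg [continuous_intros]: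
  fixes p q r :: "'b::t2_space \<Rightarrow> real ^ 'n"
  assumes "continuous_on A p" "continuous_on A q" "continuous_on A r"
  shows "continuous_on A (\<lambda>w. tr_arg (p w) (q w) (r w))"
  unfolding tr_arg_def by (intro continuous_intros assms)

lemma tr_arg_sq: "(tr_arg x y a $ i)\<^sup>2 = (x $ i - y $ i * cos (a $ i))\<^sup>2 + (y $ i * sin (a $ i))\<^sup>2"
  by (simp add: tr_arg_nth)

lemma tr_arg_add_axis:
  "tr_arg (x + s *\<^sub>R axis i 1) y a =
   tr_arg x y a + (sqrt ((x $ i + s - y $ i * cos (a $ i))\<^sup>2 + (y $ i * sin (a $ i))\<^sup>2) - tr_arg x y a $ i) *\<^sub>R axis i 1"
  by (auto simp: vec_eq_iff tr_arg_nth axis_def)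

lemma tr_arg_add_axis_angle:
  "tr_arg x y (a + s *\<^sub>R axis i 1) =
   tr_arg x y a + (sqrt ((x $ i)\<^sup>2 + (y $ i)\<^sup>2 - 2 * x $ i * y $ i * cos (a $ i + s)) - tr_arg x y a $ i) *\<^sub>R axis i 1"
  by (auto simp: vec_eq_iff tr_arg_def axis_def)

text \<open>Moving \<open>x_i\<close> or \<open>a_i\<close> displaces only the \<open>i\<close>-th
  component of \<open>tr_arg\<close>. A one-variable chain rule along the axis is therefore enough,
  without a total derivative of \<open>q\<close>.\<close>

lemma DERIV_axis_chain:
  fixes q :: "real ^ 'n \<Rightarrow> real"
  assumes "((\<lambda>s. q (z + s *\<^sub>R axis i 1)) has_real_derivative q') (at 0)"
    and "(r has_real_derivative r') (at 0)" and "r 0 = z $ i"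
  shows "((\<lambda>s. q (z + (r s - z $ i) *\<^sub>R axis i 1)) has_real_derivative q' * r') (at 0)"
proof -
  have 1: "((\<lambda>s. q (z + s *\<^sub>R axis i 1)) has_real_derivative q') (at (r 0 - z $ i))" using assms by simp
  have 2: "((\<lambda>s. r s - z $ i) has_real_derivative r') (at 0)"
    using assms by (auto intro!: derivative_eq_intros)
  show ?thesis by (rule DERIV_chain2[where g="\<lambda>s. r s - z $ i", OF 1 2])
qed

lemma DERIV_sqrt_shift:
  assumes "u\<^sup>2 + c\<^sup>2 > (0::real)"
  shows "((\<lambda>s. sqrt ((u + s)\<^sup>2 + c\<^sup>2)) has_real_derivative u / sqrt (u\<^sup>2 + c\<^sup>2)) (at 0)"
  using assms by (auto intro!: derivative_eq_intros simp: field_simps)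

lemma DERIV_tr_arg_axis:
  fixes q :: "real ^ 'n \<Rightarrow> real"
  assumes q: "((\<lambda>s. q (tr_arg x y a + s *\<^sub>R axis i 1)) has_real_derivative q') (at 0)"
    and pos: "tr_arg x y a $ i \<noteq> 0"
  shows "((\<lambda>s. q (tr_arg (x + s *\<^sub>R axis i 1) y a)) has_real_derivative
     q' * ((x $ i - y $ i * cos (a $ i)) / tr_arg x y a $ i)) (at 0)"
proof -
  let ?u = "x $ i - y $ i * cos (a $ i)" and ?c = "y $ i * sin (a $ i)"
  have "0 < (tr_arg x y a $ i)\<^sup>2" using pos by simp
  hence p: "0 < ?u\<^sup>2 + ?c\<^sup>2" by (simp add: tr_arg_sq)
  have "((\<lambda>s. sqrt ((x $ i + s - y $ i * cos (a $ i))\<^sup>2 + ?c\<^sup>2)) has_real_derivative ?u / tr_arg x y a $ i) (at 0)"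
    using DERIV_sqrt_shift[OF p] by (simp add: tr_arg_nth algebra_simps)
  from DERIV_axis_chain[OF q this] show ?thesis
    unfolding tr_arg_add_axis by (simp add: tr_arg_nth)
qed

lemma tr_arg_add_axis_neq_0:
  assumes "s \<noteq> y $ i * cos (a $ i) - x $ i"
  shows "tr_arg (x + s *\<^sub>R axis i 1) y a $ i \<noteq> 0"
  using assms by (auto simp: tr_arg_nth add_nonneg_eq_0_iff)

text \<open>Meant for \<open>b = y_i cos a_i\<close>: outside this value the square root is
  positive, and each line in direction \<open>i\<close> crosses it only once.\<close>

lemma DERIV_axis_all:
  fixes q q' :: "real ^ 'n \<Rightarrow> real"
  assumes q: "continuous_on UNIV q" and q': "continuous_on UNIV q'"
    and der: "\<And>x. x $ i \<noteq> b \<Longrightarrow> ((\<lambda>s. q (x + s *\<^sub>R axis i 1)) has_real_derivative q' x) (at 0)"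
  shows "((\<lambda>s. q (x + s *\<^sub>R axis i 1)) has_real_derivative q' x) (at 0)"
proof -
  have "((\<lambda>s. q (x + s *\<^sub>R axis i 1)) has_real_derivative q' (x + 0 *\<^sub>R axis i 1)) (at 0)"
  proof (rule DERIV_remove_point[where b="b - x $ i"])
    show "continuous_on UNIV (\<lambda>s. q (x + s *\<^sub>R axis i 1))"
      by (rule continuous_on_compose2[OF q]) (auto intro!: continuous_intros)
    show "continuous_on UNIV (\<lambda>s. q' (x + s *\<^sub>R axis i 1))"
      by (rule continuous_on_compose2[OF q']) (auto intro!: continuous_intros)
    fix s assume "s \<noteq> b - x $ i"
    hence "((\<lambda>r. q ((x + s *\<^sub>R axis i 1) + r *\<^sub>R axis i 1)) has_real_derivative q' (x + s *\<^sub>R axis i 1)) (at 0)"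
      by (intro der) auto
    thus "((\<lambda>s. q (x + s *\<^sub>R axis i 1)) has_real_derivative q' (x + s *\<^sub>R axis i 1)) (at s)"
      using DERIV_shift[of "\<lambda>s. q (x + s *\<^sub>R axis i 1)" _ 0 s] by (simp add: algebra_simps)
  qed
  thus ?thesis by simp
qed

lemma DERIV_axis_shift:
  fixes q :: "real ^ 'n \<Rightarrow> real"
  assumes "\<And>x. ((\<lambda>s. q (x + s *\<^sub>R axis i 1)) has_real_derivative q' x) (at 0)"
  shows "((\<lambda>s. q (x + s *\<^sub>R axis i 1)) has_real_derivative q' (x + s *\<^sub>R axis i 1)) (at s)"
  using DERIV_shift[of "\<lambda>s. q (x + s *\<^sub>R axis i 1)" _ 0 s] assms[of "x + s *\<^sub>R axis i 1"]
  by (simp add: algebra_simps)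

section \<open>The integrand of the translation and its first two derivatives in
  \<open>x_i\<close>\<close>

context even_C2
begin

lemma G_deriv:
  assumes "0 < z $ i"
  shows "((\<lambda>s. G i (z + s *\<^sub>R axis i 1)) has_real_derivative (E i z - G i z) / z $ i) (at 0)"
proof -
  have h: "((\<lambda>s. z $ i + s) has_real_derivative 1) (at 0)" by (auto intro!: derivative_eq_intros)
  have "((\<lambda>s. (z $ i + s) * G i (z + s *\<^sub>R axis i 1) / (z $ i + s)) has_real_derivative (E i z - G i z) / z $ i) (at 0)"
    by (rule DERIV_cong[OF DERIV_divide[OF zG_deriv[OF assms] h]]) (use assms in \<open>auto simp: field_simps\<close>)
  thus ?thesis
    by (rule has_field_derivative_transform_within_open[where S="{- z $ i <..}"]) (use assms in auto)
qed

text \<open>With \<open>z = tr_arg x y a\<close> and \<open>u = x_i - y_i cos a_i\<close>, the chain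
  rule gives \<open>z_i G_i\<close> times \<open>u / z_i\<close>. The root cancels, so the formula
  is meaningful where it vanishes.\<close>

definition ker1 :: "'n \<Rightarrow> real ^ 'n \<Rightarrow> real ^ 'n \<Rightarrow> real ^ 'n \<Rightarrow> real" where
  "ker1 i x y a = G i (tr_arg x y a) * (x $ i - y $ i * cos (a $ i))"

text \<open>The product rule for \<open>G_i u\<close>, where the derivative of \<open>G_i\<close>
  along the axis is \<open>(E_i - G_i) / z_i\<close>. At \<open>z_i = 0\<close> division by zero
  leaves \<open>G_i\<close>, the correct value because \<open>E_i = G_i\<close> there.\<close>

definition ker2 :: "'n \<Rightarrow> real ^ 'n \<Rightarrow> real ^ 'n \<Rightarrow> real ^ 'n \<Rightarrow> real" where
  "ker2 i x y a = G i (tr_arg x y a) +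
     (E i (tr_arg x y a) - G i (tr_arg x y a)) * ((x $ i - y $ i * cos (a $ i))\<^sup>2 / (tr_arg x y a $ i)\<^sup>2)"

lemma cont_f_tr: 
  fixes p q r :: "'b::t2_space \<Rightarrow> real ^ 'n"
  assumes "continuous_on A p" "continuous_on A q" "continuous_on A r"
  shows "continuous_on A (\<lambda>w. f (tr_arg (p w) (q w) (r w)))"
  by (rule continuous_on_compose2[OF f_cont]) (auto intro!: continuous_intros assms)

lemma cont_G_tr: 
  fixes p q r :: "'b::t2_space \<Rightarrow> real ^ 'n"
  assumes "continuous_on A p" "continuous_on A q" "continuous_on A r"
  shows "continuous_on A (\<lambda>w. G i (tr_arg (p w) (q w) (r w)))"
  by (rule continuous_on_compose2[OF G_cont]) (auto intro!: continuous_intros assms)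

lemma cont_E_tr: 
  fixes p q r :: "'b::t2_space \<Rightarrow> real ^ 'n"
  assumes "continuous_on A p" "continuous_on A q" "continuous_on A r"
  shows "continuous_on A (\<lambda>w. E i (tr_arg (p w) (q w) (r w)))"
  by (rule continuous_on_compose2[OF E_cont]) (auto intro!: continuous_intros assms)

lemma cont_ker1: 
  fixes p q r :: "'b::t2_space \<Rightarrow> real ^ 'n"
  assumes "continuous_on A p" "continuous_on A q" "continuous_on A r"
  shows "continuous_on A (\<lambda>w. ker1 i (p w) (q w) (r w))"
  unfolding ker1_def by (intro continuous_intros cont_G_tr assms)

text \<open>Where \<open>tr_arg\<close> vanishes in the \<open>i\<close>-th component the quotient is discontinuous, but bounded by 1,
  and its factor \<open>E - G\<close> vanishes.\<close>

lemma cont_ker2_UNIV: "continuous_on UNIV (\<lambda>(x, y, a). ker2 i x y a)"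
  unfolding continuous_on_eq_continuous_at[OF open_UNIV]
proof (intro ballI)
  fix p0 :: "(real ^ 'n) \<times> (real ^ 'n) \<times> (real ^ 'n)"
  define Z where "Z p = tr_arg (fst p) (fst (snd p)) (snd (snd p))" for p :: "(real ^ 'n) \<times> (real ^ 'n) \<times> (real ^ 'n)"
  define u where "u p = fst p $ i - fst (snd p) $ i * cos (snd (snd p) $ i)" for p :: "(real ^ 'n) \<times> (real ^ 'n) \<times> (real ^ 'n)"
  have cG: "continuous_on UNIV (\<lambda>p. G i (Z p))" and cE: "continuous_on UNIV (\<lambda>p. E i (Z p))"
    unfolding Z_def by (intro cont_G_tr cont_E_tr continuous_intros)+
  have cZ: "continuous_on UNIV (\<lambda>p. Z p $ i)" and cu: "continuous_on UNIV u"
    unfolding Z_def u_def by (intro continuous_intros)+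
  have G: "isCont (\<lambda>p. G i (Z p)) p0" and E: "isCont (\<lambda>p. E i (Z p)) p0" and Zc: "isCont (\<lambda>p. Z p $ i) p0" and uc: "isCont u p0"
    using cG cE cZ cu unfolding continuous_on_eq_continuous_at[OF open_UNIV] by (blast intro: UNIV_I)+
  have "isCont (\<lambda>p. (E i (Z p) - G i (Z p)) * ((u p)\<^sup>2 / (Z p $ i)\<^sup>2)) p0"
  proof (cases "Z p0 $ i = 0")
    case False
    thus ?thesis by (intro continuous_intros G E Zc uc) auto
  next
    case True
    have 1: "(u p)\<^sup>2 / (Z p $ i)\<^sup>2 \<le> 1" for p
      using divide_le_eq_1[of "(u p)\<^sup>2" "(u p)\<^sup>2 + (fst (snd p) $ i * sin (snd (snd p) $ i))\<^sup>2"]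
      unfolding Z_def tr_arg_sq u_def by (simp add: sum_power2_gt_zero_iff) force
    have "((\<lambda>p. E i (Z p) - G i (Z p)) \<longlongrightarrow> E i (Z p0) - G i (Z p0)) (at p0)"
      using G E by (auto simp: isCont_def intro!: tendsto_intros)
    hence "((\<lambda>p. E i (Z p) - G i (Z p)) \<longlongrightarrow> 0) (at p0)" using E_eq_G[OF True] by simp
    hence "((\<lambda>p. (E i (Z p) - G i (Z p)) * ((u p)\<^sup>2 / (Z p $ i)\<^sup>2)) \<longlongrightarrow> 0) (at p0)"
    proof (rule Lim_null_comparison[rotated, OF tendsto_norm_zero], intro always_eventually allI)
      fix p
      show "norm ((E i (Z p) - G i (Z p)) * ((u p)\<^sup>2 / (Z p $ i)\<^sup>2)) \<le> norm (E i (Z p) - G i (Z p))"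
        using mult_left_mono[OF 1[of p], of "\<bar>E i (Z p) - G i (Z p)\<bar>"] by (simp add: abs_mult)
    qed
    thus ?thesis using True by (simp add: isCont_def)
  qed
  hence "isCont (\<lambda>p. G i (Z p) + (E i (Z p) - G i (Z p)) * ((u p)\<^sup>2 / (Z p $ i)\<^sup>2)) p0"
    by (rule isCont_add[OF G])
  thus "isCont (\<lambda>(x, y, a). ker2 i x y a) p0"
    by (simp add: ker2_def Z_def u_def case_prod_unfold)
qed

lemma cont_ker2:
  fixes p q r :: "'b::t2_space \<Rightarrow> real ^ 'n"
  assumes "continuous_on A p" "continuous_on A q" "continuous_on A r"
  shows "continuous_on A (\<lambda>w. ker2 i (p w) (q w) (r w))"
proof -
  have "continuous_on A (\<lambda>w. (\<lambda>(x, y, a). ker2 i x y a) (p w, q w, r w))"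
    by (rule continuous_on_compose2[OF cont_ker2_UNIV]) (auto intro!: continuous_intros assms)
  thus ?thesis by simp
qed

lemma f_tr_deriv: "((\<lambda>s. f (tr_arg (x + s *\<^sub>R axis i 1) y a)) has_real_derivative ker1 i x y a) (at 0)"
proof (rule DERIV_axis_all[where q="\<lambda>x. f (tr_arg x y a)" and q'="\<lambda>x. ker1 i x y a" and b="y $ i * cos (a $ i)"])
  fix x :: "real ^ 'n" assume "x $ i \<noteq> y $ i * cos (a $ i)"
  hence nz: "tr_arg x y a $ i \<noteq> 0" using tr_arg_add_axis_neq_0[of 0 y i a x] by simp
  hence p: "tr_arg x y a $ i > 0" by (simp add: less_le)
  show "((\<lambda>s. f (tr_arg (x + s *\<^sub>R axis i 1) y a)) has_real_derivative ker1 i x y a) (at 0)"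
    using DERIV_tr_arg_axis[OF f_deriv[OF p] nz] nz by (simp add: ker1_def)
qed (auto intro!: cont_f_tr cont_ker1 continuous_intros)

lemma ker1_deriv: "((\<lambda>s. ker1 i (x + s *\<^sub>R axis i 1) y a) has_real_derivative ker2 i x y a) (at 0)"
proof (rule DERIV_axis_all[where q="\<lambda>x. ker1 i x y a" and q'="\<lambda>x. ker2 i x y a" and b="y $ i * cos (a $ i)"])
  fix x :: "real ^ 'n" assume "x $ i \<noteq> y $ i * cos (a $ i)"
  hence nz: "tr_arg x y a $ i \<noteq> 0" using tr_arg_add_axis_neq_0[of 0 y i a x] by simp
  hence p: "tr_arg x y a $ i > 0" by (simp add: less_le)
  note D = DERIV_tr_arg_axis[where q="G i", OF G_deriv[OF p] nz]
  have "((\<lambda>s. G i (tr_arg (x + s *\<^sub>R axis i 1) y a) * (x $ i + s - y $ i * cos (a $ i))) has_real_derivative ker2 i x y a) (at 0)"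
    by (rule derivative_eq_intros D refl)+ (simp add: ker2_def power2_eq_square)
  thus "((\<lambda>s. ker1 i (x + s *\<^sub>R axis i 1) y a) has_real_derivative ker2 i x y a) (at 0)"
    by (simp add: ker1_def)
qed (auto intro!: cont_ker1 cont_ker2 continuous_intros)

end

section \<open>The generalized translation\<close>

lemma integral_directional_derivative_eq_0':
  fixes K H :: "'a::euclidean_space \<Rightarrow> real"
  assumes K: "integrable lborel K" and H: "integrable lborel H"
    and cont: "\<And>y. continuous_on UNIV (\<lambda>s. K (y + s *\<^sub>R b))"
    and fin: "\<And>y. finite {s. y + s *\<^sub>R b \<in> N}"
    and der: "\<And>y. y \<notin> N \<Longrightarrow> ((\<lambda>s. K (y + s *\<^sub>R b)) has_real_derivative H y) (at 0)"
  shows "(\<integral>y. H y \<partial>lborel) = 0"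
proof (rule integral_directional_derivative_eq_0[OF K H cont fin])
  fix y s assume "s \<notin> {s. y + s *\<^sub>R b \<in> N}"
  hence "((\<lambda>r. K ((y + s *\<^sub>R b) + r *\<^sub>R b)) has_real_derivative H (y + s *\<^sub>R b)) (at 0)"
    by (intro der) auto
  thus "((\<lambda>s. K (y + s *\<^sub>R b)) has_real_derivative H (y + s *\<^sub>R b)) (at s)"
    using DERIV_shift[of "\<lambda>s. K (y + s *\<^sub>R b)" _ 0 s] by (simp add: algebra_simps)
qed

definition trans_weight :: "real ^ 'n \<Rightarrow> real ^ 'n \<Rightarrow> real" where
  "trans_weight g a = (\<Prod>i\<in>UNIV. indicator {0..pi} (a $ i) * sin (a $ i) powr (g $ i - 1))"

definition trans_measure :: "real ^ 'n \<Rightarrow> (real ^ 'n) measure" where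
  "trans_measure g = density lborel (\<lambda>a. ennreal (trans_weight g a))"

lemma trans_weight_nonneg [simp]: "0 \<le> trans_weight g a"
  unfolding trans_weight_def by (intro prod_nonneg) auto

lemma borel_measurable_trans_weight [measurable]: "trans_weight g \<in> borel_measurable borel"
proof -
  have [measurable]: "(\<lambda>z. z $ i) \<in> borel_measurable (borel :: (real ^ 'n) measure)" for i
    by (intro borel_measurable_continuous_onI continuous_intros)
  show ?thesis unfolding trans_weight_def by measurable
qed

lemma sets_trans_measure [simp, measurable_cong]: "sets (trans_measure g) = sets borel"
  and space_trans_measure [simp]: "space (trans_measure g) = UNIV"
  by (simp_all add: trans_measure_def)

lemma Beta_real_pos: "0 < a \<Longrightarrow> 0 < b \<Longrightarrow> 0 < Beta a (b :: real)"
  by (simp add: Beta_def Gamma_real_pos add_pos_pos)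

lemma emeasure_trans_measure:
  fixes g :: "real ^ 'n"
  assumes "\<forall>i. g $ i > 0"
  shows "emeasure (trans_measure g) UNIV = ennreal (\<Prod>i\<in>UNIV. Beta (g $ i / 2) (1 / 2))"
proof -
  have "emeasure (trans_measure g) UNIV = (\<integral>\<^sup>+a. ennreal (trans_weight g a) \<partial>lborel)"
    by (simp add: trans_measure_def emeasure_density)
  also have "\<dots> = (\<integral>\<^sup>+a. (\<Prod>i\<in>UNIV. ennreal (indicator {0..pi} (a $ i) * sin (a $ i) powr (g $ i - 1))) \<partial>(lborel :: (real ^ 'n) measure))"
    by (simp add: trans_weight_def prod_ennreal)
  also have "\<dots> = (\<Prod>i\<in>UNIV. \<integral>\<^sup>+s. ennreal (indicator {0..pi} s * sin s powr (g $ i - 1)) \<partial>lborel)"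
    by (rule nn_integral_vec_prod) auto
  also have "\<dots> = (\<Prod>i\<in>UNIV. ennreal (Beta (g $ i / 2) (1 / 2)))"
    using assms by (intro prod.cong refl nn_integral_sin_powr) auto
  also have "\<dots> = ennreal (\<Prod>i\<in>UNIV. Beta (g $ i / 2) (1 / 2))"
    using assms by (intro prod_ennreal less_imp_le Beta_real_pos) auto
  finally show ?thesis .
qed

lemma trans_weight_eq_0: "a $ i \<notin> {0..pi} \<Longrightarrow> trans_weight g a = 0"
  by (auto simp: trans_weight_def intro!: prod_zero exI[of _ i])

lemma trans_weight_eq:
  "trans_weight g a = indicator (cbox 0 (\<chi> i. pi)) a * (\<Prod>i\<in>UNIV. sin (a $ i) powr (g $ i - 1))"
proof (cases "a \<in> cbox 0 (\<chi> i. pi)")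
  case True
  hence "a $ i \<in> {0..pi}" for i by (simp add: mem_box_cart)
  hence "indicator {0..pi} (a $ i) = (1::real)" for i by (simp only: indicator_eq_1_iff)
  thus ?thesis using True by (simp add: trans_weight_def)
next
  case False
  then obtain i where "a $ i \<notin> {0..pi}" by (auto simp: mem_box_cart)
  thus ?thesis using False by (simp add: trans_weight_eq_0)
qed

lemma compact_measure_trans_measure:
  assumes "\<forall>i. g $ i > 0"
  shows "compact_measure (trans_measure g)"
  unfolding compact_measure_def
proof (intro conjI exI[of _ "cbox 0 (\<chi> i. pi)"])
  show "finite_measure (trans_measure g)"
    using emeasure_trans_measure[OF assms] by (intro finite_measureI) auto
  show "AE x in trans_measure g. x \<in> cbox 0 (\<chi> i. pi)"
    unfolding trans_measure_def by (subst AE_density) (auto simp: trans_weight_eq indicator_def intro!: AE_I2)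
qed auto

lemma
  assumes g: "\<forall>i. g $ i > 0" and F: "continuous_on UNIV F"
  shows integrable_trans_weight: "integrable lborel (\<lambda>a. F a * trans_weight g a)"
    and integral_trans_measure: "(\<integral>a. F a \<partial>trans_measure g) = (\<integral>a. F a * trans_weight g a \<partial>lborel)"
proof -
  have Fm: "F \<in> borel_measurable borel" by (rule borel_measurable_continuous_onI[OF F])
  have "integrable (trans_measure g) F"
    by (rule compact_measure_integrable[OF compact_measure_trans_measure[OF g] F])
  thus "integrable lborel (\<lambda>a. F a * trans_weight g a)"
    unfolding trans_measure_def using Fm by (subst (asm) integrable_density) (auto simp: mult.commute)
  show "(\<integral>a. F a \<partial>trans_measure g) = (\<integral>a. F a * trans_weight g a \<partial>lborel)"
    unfolding trans_measure_def using Fm by (subst integral_density) (auto simp: mult.commute)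
qed

lemma gtrans_eq_integral:
  fixes g :: "real ^ 'n"
  assumes g: "\<forall>i. g $ i > 0" and F: "continuous_on UNIV (\<lambda>a. f (tr_arg x y a))"
  shows "gtrans g y f x = (\<Prod>i\<in>UNIV. Gamma ((g $ i + 1) / 2) / (Gamma (g $ i / 2) * Gamma (1 / 2))) *
    (\<integral>a. f (tr_arg x y a) \<partial>trans_measure g)"
proof -
  let ?F = "\<lambda>a. f (tr_arg x y a) * (\<Prod>i\<in>UNIV. sin (a $ i) powr (g $ i - 1))"
  have eq: "indicator (cbox 0 (\<chi> i. pi)) a *\<^sub>R ?F a = f (tr_arg x y a) * trans_weight g a" for a
    by (simp add: trans_weight_eq)
  have "set_integrable lborel (cbox 0 (\<chi> i. pi)) ?F"
    unfolding set_integrable_def eq by (rule integrable_trans_weight[OF g F])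
  from set_borel_integral_eq_integral(2)[OF this]
  have "integral (cbox 0 (\<chi> i. pi)) ?F = (\<integral>a. f (tr_arg x y a) \<partial>trans_measure g)"
    unfolding set_lebesgue_integral_def eq integral_trans_measure[OF g F] by simp
  thus ?thesis unfolding gtrans_def tr_arg_def by simp
qed

section \<open>The unnormalized translation and its Darboux equation\<close>

locale even_C2_weight = even_C2 f G E
  for f :: "real ^ 'n \<Rightarrow> real" and G E :: "'n \<Rightarrow> real ^ 'n \<Rightarrow> real" +
  fixes g :: "real ^ 'n"
  assumes g_pos: "\<forall>i. g $ i > 0"
begin

lemmas cm_trans = compact_measure_trans_measure[OF g_pos]

text \<open>The translation without its Gamma factors, which do not depend on \<open>x\<close> and
  \<open>y\<close> and return as \<open>gtrans_const\<close> at the end.\<close>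

definition v0 :: "real ^ 'n \<Rightarrow> real ^ 'n \<Rightarrow> real" where
  "v0 x y = (\<integral>a. f (tr_arg x y a) \<partial>trans_measure g)"

definition v1 :: "'n \<Rightarrow> real ^ 'n \<Rightarrow> real ^ 'n \<Rightarrow> real" where
  "v1 i x y = (\<integral>a. ker1 i x y a \<partial>trans_measure g)"

definition v2 :: "'n \<Rightarrow> real ^ 'n \<Rightarrow> real ^ 'n \<Rightarrow> real" where
  "v2 i x y = (\<integral>a. ker2 i x y a \<partial>trans_measure g)"

text \<open>By this symmetry \<open>v1 i y x\<close> is also the derivative of \<open>v0 x y\<close>
  in \<open>y_i\<close>, so no separate kernels for the second argument are introduced.\<close>

lemma v0_commute: "v0 x y = v0 y x"
  by (simp add: v0_def tr_arg_commute)

lemma cont_v_UNIV: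
  shows "continuous_on UNIV (\<lambda>(x, y). v0 x y)" "continuous_on UNIV (\<lambda>(x, y). v1 i x y)"
    "continuous_on UNIV (\<lambda>(x, y). v2 i x y)"
proof -
  show "continuous_on UNIV (\<lambda>(x, y). v0 x y)" unfolding v0_def case_prod_unfold
    by (rule continuous_compact_measure_integral[OF cm_trans])
      (auto intro!: cont_f_tr continuous_intros simp: case_prod_unfold)
  show "continuous_on UNIV (\<lambda>(x, y). v1 i x y)" unfolding v1_def case_prod_unfold
    by (rule continuous_compact_measure_integral[OF cm_trans])
      (auto intro!: cont_ker1 continuous_intros simp: case_prod_unfold)
  show "continuous_on UNIV (\<lambda>(x, y). v2 i x y)" unfolding v2_def case_prod_unfold
    by (rule continuous_compact_measure_integral[OF cm_trans])
      (auto intro!: cont_ker2 continuous_intros simp: case_prod_unfold)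
qed

lemma
  assumes "continuous_on A p" "continuous_on A q"
  shows cont_v0: "continuous_on A (\<lambda>w. v0 (p w) (q w))"
    and cont_v1: "continuous_on A (\<lambda>w. v1 i (p w) (q w))"
    and cont_v2: "continuous_on A (\<lambda>w. v2 i (p w) (q w))"
  using continuous_on_compose2[OF cont_v_UNIV(1) continuous_on_Pair[OF assms]]
    continuous_on_compose2[OF cont_v_UNIV(2) continuous_on_Pair[OF assms]]
    continuous_on_compose2[OF cont_v_UNIV(3) continuous_on_Pair[OF assms]] by simp_all

lemma v0_deriv: "((\<lambda>s. v0 (x + s *\<^sub>R axis i 1) y) has_real_derivative v1 i x y) (at 0)"
proof -
  have "((\<lambda>s. v0 (x + s *\<^sub>R axis i 1) y) has_real_derivative v1 i (x + 0 *\<^sub>R axis i 1) y) (at 0)"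
    unfolding v0_def v1_def
    by (rule leibniz_compact_measure[OF cm_trans])
      (auto intro!: cont_f_tr cont_ker1 continuous_intros DERIV_axis_shift[OF f_tr_deriv] simp: case_prod_unfold)
  thus ?thesis by simp
qed

lemma v1_deriv: "((\<lambda>s. v1 i (x + s *\<^sub>R axis i 1) y) has_real_derivative v2 i x y) (at 0)"
proof -
  have "((\<lambda>s. v1 i (x + s *\<^sub>R axis i 1) y) has_real_derivative v2 i (x + 0 *\<^sub>R axis i 1) y) (at 0)"
    unfolding v1_def v2_def
    by (rule leibniz_compact_measure[OF cm_trans])
      (auto intro!: cont_ker1 cont_ker2 continuous_intros DERIV_axis_shift[OF ker1_deriv] simp: case_prod_unfold)
  thus ?thesis by simp
qed

text \<open>\<open>ker2\<close> interpolates between \<open>G\<close> and \<open>E\<close> with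
  ratio \<open>u^2 / z_i^2\<close>, and \<open>z_i^2 - u^2\<close> is
  \<open>(y_i sin a_i)^2\<close>. Multiplying through by \<open>z_i^2\<close> covers the zeros of
  the root; the factor \<open>sin^2\<close> is what the angle derivative produces.\<close>

lemma E_minus_ker2:
  "(E i (tr_arg x y a) - ker2 i x y a) * (tr_arg x y a $ i)\<^sup>2 =
   (E i (tr_arg x y a) - G i (tr_arg x y a)) * (y $ i * sin (a $ i))\<^sup>2"
proof (cases "tr_arg x y a $ i = 0")
  case True
  thus ?thesis using E_eq_G[OF True] by simp
next
  case False
  let ?R = "(tr_arg x y a $ i)\<^sup>2" and ?u = "(x $ i - y $ i * cos (a $ i))\<^sup>2"
  have "(y $ i * sin (a $ i))\<^sup>2 = ?R - ?u" by (simp add: tr_arg_sq)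
  moreover have "(e - (k + (e - k) * (u / R))) * R = (e - k) * (R - u)" if "R \<noteq> 0" for e k u R :: real
    using that by (simp add: field_simps)
  ultimately show ?thesis using False by (simp add: ker2_def)
qed

text \<open>The integrand is \<open>\<partial>/\<partial>a\<^sub>i (G\<^sub>i sin\<^sup>g a\<^sub>i)\<close> with the remaining weight factors.\<close>

lemma angle_integral_eq_0:
  assumes x: "0 < x $ i" and y: "0 < y $ i"
  shows "(\<integral>a. (x $ i / y $ i) * (E i (tr_arg x y a) - ker2 i x y a) + g $ i * G i (tr_arg x y a) * cos (a $ i) \<partial>trans_measure g) = 0"
proof -
  define B where "B a = (x $ i / y $ i) * (E i (tr_arg x y a) - ker2 i x y a) + g $ i * G i (tr_arg x y a) * cos (a $ i)" for a
  \<comment> \<open>The weight \<open>sin^(g-1)\<close> may blow up at 0 and \<open>pi\<close>, but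
    one further sine turns it into \<open>sin^g\<close>, which tends to 0 there. Clamping the angle
    to \<open>[0, pi]\<close> expresses this product by one continuous formula.\<close>
  define c where "c b = sin (max 0 (min pi b))" for b :: real
  define W where "W a = (\<Prod>j\<in>UNIV - {i}. indicator {0..pi} (a $ j) * sin (a $ j) powr (g $ j - 1))" for a :: "real ^ 'n"
  have gi: "g $ i > 0" using g_pos by blast
  have W: "trans_weight g a = indicator {0..pi} (a $ i) * sin (a $ i) powr (g $ i - 1) * W a" for a
    unfolding trans_weight_def W_def by (rule prod.remove) auto
  have W': "W (a + s *\<^sub>R axis i 1) = W a" for a s
    unfolding W_def by (intro prod.cong) (auto simp: axis_def)
  have sw: "sin b * (indicator {0..pi} b * sin b powr (g $ i - 1)) = c b powr (g $ i)" for b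
  proof (cases "b \<in> {0..pi}")
    case True
    hence "sin b \<ge> 0" by (auto intro: sin_ge_zero)
    thus ?thesis using True by (auto simp: c_def powr_mult_base max_def min_def)
  next
    case False
    thus ?thesis by (auto simp: c_def max_def min_def)
  qed
  have K: "G i (tr_arg x y a) * sin (a $ i) * trans_weight g a = G i (tr_arg x y a) * c (a $ i) powr (g $ i) * W a" for a
    unfolding W sw[symmetric] by (simp only: mult_ac)
  have Bc: "continuous_on UNIV B" unfolding B_def
    by (intro continuous_intros cont_E_tr cont_G_tr cont_ker2)
  have "(\<integral>a. B a * trans_weight g a \<partial>lborel) = 0"
  proof (rule integral_directional_derivative_eq_0'[where b="axis i 1" and K="\<lambda>a. G i (tr_arg x y a) * sin (a $ i) * trans_weight g a" and N="{a. a $ i = 0 \<or> a $ i = pi}"])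
    show "integrable lborel (\<lambda>a. B a * trans_weight g a)" by (rule integrable_trans_weight[OF g_pos Bc])
    show "integrable lborel (\<lambda>a. G i (tr_arg x y a) * sin (a $ i) * trans_weight g a)"
      by (intro integrable_trans_weight[OF g_pos] continuous_intros cont_G_tr)
    fix a :: "real ^ 'n"
    show "continuous_on UNIV (\<lambda>s. G i (tr_arg x y (a + s *\<^sub>R axis i 1)) * sin ((a + s *\<^sub>R axis i 1) $ i) * trans_weight g (a + s *\<^sub>R axis i 1))"
      unfolding K W' c_def using gi
      by (intro continuous_intros cont_G_tr continuous_on_powr') (auto intro!: sin_ge_zero)
    have "{s. a + s *\<^sub>R axis i 1 \<in> {a. a $ i = 0 \<or> a $ i = pi}} \<subseteq> {- a $ i, pi - a $ i}" by auto
    thus "finite {s. a + s *\<^sub>R axis i 1 \<in> {a. a $ i = 0 \<or> a $ i = pi}}" by (rule finite_subset) simp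
    assume a: "a \<notin> {a. a $ i = 0 \<or> a $ i = pi}"
    show "((\<lambda>s. G i (tr_arg x y (a + s *\<^sub>R axis i 1)) * sin ((a + s *\<^sub>R axis i 1) $ i) * trans_weight g (a + s *\<^sub>R axis i 1)) has_real_derivative
       B a * trans_weight g a) (at 0)"
    proof (cases "a $ i \<in> {0..pi}")
      case False
      have z: "((\<lambda>s. 0) has_real_derivative B a * trans_weight g a) (at (0::real))"
        using False by (simp add: trans_weight_eq_0)
      define S where "S = (if a $ i < 0 then {..< - a $ i} else {pi - a $ i <..})"
      show ?thesis
      proof (rule has_field_derivative_transform_within_open[OF z, where S=S])
        show "open S" "0 \<in> S" using False by (auto simp: S_def)
        fix s assume "s \<in> S"
        hence "(a + s *\<^sub>R axis i 1) $ i \<notin> {0..pi}" using False by (auto simp: S_def split: if_splits)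
        thus "0 = G i (tr_arg x y (a + s *\<^sub>R axis i 1)) * sin ((a + s *\<^sub>R axis i 1) $ i) * trans_weight g (a + s *\<^sub>R axis i 1)"
          by (simp only: trans_weight_eq_0 mult_zero_right)
      qed
    next
      case True
      hence b: "0 < a $ i" "a $ i < pi" using a by auto
      hence sp: "sin (a $ i) > 0" by (rule sin_gt_zero)
      let ?z = "tr_arg x y a"
      have zp: "?z $ i > 0"
        using y sp by (auto simp: tr_arg_nth sum_power2_gt_zero_iff)
      have rad: "(x $ i)\<^sup>2 + (y $ i)\<^sup>2 - 2 * x $ i * y $ i * cos (a $ i) > 0"
        using zp by (simp add: tr_arg_def)
      have "((\<lambda>s. sqrt ((x $ i)\<^sup>2 + (y $ i)\<^sup>2 - 2 * x $ i * y $ i * cos (a $ i + s))) has_real_derivative x $ i * y $ i * sin (a $ i) / ?z $ i) (at 0)"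
        using rad by (auto intro!: derivative_eq_intros simp: tr_arg_def field_simps)
      from DERIV_axis_chain[where q="G i", OF G_deriv[OF zp] this]
      have DG: "((\<lambda>s. G i (tr_arg x y (a + s *\<^sub>R axis i 1))) has_real_derivative (E i ?z - G i ?z) / ?z $ i * (x $ i * y $ i * sin (a $ i) / ?z $ i)) (at 0)"
        unfolding tr_arg_add_axis_angle by (simp add: tr_arg_def)
      have Ds: "((\<lambda>s. sin (a $ i + s) powr (g $ i)) has_real_derivative g $ i * cos (a $ i) * sin (a $ i) powr (g $ i - 1)) (at 0)"
        using sp by (auto intro!: derivative_eq_intros simp: powr_diff field_simps)
      have "((\<lambda>s. G i (tr_arg x y (a + s *\<^sub>R axis i 1)) * sin (a $ i + s) powr (g $ i) * W a) has_real_derivative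
         ((E i ?z - G i ?z) / ?z $ i * (x $ i * y $ i * sin (a $ i) / ?z $ i) * sin (a $ i) powr (g $ i) +
          (g $ i * cos (a $ i) * sin (a $ i) powr (g $ i - 1)) * G i ?z) * W a) (at 0)"
        by (rule derivative_eq_intros DG Ds refl)+ simp
      moreover have "((E i ?z - G i ?z) / ?z $ i * (x $ i * y $ i * sin (a $ i) / ?z $ i) * sin (a $ i) powr (g $ i) +
          (g $ i * cos (a $ i) * sin (a $ i) powr (g $ i - 1)) * G i ?z) * W a = B a * trans_weight g a"
      proof -
        have 1: "sin (a $ i) powr (g $ i) = sin (a $ i) * sin (a $ i) powr (g $ i - 1)"
          using sp by (simp add: powr_mult_base)
        have "E i ?z - ker2 i x y a = (E i ?z - G i ?z) * (y $ i * sin (a $ i))\<^sup>2 / (?z $ i)\<^sup>2"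
          using E_minus_ker2[of i x y a] zp by (simp add: field_simps)
        hence 2: "(E i ?z - G i ?z) / ?z $ i * (x $ i * y $ i * sin (a $ i) / ?z $ i) * sin (a $ i) = (x $ i / y $ i) * (E i ?z - ker2 i x y a)"
          using y by (simp add: power2_eq_square)
        show ?thesis unfolding B_def W 1 2[symmetric] using True by (simp add: algebra_simps)
      qed
      ultimately have "((\<lambda>s. G i (tr_arg x y (a + s *\<^sub>R axis i 1)) * sin (a $ i + s) powr (g $ i) * W a) has_real_derivative B a * trans_weight g a) (at 0)"
        by simp
      thus ?thesis
      proof (rule has_field_derivative_transform_within_open[where S="{- a $ i <..< pi - a $ i}"])
        fix s assume s: "s \<in> {- a $ i <..< pi - a $ i}"
        have "c ((a + s *\<^sub>R axis i 1) $ i) = sin (a $ i + s)" using s by (auto simp: c_def max_def min_def)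
        thus "G i (tr_arg x y (a + s *\<^sub>R axis i 1)) * sin (a $ i + s) powr (g $ i) * W a =
           G i (tr_arg x y (a + s *\<^sub>R axis i 1)) * sin ((a + s *\<^sub>R axis i 1) $ i) * trans_weight g (a + s *\<^sub>R axis i 1)"
          unfolding K W' by simp
      qed (use b in auto)
    qed
  qed
  thus ?thesis using integral_trans_measure[OF g_pos Bc] unfolding B_def by simp
qed

text \<open>Before integration the two Bessel operators already differ only by an angle-independent
  multiple of the integrand in \<open>angle_integral_eq_0\<close>. For \<open>x_i = y_i\<close> both
  sides vanish and the root may be zero; otherwise its square is at least
  \<open>(x_i - y_i)^2\<close>, so division is safe.\<close>

lemma ker_Darboux:
  assumes x: "0 < x $ i" and y: "0 < y $ i"
  shows "ker2 i x y a + g $ i / x $ i * ker1 i x y a - (ker2 i y x a + g $ i / y $ i * ker1 i y x a) =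
    ((x $ i)\<^sup>2 - (y $ i)\<^sup>2) / (x $ i * y $ i) *
    ((x $ i / y $ i) * (E i (tr_arg x y a) - ker2 i x y a) + g $ i * G i (tr_arg x y a) * cos (a $ i))"
proof (cases "x $ i = y $ i")
  case True
  thus ?thesis by (simp add: ker1_def ker2_def tr_arg_commute[of y x])
next
  case False
  define X Y c s R e k where "X = x $ i" "Y = y $ i" "c = cos (a $ i)" "s = sin (a $ i)"
    "R = (tr_arg x y a $ i)\<^sup>2" "e = E i (tr_arg x y a)" "k = G i (tr_arg x y a)"
  note d = this
  have pos: "X > 0" "Y > 0" "X \<noteq> Y" using x y False by (auto simp: d)
  have s2: "s\<^sup>2 = 1 - c\<^sup>2" by (simp add: d sin_squared_eq)
  have R: "R = X\<^sup>2 + Y\<^sup>2 - 2 * X * Y * c" by (simp add: d tr_arg_def tr_radicand)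
  have "X * Y * c \<le> X * Y * 1" using pos by (intro mult_left_mono) (auto simp: d)
  hence "R \<ge> (X - Y)\<^sup>2" by (simp add: R power2_eq_square algebra_simps)
  moreover have "(X - Y)\<^sup>2 > 0" using pos by simp
  ultimately have Rp: "R > 0" by linarith
  have k1: "ker2 i x y a = k + (e - k) * ((X - Y * c)\<^sup>2 / R)" and k2: "ker2 i y x a = k + (e - k) * ((Y - X * c)\<^sup>2 / R)"
    by (simp_all add: ker2_def d tr_arg_commute[of y x])
  have k3: "ker1 i x y a = k * (X - Y * c)" and k4: "ker1 i y x a = k * (Y - X * c)"
    by (simp_all add: ker1_def d tr_arg_commute[of y x])
  have "E i (tr_arg x y a) - ker2 i x y a = (e - k) * (Y * s)\<^sup>2 / R"
    using E_minus_ker2[of i x y a] Rp by (simp add: d field_simps)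
  hence 1: "E i (tr_arg x y a) - ker2 i x y a = (e - k) * (Y\<^sup>2 * (1 - c\<^sup>2)) / R" by (simp add: power_mult_distrib s2)
  have 2: "(X - Y * c)\<^sup>2 - (Y - X * c)\<^sup>2 = (X\<^sup>2 - Y\<^sup>2) * (1 - c\<^sup>2)" by (simp add: power2_eq_square algebra_simps)
  have "ker2 i x y a - ker2 i y x a = (e - k) * (((X - Y * c)\<^sup>2 - (Y - X * c)\<^sup>2) / R)"
    unfolding k1 k2 by (simp add: algebra_simps diff_divide_distrib)
  also have "\<dots> = (X\<^sup>2 - Y\<^sup>2) / (X * Y) * ((X / Y) * ((e - k) * (Y\<^sup>2 * (1 - c\<^sup>2)) / R))"
    unfolding 2 using pos Rp by (simp add: field_simps power2_eq_square)
  finally have 3: "ker2 i x y a - ker2 i y x a = (X\<^sup>2 - Y\<^sup>2) / (X * Y) * ((X / Y) * ((e - k) * (Y\<^sup>2 * (1 - c\<^sup>2)) / R))" .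
  have 4: "g $ i / X * ker1 i x y a - g $ i / Y * ker1 i y x a = (X\<^sup>2 - Y\<^sup>2) / (X * Y) * (g $ i * k * c)"
    unfolding k3 k4 using pos by (simp add: field_simps power2_eq_square)
  show ?thesis unfolding 1 using 3 4 by (simp add: d(1,2,3,7) distrib_left)
qed

lemma v_Darboux:
  assumes x: "0 < x $ i" and y: "0 < y $ i"
  shows "v2 i x y + g $ i / x $ i * v1 i x y = v2 i y x + g $ i / y $ i * v1 i y x"
proof -
  have i1: "integrable (trans_measure g) (ker1 i x y)" "integrable (trans_measure g) (ker2 i x y)" for x y
    by (intro compact_measure_integrable[OF cm_trans] cont_ker1 cont_ker2 continuous_intros)+
  have "v2 i x y + g $ i / x $ i * v1 i x y - (v2 i y x + g $ i / y $ i * v1 i y x) =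
     (\<integral>a. ker2 i x y a + g $ i / x $ i * ker1 i x y a - (ker2 i y x a + g $ i / y $ i * ker1 i y x a) \<partial>trans_measure g)"
    unfolding v1_def v2_def using i1 by simp
  also have "\<dots> = 0"
    unfolding ker_Darboux[OF x y] using angle_integral_eq_0[OF x y] by simp
  finally show ?thesis by simp
qed

end

section \<open>Divergence theorem on the weighted ball\<close>

lemma compact_measure_radial_bounded:
  assumes [measurable]: "c \<in> borel_measurable borel" and c: "\<And>r. 0 \<le> c r" "\<And>r. 0 < r \<Longrightarrow> r \<le> R \<Longrightarrow> c r \<le> C"
    and R: "\<And>r. r > R \<Longrightarrow> c r = 0" and m: "0 \<le> m" 
  shows "compact_measure (radial_measure m c)"
proof (rule compact_measure_radial_measure[OF _ R])
  have "(\<integral>\<^sup>+r. ennreal (indicator {0<..} r * r powr m * c r) \<partial>lborel) \<le> (\<integral>\<^sup>+r. ennreal (R powr m * C) * indicator {0..R} r \<partial>lborel)"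
  proof (rule nn_integral_mono)
    fix r :: real
    show "ennreal (indicator {0<..} r * r powr m * c r) \<le> ennreal (R powr m * C) * indicator {0..R} r"
    proof (cases "0 < r \<and> r \<le> R")
      case True
      hence "r powr m * c r \<le> R powr m * C"
        using m c(1)[of r] c(2)[of r] by (intro mult_mono powr_mono2) auto
      thus ?thesis using True by (simp add: ennreal_leI)
    next
      case False
      thus ?thesis using R[of r] by (auto simp: indicator_def not_le)
    qed
  qed
  also have "\<dots> < \<infinity>"
    by (subst nn_integral_cmult) (auto simp: ennreal_mult_less_top emeasure_lborel_Icc_eq)
  finally show "(\<integral>\<^sup>+r. ennreal (indicator {0<..} r * r powr m * c r) \<partial>lborel) < \<infinity>" .
qed auto

lemma integral_radial_measure:
  assumes [measurable]: "c \<in> borel_measurable borel" and c: "\<And>r. 0 \<le> c r" and R: "\<And>r. r > R \<Longrightarrow> c r = 0" and "m > 0"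
    and cm: "compact_measure (radial_measure m c)" and F: "continuous_on UNIV F"
  shows "(\<integral>r. F r \<partial>radial_measure m c) = integral {0..R} (\<lambda>r. r powr m * c r * F r)"
proof -
  have [measurable]: "F \<in> borel_measurable borel" by (rule borel_measurable_continuous_onI[OF F])
  have eq: "indicator {0<..} r * r powr m * c r * F r = indicator {0..R} r *\<^sub>R (r powr m * c r * F r)" for r
    using R[of r] by (cases "r = 0") (auto simp: indicator_def not_le)
  have "integrable (radial_measure m c) F" by (rule compact_measure_integrable[OF cm F])
  hence "integrable lborel (\<lambda>r. indicator {0<..} r * r powr m * c r * F r)"
    unfolding radial_measure_def using c by (subst (asm) integrable_density) auto
  hence "set_integrable lborel {0..R} (\<lambda>r. r powr m * c r * F r)"
    unfolding set_integrable_def eq .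
  from set_borel_integral_eq_integral(2)[OF this]
  have "integral {0..R} (\<lambda>r. r powr m * c r * F r) = (\<integral>r. indicator {0<..} r * r powr m * c r * F r \<partial>lborel)"
    unfolding set_lebesgue_integral_def eq by simp
  also have "\<dots> = (\<integral>r. F r \<partial>radial_measure m c)"
    unfolding radial_measure_def using c by (subst integral_density) auto
  finally show ?thesis by simp
qed

lemma
  assumes g: "\<forall>i. g $ i > 0" and [measurable]: "c \<in> borel_measurable borel" and c: "\<And>r. 0 \<le> c r"
    and cm: "compact_measure (orth_measure g c)" and F: "continuous_on UNIV F"
  shows integrable_orth_measure_lborel: "integrable lborel (\<lambda>y. F y * (orth_weight g y * c (norm y)))"
    and integral_orth_measure_lborel: "(\<integral>y. F y \<partial>orth_measure g c) = (\<integral>y. F y * (orth_weight g y * c (norm y)) \<partial>lborel)"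
proof -
  have Fm: "F \<in> borel_measurable borel" by (rule borel_measurable_continuous_onI[OF F])
  have "integrable (orth_measure g c) F" by (rule compact_measure_integrable[OF cm F])
  thus "integrable lborel (\<lambda>y. F y * (orth_weight g y * c (norm y)))"
    unfolding orth_measure_def using Fm c by (subst (asm) integrable_density) (auto simp: mult.commute)
  show "(\<integral>y. F y \<partial>orth_measure g c) = (\<integral>y. F y * (orth_weight g y * c (norm y)) \<partial>lborel)"
    unfolding orth_measure_def using Fm c by (subst integral_density) (auto simp: mult.commute)
qed

lemma not_orth_openI: "z $ j \<le> 0 \<Longrightarrow> z \<notin> orth_open"
  by (auto simp: orth_open_def not_less)

lemma norm_add_axis_sq: "(norm (y + s *\<^sub>R axis i 1))\<^sup>2 = (norm y)\<^sup>2 + 2 * y $ i * s + s\<^sup>2"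
  for y :: "real ^ 'n"
  unfolding power2_norm_eq_inner
  by (simp add: inner_add_left inner_add_right inner_axis inner_axis' power2_eq_square algebra_simps)

context even_C2_weight
begin

lemmas cm_sph = compact_measure_sph_measure[OF g_pos]

definition lap :: "real ^ 'n \<Rightarrow> real ^ 'n \<Rightarrow> real" where
  "lap x y = (\<Sum>i\<in>UNIV. v2 i x y + g $ i / x $ i * v1 i x y)"

lemma cont_lap: "continuous_on A (lap x)"
  unfolding lap_def by (intro continuous_intros cont_v1 cont_v2)

text \<open>In each coordinate, \<open>y^g\<close> times the Bessel operator in \<open>y_i\<close>
  is the derivative of \<open>y^g\<close> times the first derivative. Multiplied by the cutoff, the
  field \<open>K\<close> has compact support and is continuous, so its derivative integrates to 0;
  differentiating the cutoff yields \<open>- 2 y_i\<close> inside the ball, the source of the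
  right-hand side.\<close>

lemma ball_divergence:
  assumes x: "x \<in> orth_open" and T: "T > 0"
  shows "(\<integral>y. lap x y \<partial>orth_measure g (\<lambda>r. max 0 (T\<^sup>2 - r\<^sup>2))) =
    2 * (\<integral>y. (\<Sum>i\<in>UNIV. y $ i * v1 i y x) \<partial>orth_measure g (indicator {..T}))"
proof -
  define c1 where "c1 r = max 0 (T\<^sup>2 - r\<^sup>2)" for r :: real
  define c2 where "c2 = (indicator {..T} :: real \<Rightarrow> real)"
  have [measurable]: "c1 \<in> borel_measurable borel" "c2 \<in> borel_measurable borel"
    unfolding c1_def c2_def by measurable
  have c1: "c1 r \<ge> 0" "0 < r \<Longrightarrow> r \<le> T \<Longrightarrow> c1 r \<le> T\<^sup>2" "r > T \<Longrightarrow> c1 r = 0" for r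
  proof -
    show "c1 r = 0" if "r > T"
      using that T by (auto simp: c1_def max_def intro!: antisym power_mono)
  qed (auto simp: c1_def)
  have c2: "c2 r \<ge> 0" "0 < r \<Longrightarrow> r \<le> T \<Longrightarrow> c2 r \<le> 1" "r > T \<Longrightarrow> c2 r = 0" for r by (auto simp: c2_def)
  have m: "sph_dim g > 0" by (rule sph_dim_pos[OF g_pos])
  have r1: "compact_measure (radial_measure (sph_dim g) c1)"
    by (rule compact_measure_radial_bounded[OF _ c1]) (use m in auto)
  have r2: "compact_measure (radial_measure (sph_dim g) c2)"
    by (rule compact_measure_radial_bounded[OF _ c2]) (use m in auto)
  have o1: "compact_measure (orth_measure g c1)"
    by (rule compact_measure_orth_measure[OF g_pos _ c1(1,3) r1]) auto
  have o2: "compact_measure (orth_measure g c2)"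
    by (rule compact_measure_orth_measure[OF g_pos _ c2(1,3) r2]) auto
  note i1 = integrable_orth_measure_lborel[OF g_pos _ c1(1) o1] and i2 = integrable_orth_measure_lborel[OF g_pos _ c2(1) o2]
  note e1 = integral_orth_measure_lborel[OF g_pos _ c1(1) o1] and e2 = integral_orth_measure_lborel[OF g_pos _ c2(1) o2]
  define b where "b i y = v2 i x y + g $ i / x $ i * v1 i x y" for i y
  have bc: "continuous_on UNIV (b i)" for i unfolding b_def by (intro continuous_intros cont_v1 cont_v2)
  have yc: "continuous_on UNIV (\<lambda>y. y $ i * v1 i y x)" for i by (intro continuous_intros cont_v1)
  have Hi: "integrable lborel (\<lambda>y. b i y * (orth_weight g y * c1 (norm y)))"
    "integrable lborel (\<lambda>y. y $ i * v1 i y x * (orth_weight g y * c2 (norm y)))" for i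
    by (intro i1 i2 bc yc; simp)+
  have zero: "(\<integral>y. b i y * (orth_weight g y * c1 (norm y)) - 2 * (y $ i * v1 i y x * (orth_weight g y * c2 (norm y))) \<partial>lborel) = 0" for i
  proof (rule integral_directional_derivative_eq_0'[where b="axis i 1" and N="{y. y $ i = 0 \<or> norm y = T}" and
      K="\<lambda>y. v1 i y x * (orth_weight g y * c1 (norm y))"])
    show "integrable lborel (\<lambda>y. v1 i y x * (orth_weight g y * c1 (norm y)))"
      by (intro i1 cont_v1 continuous_intros) simp
    show "integrable lborel (\<lambda>y. b i y * (orth_weight g y * c1 (norm y)) - 2 * (y $ i * v1 i y x * (orth_weight g y * c2 (norm y))))"
      using Hi[of i] by simp
    have Kc: "continuous_on UNIV (\<lambda>y. v1 i y x * (orth_weight g y * c1 (norm y)))"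
      unfolding c1_def by (intro continuous_intros cont_v1 continuous_on_orth_weight[OF g_pos])
    fix y :: "real ^ 'n"
    show "continuous_on UNIV (\<lambda>s. v1 i (y + s *\<^sub>R axis i 1) x * (orth_weight g (y + s *\<^sub>R axis i 1) * c1 (norm (y + s *\<^sub>R axis i 1))))"
      by (rule continuous_on_compose2[OF Kc]) (auto intro!: continuous_intros)
    \<comment> \<open>Completing the square: the line meets the sphere of radius \<open>T\<close>
      exactly where \<open>(y_i + s)^2 = Q\<close>, hence for at most two parameters.\<close>
    define Q where "Q = (y $ i)\<^sup>2 - (norm y)\<^sup>2 + T\<^sup>2"
    have "{s. y + s *\<^sub>R axis i 1 \<in> {y. y $ i = 0 \<or> norm y = T}} \<subseteq> {- y $ i, - y $ i + sqrt Q, - y $ i - sqrt Q}"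
    proof
      fix s assume "s \<in> {s. y + s *\<^sub>R axis i 1 \<in> {y. y $ i = 0 \<or> norm y = T}}"
      then consider "y $ i + s = 0" | "norm (y + s *\<^sub>R axis i 1) = T" by auto
      thus "s \<in> {- y $ i, - y $ i + sqrt Q, - y $ i - sqrt Q}"
      proof cases
        case 1
        thus ?thesis by auto
      next
        case 2
        hence "(y $ i + s)\<^sup>2 = Q" using norm_add_axis_sq[of y s i] by (simp add: Q_def power2_eq_square algebra_simps)
        hence "sqrt Q = \<bar>y $ i + s\<bar>" by (metis real_sqrt_abs)
        thus ?thesis by (auto simp: abs_if split: if_splits)
      qed
    qed
    thus "finite {s. y + s *\<^sub>R axis i 1 \<in> {y. y $ i = 0 \<or> norm y = T}}" by (rule finite_subset) simp
    assume y: "y \<notin> {y. y $ i = 0 \<or> norm y = T}"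
    let ?goal = "((\<lambda>s. v1 i (y + s *\<^sub>R axis i 1) x * (orth_weight g (y + s *\<^sub>R axis i 1) * c1 (norm (y + s *\<^sub>R axis i 1)))) has_real_derivative
       b i y * (orth_weight g y * c1 (norm y)) - 2 * (y $ i * v1 i y x * (orth_weight g y * c2 (norm y)))) (at 0)"
    have cn: "continuous_on UNIV (\<lambda>s. norm (y + s *\<^sub>R axis i 1))" by (intro continuous_intros)
    consider "y \<notin> orth_open" | "norm y > T" | "y \<in> orth_open" "norm y < T" using y by fastforce
    thus ?goal
    proof cases
      case 1
      \<comment> \<open>\<open>K\<close> vanishes near \<open>s = 0\<close>: a negative
        \<open>y_i\<close> stays negative for small \<open>s\<close>, and if \<open>y_i\<close> is
        positive some other coordinate is nonpositive and does not move.\<close>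
      define S where "S = (if y $ i < 0 then {..< - y $ i} else UNIV)"
      have z: "((\<lambda>s. 0) has_real_derivative b i y * (orth_weight g y * c1 (norm y)) - 2 * (y $ i * v1 i y x * (orth_weight g y * c2 (norm y)))) (at (0::real))"
        using 1 by (simp add: orth_weight_eq)
      show ?goal
      proof (rule has_field_derivative_transform_within_open[OF z, where S=S])
        show "open S" "0 \<in> S" by (auto simp: S_def)
        fix s assume s: "s \<in> S"
        have "y + s *\<^sub>R axis i 1 \<notin> orth_open"
        proof (cases "y $ i < 0")
          case True
          hence "(y + s *\<^sub>R axis i 1) $ i \<le> 0" using s by (simp add: S_def)
          thus ?thesis by (rule not_orth_openI)
        next
          case False
          hence "y $ i > 0" using y by auto
          moreover from 1 obtain j where j: "y $ j \<le> 0" by (auto simp: orth_open_def not_less)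
          ultimately have "j \<noteq> i" by auto
          hence "(y + s *\<^sub>R axis i 1) $ j \<le> 0" using j by (simp add: axis_def)
          thus ?thesis by (rule not_orth_openI)
        qed
        thus "0 = v1 i (y + s *\<^sub>R axis i 1) x * (orth_weight g (y + s *\<^sub>R axis i 1) * c1 (norm (y + s *\<^sub>R axis i 1)))"
          by (simp add: orth_weight_eq)
      qed
    next
      case 2
      have z: "((\<lambda>s. 0) has_real_derivative b i y * (orth_weight g y * c1 (norm y)) - 2 * (y $ i * v1 i y x * (orth_weight g y * c2 (norm y)))) (at (0::real))"
        using 2 by (simp add: c1(3) c2(3))
      show ?goal
      proof (rule has_field_derivative_transform_within_open[OF z, where S="{s. T < norm (y + s *\<^sub>R axis i 1)}"])
        show "open {s. T < norm (y + s *\<^sub>R axis i 1)}" using cn by (intro open_Collect_less continuous_intros)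
      qed (use 2 c1(3) in auto)
    next
      case 3
      have yi: "y $ i > 0" and xi: "x $ i > 0" using 3 x by (auto simp: orth_open_def)
      have gi: "g $ i > 0" using g_pos by blast
      \<comment> \<open>The weight of the remaining coordinates, constant along the line.\<close>
      define W where "W = (\<Prod>j\<in>UNIV - {i}. max 0 (y $ j) powr g $ j)"
      have W: "orth_weight g (y + s *\<^sub>R axis i 1) = max 0 (y $ i + s) powr g $ i * W" for s
      proof -
        have "orth_weight g (y + s *\<^sub>R axis i 1) = max 0 ((y + s *\<^sub>R axis i 1) $ i) powr g $ i *
            (\<Prod>j\<in>UNIV - {i}. max 0 ((y + s *\<^sub>R axis i 1) $ j) powr g $ j)"
          unfolding orth_weight_def by (rule prod.remove) auto
        also have "(\<Prod>j\<in>UNIV - {i}. max 0 ((y + s *\<^sub>R axis i 1) $ j) powr g $ j) = W"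
          unfolding W_def by (intro prod.cong) (auto simp: axis_def)
        finally show ?thesis by simp
      qed
      have W0: "orth_weight g y = y $ i powr g $ i * W" using W[of 0] yi by simp
      have c10: "c1 (norm y) = T\<^sup>2 - (norm y)\<^sup>2" and c20: "c2 (norm y) = 1"
        using 3 T by (auto simp: c1_def c2_def max_def power_mono)
      have "((\<lambda>s. v1 i (y + s *\<^sub>R axis i 1) x * ((y $ i + s) powr g $ i * W * (T\<^sup>2 - ((norm y)\<^sup>2 + 2 * y $ i * s + s\<^sup>2)))) has_real_derivative
         v2 i y x * (y $ i powr g $ i * W * (T\<^sup>2 - (norm y)\<^sup>2)) +
         (g $ i * y $ i powr (g $ i - 1) * W * (T\<^sup>2 - (norm y)\<^sup>2) - 2 * y $ i * (y $ i powr g $ i * W)) * v1 i y x) (at 0)"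
        using yi by (auto intro!: derivative_eq_intros v1_deriv simp: powr_diff algebra_simps diff_divide_distrib)
      moreover have "y $ i powr (g $ i - 1) = y $ i powr g $ i / y $ i" using yi by (simp add: powr_diff)
      \<comment> \<open>Here the operator in \<open>x_i\<close> is exchanged for the operator in
        \<open>y_i\<close>; both coordinates are positive in this case.\<close>
      moreover have "b i y = v2 i y x + g $ i / y $ i * v1 i y x"
        unfolding b_def by (rule v_Darboux[OF xi yi])
      ultimately have "((\<lambda>s. v1 i (y + s *\<^sub>R axis i 1) x * ((y $ i + s) powr g $ i * W * (T\<^sup>2 - ((norm y)\<^sup>2 + 2 * y $ i * s + s\<^sup>2)))) has_real_derivative
         b i y * (orth_weight g y * c1 (norm y)) - 2 * (y $ i * v1 i y x * (orth_weight g y * c2 (norm y)))) (at 0)"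
        unfolding W0 c10 c20 by (simp add: algebra_simps diff_divide_distrib)
      thus ?goal
      proof (rule has_field_derivative_transform_within_open[where S="{- y $ i <..} \<inter> {s. norm (y + s *\<^sub>R axis i 1) < T}"])
        show "open ({- y $ i <..} \<inter> {s. norm (y + s *\<^sub>R axis i 1) < T})"
          using cn by (intro open_Int open_Collect_less continuous_intros open_greaterThan)
        show "0 \<in> {- y $ i <..} \<inter> {s. norm (y + s *\<^sub>R axis i 1) < T}" using 3 yi by simp
        fix s assume s: "s \<in> {- y $ i <..} \<inter> {s. norm (y + s *\<^sub>R axis i 1) < T}"
        hence "(norm (y + s *\<^sub>R axis i 1))\<^sup>2 \<le> T\<^sup>2" by (intro power_mono) auto
        hence "c1 (norm (y + s *\<^sub>R axis i 1)) = T\<^sup>2 - ((norm y)\<^sup>2 + 2 * y $ i * s + s\<^sup>2)"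
          unfolding c1_def norm_add_axis_sq by simp
        moreover have "max 0 (y $ i + s) = y $ i + s" using s by simp
        ultimately show "v1 i (y + s *\<^sub>R axis i 1) x * ((y $ i + s) powr g $ i * W * (T\<^sup>2 - ((norm y)\<^sup>2 + 2 * y $ i * s + s\<^sup>2))) =
          v1 i (y + s *\<^sub>R axis i 1) x * (orth_weight g (y + s *\<^sub>R axis i 1) * c1 (norm (y + s *\<^sub>R axis i 1)))"
          unfolding W by simp
      qed
    qed
  qed
  have "(\<integral>y. lap x y \<partial>orth_measure g c1) = (\<integral>y. (\<Sum>i\<in>UNIV. b i y * (orth_weight g y * c1 (norm y))) \<partial>lborel)"
    by (subst e1[OF _ cont_lap]) (auto simp: lap_def b_def sum_distrib_right)
  also have "\<dots> = (\<Sum>i\<in>UNIV. \<integral>y. b i y * (orth_weight g y * c1 (norm y)) \<partial>lborel)"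
    using Hi by (intro Bochner_Integration.integral_sum) auto
  also have "\<dots> = (\<Sum>i\<in>UNIV. 2 * (\<integral>y. y $ i * v1 i y x * (orth_weight g y * c2 (norm y)) \<partial>lborel))"
    using zero Hi by (intro sum.cong refl) simp
  also have "\<dots> = 2 * (\<integral>y. (\<Sum>i\<in>UNIV. y $ i * v1 i y x * (orth_weight g y * c2 (norm y))) \<partial>lborel)"
    using Hi by (subst Bochner_Integration.integral_sum) (auto simp: sum_distrib_left)
  also have "(\<integral>y. (\<Sum>i\<in>UNIV. y $ i * v1 i y x * (orth_weight g y * c2 (norm y))) \<partial>lborel) =
     (\<integral>y. (\<Sum>i\<in>UNIV. y $ i * v1 i y x) \<partial>orth_measure g c2)"
    by (subst e2) (auto simp: sum_distrib_right intro!: continuous_intros cont_v1)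
  finally show ?thesis unfolding c1_def c2_def .
qed

end

section \<open>Spherical means\<close>

context even_C2_weight
begin

definition Phi0 :: "real ^ 'n \<Rightarrow> real \<Rightarrow> real" where
  "Phi0 x t = (\<integral>z. v0 x (t *\<^sub>R z) \<partial>sph_measure g)"

definition Phi1 :: "'n \<Rightarrow> real ^ 'n \<Rightarrow> real \<Rightarrow> real" where
  "Phi1 i x t = (\<integral>z. v1 i x (t *\<^sub>R z) \<partial>sph_measure g)"

definition Phi2 :: "'n \<Rightarrow> real ^ 'n \<Rightarrow> real \<Rightarrow> real" where
  "Phi2 i x t = (\<integral>z. v2 i x (t *\<^sub>R z) \<partial>sph_measure g)"

text \<open>The radial derivative of \<open>v0 x\<close> at \<open>t z\<close>, written with
  \<open>v1\<close> by the symmetry of \<open>v0\<close>.\<close>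

definition PhiT :: "real ^ 'n \<Rightarrow> real \<Rightarrow> real" where
  "PhiT x t = (\<integral>z. (\<Sum>i\<in>UNIV. z $ i * v1 i (t *\<^sub>R z) x) \<partial>sph_measure g)"

definition Hm :: "real ^ 'n \<Rightarrow> real \<Rightarrow> real" where
  "Hm x t = (\<Sum>i\<in>UNIV. Phi2 i x t + g $ i / x $ i * Phi1 i x t)"

lemma cont_Phi_UNIV:
  shows "continuous_on UNIV (\<lambda>(x, t). Phi0 x t)" "continuous_on UNIV (\<lambda>(x, t). Phi1 i x t)"
    "continuous_on UNIV (\<lambda>(x, t). Phi2 i x t)" "continuous_on UNIV (\<lambda>(x, t). PhiT x t)"
proof -
  show "continuous_on UNIV (\<lambda>(x, t). Phi0 x t)" unfolding Phi0_def case_prod_unfold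
    by (rule continuous_compact_measure_integral[OF cm_sph])
      (auto intro!: cont_v0 continuous_intros simp: case_prod_unfold)
  show "continuous_on UNIV (\<lambda>(x, t). Phi1 i x t)" unfolding Phi1_def case_prod_unfold
    by (rule continuous_compact_measure_integral[OF cm_sph])
      (auto intro!: cont_v1 continuous_intros simp: case_prod_unfold)
  show "continuous_on UNIV (\<lambda>(x, t). Phi2 i x t)" unfolding Phi2_def case_prod_unfold
    by (rule continuous_compact_measure_integral[OF cm_sph])
      (auto intro!: cont_v2 continuous_intros simp: case_prod_unfold)
  show "continuous_on UNIV (\<lambda>(x, t). PhiT x t)" unfolding PhiT_def case_prod_unfold
    by (rule continuous_compact_measure_integral[OF cm_sph])
      (auto intro!: cont_v1 continuous_intros simp: case_prod_unfold)
qed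

lemma
  assumes "continuous_on A p" "continuous_on A q"
  shows cont_Phi0: "continuous_on A (\<lambda>w. Phi0 (p w) (q w))"
    and cont_Phi1: "continuous_on A (\<lambda>w. Phi1 i (p w) (q w))"
    and cont_Phi2: "continuous_on A (\<lambda>w. Phi2 i (p w) (q w))"
    and cont_PhiT: "continuous_on A (\<lambda>w. PhiT (p w) (q w))"
  using continuous_on_compose2[OF cont_Phi_UNIV(1) continuous_on_Pair[OF assms]]
    continuous_on_compose2[OF cont_Phi_UNIV(2) continuous_on_Pair[OF assms]]
    continuous_on_compose2[OF cont_Phi_UNIV(3) continuous_on_Pair[OF assms]]
    continuous_on_compose2[OF cont_Phi_UNIV(4) continuous_on_Pair[OF assms]] by simp_all

lemma cont_Hm:
  assumes "continuous_on A q"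
  shows "continuous_on A (\<lambda>w. Hm x (q w))"
  unfolding Hm_def by (intro continuous_intros cont_Phi1 cont_Phi2 assms)

lemma Phi0_deriv: "((\<lambda>s. Phi0 (x + s *\<^sub>R axis i 1) t) has_real_derivative Phi1 i x t) (at 0)"
proof -
  have "((\<lambda>s. Phi0 (x + s *\<^sub>R axis i 1) t) has_real_derivative Phi1 i (x + 0 *\<^sub>R axis i 1) t) (at 0)"
    unfolding Phi0_def Phi1_def
    by (rule leibniz_compact_measure[OF cm_sph])
      (auto intro!: cont_v0 cont_v1 continuous_intros DERIV_axis_shift[OF v0_deriv] simp: case_prod_unfold)
  thus ?thesis by simp
qed

lemma Phi1_deriv: "((\<lambda>s. Phi1 i (x + s *\<^sub>R axis i 1) t) has_real_derivative Phi2 i x t) (at 0)"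
proof -
  have "((\<lambda>s. Phi1 i (x + s *\<^sub>R axis i 1) t) has_real_derivative Phi2 i (x + 0 *\<^sub>R axis i 1) t) (at 0)"
    unfolding Phi1_def Phi2_def
    by (rule leibniz_compact_measure[OF cm_sph])
      (auto intro!: cont_v1 cont_v2 continuous_intros DERIV_axis_shift[OF v1_deriv] simp: case_prod_unfold)
  thus ?thesis by simp
qed

lemma Phi0_deriv_t: "((\<lambda>t. Phi0 x t) has_real_derivative PhiT x t) (at t)"
  unfolding Phi0_def PhiT_def
proof (rule leibniz_compact_measure[OF cm_sph])
  fix s z
  show "((\<lambda>s. v0 x (s *\<^sub>R z)) has_real_derivative (\<Sum>i\<in>UNIV. z $ i * v1 i (s *\<^sub>R z) x)) (at s)"
    unfolding v0_commute[of x]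
    by (rule DERIV_along_ray[where F="\<lambda>y. v0 y x" and ?F1.0="\<lambda>i y. v1 i y x"])
      (auto intro!: cont_v1 continuous_intros v0_deriv)
qed (auto intro!: cont_v0 cont_v1 continuous_intros simp: case_prod_unfold)

lemma Hm_eq: "Hm x t = (\<integral>z. lap x (t *\<^sub>R z) \<partial>sph_measure g)"
proof -
  have "integrable (sph_measure g) (\<lambda>z. v1 i x (t *\<^sub>R z))" "integrable (sph_measure g) (\<lambda>z. v2 i x (t *\<^sub>R z))" for i
    by (intro compact_measure_integrable[OF cm_sph] cont_v1 cont_v2 continuous_intros)+
  thus ?thesis unfolding Hm_def Phi1_def Phi2_def lap_def by simp
qed

text \<open>\<open>ball_divergence\<close> in polar coordinates. The extra factor \<open>r\<close>
  on the right comes from the coordinates \<open>y_i = r z_i\<close> in the radial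
  derivative.\<close>

lemma sphere_identity_weighted:
  assumes x: "x \<in> orth_open" and T: "T > 0"
  shows "integral {0..T} (\<lambda>r. r powr sph_dim g * (T\<^sup>2 - r\<^sup>2) * Hm x r) =
    2 * integral {0..T} (\<lambda>r. r powr sph_dim g * (r * PhiT x r))"
proof -
  define c1 where "c1 r = max 0 (T\<^sup>2 - r\<^sup>2)" for r :: real
  define c2 where "c2 = (indicator {..T} :: real \<Rightarrow> real)"
  have meas: "c1 \<in> borel_measurable borel" "c2 \<in> borel_measurable borel"
    unfolding c1_def c2_def by measurable
  have c1: "c1 r \<ge> 0" "0 < r \<Longrightarrow> r \<le> T \<Longrightarrow> c1 r \<le> T\<^sup>2" "r > T \<Longrightarrow> c1 r = 0" for r
  proof -
    show "c1 r = 0" if "r > T"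
      using that T by (auto simp: c1_def max_def intro!: antisym power_mono)
  qed (auto simp: c1_def)
  have c2: "c2 r \<ge> 0" "0 < r \<Longrightarrow> r \<le> T \<Longrightarrow> c2 r \<le> 1" "r > T \<Longrightarrow> c2 r = 0" for r by (auto simp: c2_def)
  have m: "sph_dim g > 0" by (rule sph_dim_pos[OF g_pos])
  have r1: "compact_measure (radial_measure (sph_dim g) c1)"
    by (rule compact_measure_radial_bounded[OF _ c1]) (use m meas in auto)
  have r2: "compact_measure (radial_measure (sph_dim g) c2)"
    by (rule compact_measure_radial_bounded[OF _ c2]) (use m meas in auto)
  have "(\<integral>y. lap x y \<partial>orth_measure g c1) = (\<integral>r. Hm x r \<partial>radial_measure (sph_dim g) c1)"
    unfolding Hm_eq by (rule integral_orth_measure_polar[OF g_pos meas(1) c1(1,3) r1 cont_lap])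
  also have "\<dots> = integral {0..T} (\<lambda>r. r powr sph_dim g * c1 r * Hm x r)"
    by (rule integral_radial_measure[OF meas(1) c1(1,3) m r1 cont_Hm[OF continuous_on_id]]) auto
  also have "\<dots> = integral {0..T} (\<lambda>r. r powr sph_dim g * (T\<^sup>2 - r\<^sup>2) * Hm x r)"
  proof (rule integral_cong)
    fix r assume "r \<in> {0..T}"
    hence "r\<^sup>2 \<le> T\<^sup>2" by (intro power_mono) auto
    thus "r powr sph_dim g * c1 r * Hm x r = r powr sph_dim g * (T\<^sup>2 - r\<^sup>2) * Hm x r" by (simp add: c1_def)
  qed
  finally have 1: "(\<integral>y. lap x y \<partial>orth_measure g c1) = integral {0..T} (\<lambda>r. r powr sph_dim g * (T\<^sup>2 - r\<^sup>2) * Hm x r)" .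
  have cs: "continuous_on UNIV (\<lambda>y. \<Sum>i\<in>UNIV. y $ i * v1 i y x)" by (intro continuous_intros cont_v1)
  have "(\<integral>y. (\<Sum>i\<in>UNIV. y $ i * v1 i y x) \<partial>orth_measure g c2) =
    (\<integral>r. (\<integral>z. (\<Sum>i\<in>UNIV. (r *\<^sub>R z) $ i * v1 i (r *\<^sub>R z) x) \<partial>sph_measure g) \<partial>radial_measure (sph_dim g) c2)"
    by (rule integral_orth_measure_polar[OF g_pos meas(2) c2(1,3) r2 cs])
  also have "\<dots> = (\<integral>r. r * PhiT x r \<partial>radial_measure (sph_dim g) c2)"
    unfolding PhiT_def integral_mult_right_zero[symmetric] by (simp add: sum_distrib_left mult.assoc)
  also have "\<dots> = integral {0..T} (\<lambda>r. r powr sph_dim g * c2 r * (r * PhiT x r))"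
    by (rule integral_radial_measure[OF meas(2) c2(1,3) m r2]) (auto intro!: cont_PhiT continuous_intros)
  also have "\<dots> = integral {0..T} (\<lambda>r. r powr sph_dim g * (r * PhiT x r))"
    by (rule integral_cong) (simp add: c2_def)
  finally show ?thesis using 1 ball_divergence[OF x T] unfolding c1_def c2_def by simp
qed

text \<open>Expanding the cutoff gives \<open>T^2 A - B = 2 C\<close>. In the derivative with
  respect to \<open>T\<close> the boundary terms of \<open>A\<close> and \<open>B\<close> cancel,
  and what remains is \<open>2 T A = 2 T powr m * (T * PhiT x T)\<close> with
  \<open>m = sph_dim g\<close>.\<close>

lemma sphere_identity:
  assumes x: "x \<in> orth_open" and T: "T > 0"
  shows "integral {0..T} (\<lambda>r. r powr sph_dim g * Hm x r) = T powr sph_dim g * PhiT x T"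
proof -
  let ?m = "sph_dim g"
  have m: "?m > 0" by (rule sph_dim_pos[OF g_pos])
  have pc: "continuous_on A (\<lambda>r::real. r powr ?m)" if "A \<subseteq> {0..}" for A
    using m that by (intro continuous_on_powr') (auto intro!: continuous_intros)
  define A where "A t = integral {0..t} (\<lambda>r. r powr ?m * Hm x r)" for t
  define B where "B t = integral {0..t} (\<lambda>r. r powr ?m * (r\<^sup>2 * Hm x r))" for t
  define C where "C t = integral {0..t} (\<lambda>r. r powr ?m * (r * PhiT x r))" for t
  have D: "((\<lambda>t. integral {0..t} (\<lambda>r. r powr ?m * F r)) has_real_derivative T powr ?m * F T) (at T)"
    if F: "continuous_on UNIV F" for F
  proof -
    have "((\<lambda>t. integral {0..t} (\<lambda>r. r powr ?m * F r)) has_real_derivative T powr ?m * F T) (at T within {0..2*T})"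
      using T by (intro integral_has_real_derivative continuous_intros pc continuous_on_subset[OF F]) auto
    thus ?thesis using at_within_interior[of T "{0..2*T}"] T by simp
  qed
  have DA: "(A has_real_derivative T powr ?m * Hm x T) (at T)" unfolding A_def
    by (intro D cont_Hm continuous_intros)
  have DB: "(B has_real_derivative T powr ?m * (T\<^sup>2 * Hm x T)) (at T)" unfolding B_def
    by (intro D cont_Hm continuous_intros)
  have DC: "(C has_real_derivative T powr ?m * (T * PhiT x T)) (at T)" unfolding C_def
    by (intro D cont_PhiT continuous_intros)
  have eq: "t\<^sup>2 * A t - B t = 2 * C t" if "t > 0" for t
  proof -
    have i: "(\<lambda>r. r powr ?m * Hm x r) integrable_on {0..t}" "(\<lambda>r. r powr ?m * (r\<^sup>2 * Hm x r)) integrable_on {0..t}"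
      by (intro integrable_continuous_real continuous_intros pc cont_Hm; force)+
    have "integral {0..t} (\<lambda>r. r powr ?m * (t\<^sup>2 - r\<^sup>2) * Hm x r) =
       integral {0..t} (\<lambda>r. t\<^sup>2 * (r powr ?m * Hm x r) - r powr ?m * (r\<^sup>2 * Hm x r))"
      by (simp add: algebra_simps)
    also have "\<dots> = t\<^sup>2 * A t - B t"
      using i by (simp add: A_def B_def Henstock_Kurzweil_Integration.integral_diff integrable_on_mult_right)
    finally show ?thesis using sphere_identity_weighted[OF x that] by (simp add: C_def)
  qed
  have "((\<lambda>t. t\<^sup>2 * A t - B t) has_real_derivative (2 * T * A T + T\<^sup>2 * (T powr ?m * Hm x T) - T powr ?m * (T\<^sup>2 * Hm x T))) (at T)"
    by (auto intro!: derivative_eq_intros DA DB)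
  hence "((\<lambda>t. 2 * C t) has_real_derivative (2 * T * A T + T\<^sup>2 * (T powr ?m * Hm x T) - T powr ?m * (T\<^sup>2 * Hm x T))) (at T)"
    by (rule has_field_derivative_transform_within_open[where S="{0<..}"]) (use T eq in auto)
  moreover have "((\<lambda>t. 2 * C t) has_real_derivative 2 * (T powr ?m * (T * PhiT x T))) (at T)"
    by (auto intro!: derivative_eq_intros DC)
  ultimately have "2 * T * A T + T\<^sup>2 * (T powr ?m * Hm x T) - T powr ?m * (T\<^sup>2 * Hm x T) = 2 * (T powr ?m * (T * PhiT x T))"
    by (rule DERIV_unique)
  hence "T * A T = T * (T powr ?m * PhiT x T)" by (simp add: algebra_simps)
  thus ?thesis using T by (simp add: A_def)
qed

text \<open>The quotient of the time derivative by \<open>t\<close>, after scaling the radius to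
  \<open>[0, 1]\<close>. In this form it is visibly continuous at \<open>t = 0\<close>, and the
  absolute value makes it even in \<open>t\<close>.\<close>

definition Pm :: "real ^ 'n \<Rightarrow> real \<Rightarrow> real" where
  "Pm x t = integral (cbox 0 1) (\<lambda>s. s powr sph_dim g * Hm x (\<bar>t\<bar> * s))"

lemma cont_Pm: "continuous_on UNIV (Pm x)"
proof -
  have m: "sph_dim g > 0" by (rule sph_dim_pos[OF g_pos])
  have "continuous_on (UNIV \<times> cbox 0 1) (\<lambda>(t, s). s powr sph_dim g * Hm x (\<bar>t\<bar> * s))"
    unfolding case_prod_unfold using m
    by (intro continuous_intros cont_Hm continuous_on_powr') auto
  thus ?thesis unfolding Pm_def by (rule integral_continuous_on_param)
qed

lemma Pm_abs: "Pm x \<bar>t\<bar> = Pm x t" and Pm_minus: "Pm x (- t) = Pm x t"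
  by (simp_all add: Pm_def)

lemma integral_eq_Pm:
  assumes T: "T > 0"
  shows "integral {0..T} (\<lambda>r. r powr sph_dim g * Hm x r) = T powr (sph_dim g + 1) * Pm x T"
proof -
  let ?m = "sph_dim g"
  have m: "?m > 0" by (rule sph_dim_pos[OF g_pos])
  have "((\<lambda>s. T *\<^sub>R ((T * s) powr ?m * Hm x (T * s))) has_integral (integral {T * 0..T * 1} (\<lambda>r. r powr ?m * Hm x r))) {0..1}"
  proof (rule has_integral_substitution)
    show "(\<lambda>s. T * s) ` {0..1} \<subseteq> {0..T}" using T by auto
    show "continuous_on {0..T} (\<lambda>r. r powr ?m * Hm x r)"
      using m by (intro continuous_intros cont_Hm continuous_on_powr') auto
    show "((\<lambda>s. T * s) has_real_derivative T) (at s within {0..1})" for s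
      by (auto intro!: derivative_eq_intros)
  qed (use T in auto)
  from integral_unique[OF this]
  have "integral {0..T} (\<lambda>r. r powr ?m * Hm x r) = integral {0..1} (\<lambda>s. T *\<^sub>R ((T * s) powr ?m * Hm x (T * s)))"
    by simp
  also have "\<dots> = integral {0..1} (\<lambda>s. T powr (?m + 1) * (s powr ?m * Hm x (\<bar>T\<bar> * s)))"
  proof (rule integral_cong)
    fix s :: real assume "s \<in> {0..1}"
    thus "T *\<^sub>R ((T * s) powr ?m * Hm x (T * s)) = T powr (?m + 1) * (s powr ?m * Hm x (\<bar>T\<bar> * s))"
      using T by (simp add: powr_mult powr_add)
  qed
  finally show ?thesis by (simp add: Pm_def)
qed

lemma PhiT_eq:
  assumes x: "x \<in> orth_open" and T: "T > 0"
  shows "PhiT x T = T * Pm x T"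
proof -
  have "T powr sph_dim g * PhiT x T = T powr sph_dim g * (T * Pm x T)"
    using sphere_identity[OF x T] integral_eq_Pm[OF T, of x] T by (simp add: powr_add)
  thus ?thesis using T by simp
qed

text \<open>The even extension in time is differentiable on the whole line, as the Leibniz rule
  demands: for \<open>t\<close> nonzero this is the chain rule, and at 0 the continuous formula
  \<open>t * Pm x t\<close> takes over.\<close>

lemma Phi0_abs_deriv:
  assumes x: "x \<in> orth_open"
  shows "((\<lambda>t. Phi0 x \<bar>t\<bar>) has_real_derivative t * Pm x t) (at t)"
proof (rule DERIV_remove_point[where b=0])
  fix s :: real assume s: "s \<noteq> 0"
  have a: "(abs has_real_derivative sgn s) (at s)"
  proof (cases "s > 0")
    case True
    show ?thesis
      by (rule has_field_derivative_transform_within_open[of "\<lambda>x. x" _ _ "{0<..}"])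
        (use True in \<open>auto intro!: derivative_eq_intros\<close>)
  next
    case False
    show ?thesis
      by (rule has_field_derivative_transform_within_open[of "\<lambda>x. - x" _ _ "{..<0}"])
        (use False s in \<open>auto intro!: derivative_eq_intros\<close>)
  qed
  have "((\<lambda>t. Phi0 x \<bar>t\<bar>) has_real_derivative PhiT x \<bar>s\<bar> * sgn s) (at s)"
    by (rule DERIV_chain2[OF Phi0_deriv_t a])
  moreover have "PhiT x \<bar>s\<bar> * sgn s = s * Pm x s"
    using s PhiT_eq[OF x, of "\<bar>s\<bar>"] by (simp add: Pm_abs mult_sgn_abs abs_mult_sgn)
  ultimately show "((\<lambda>t. Phi0 x \<bar>t\<bar>) has_real_derivative s * Pm x s) (at s)" by simp
qed (auto intro!: cont_Phi0 continuous_intros cont_Pm)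

text \<open>\<open>t * Pm x t\<close> is \<open>t powr (- m)\<close> times an integral whose
  derivative is known, so the product rule applies. On the open orthant, where this function is the
  time derivative of \<open>Phi0\<close>, the result is the equation with critical parameter
  \<open>k = m\<close>.\<close>

lemma tPm_deriv_pos:
  assumes t: "t > 0"
  shows "((\<lambda>t. t * Pm x t) has_real_derivative Hm x t - sph_dim g * Pm x t) (at t)"
proof -
  let ?m = "sph_dim g"
  have m: "?m > 0" by (rule sph_dim_pos[OF g_pos])
  let ?A = "\<lambda>t. integral {0..t} (\<lambda>r. r powr ?m * Hm x r)"
  have "(?A has_real_derivative t powr ?m * Hm x t) (at t within {0..2*t})"
    using t m by (intro integral_has_real_derivative continuous_intros cont_Hm continuous_on_powr') auto
  hence DA: "(?A has_real_derivative t powr ?m * Hm x t) (at t)"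
    using at_within_interior[of t "{0..2*t}"] t by simp
  have "((\<lambda>t. t powr (- ?m) * ?A t) has_real_derivative
     (- ?m * t powr (- ?m - 1)) * ?A t + (t powr ?m * Hm x t) * t powr (- ?m)) (at t)"
    by (rule DERIV_mult[OF has_real_derivative_powr[OF t] DA])
  moreover have "(- ?m * t powr (- ?m - 1)) * ?A t + (t powr ?m * Hm x t) * t powr (- ?m) = Hm x t - ?m * Pm x t"
  proof -
    have "t powr (- ?m - 1) * t powr (?m + 1) = 1" "t powr ?m * t powr (- ?m) = 1"
      using t by (simp_all add: powr_add[symmetric])
    moreover have "(- ?m * a) * (b * p) + (c * h) * d = h - ?m * p" if "a * b = 1" "c * d = 1" for a b c d p h
    proof -
      have "(- ?m * a) * (b * p) + (c * h) * d = - ?m * (a * b) * p + (c * d) * h" by (simp add: mult_ac)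
      thus ?thesis using that by simp
    qed
    ultimately show ?thesis unfolding integral_eq_Pm[OF t] by blast
  qed
  ultimately have "((\<lambda>t. t powr (- ?m) * ?A t) has_real_derivative Hm x t - ?m * Pm x t) (at t)" by simp
  thus ?thesis
  proof (rule has_field_derivative_transform_within_open[where S="{0<..}"])
    fix s :: real assume "s \<in> {0<..}"
    hence s: "s > 0" by simp
    hence "s powr (- ?m) * s powr (?m + 1) = s" by (simp add: powr_add[symmetric])
    thus "s powr (- ?m) * ?A s = s * Pm x s" unfolding integral_eq_Pm[OF s] by (simp add: mult.assoc[symmetric])
  qed (use t in auto)
qed

text \<open>The function is odd, which gives negative times by reflection; time 0 is filled in by
  continuity.\<close>

lemma tPm_deriv: "((\<lambda>t. t * Pm x t) has_real_derivative Hm x \<bar>t\<bar> - sph_dim g * Pm x t) (at t)"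
proof (rule DERIV_remove_point[where b=0 and D="\<lambda>t. Hm x \<bar>t\<bar> - sph_dim g * Pm x t"])
  fix s :: real assume "s \<noteq> 0"
  then consider "s > 0" | "s < 0" by linarith
  thus "((\<lambda>t. t * Pm x t) has_real_derivative Hm x \<bar>s\<bar> - sph_dim g * Pm x s) (at s)"
  proof cases
    case 1
    thus ?thesis using tPm_deriv_pos[OF 1, of x] by simp
  next
    case 2
    have D: "((\<lambda>t. t * Pm x t) has_real_derivative Hm x (- s) - sph_dim g * Pm x (- s)) (at (- s))"
      using 2 by (intro tPm_deriv_pos) simp
    have "((\<lambda>t. - (- t * Pm x (- t))) has_real_derivative - ((Hm x (- s) - sph_dim g * Pm x (- s)) * (- 1))) (at s)"
      by (intro DERIV_minus DERIV_chain2[where g=uminus, OF D]) (auto intro!: derivative_eq_intros)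
    thus ?thesis using 2 by (simp add: Pm_minus)
  qed
qed (auto intro!: cont_Hm continuous_intros cont_Pm)

end

section \<open>Radial averages of spherical means\<close>

definition ball_profile :: "real \<Rightarrow> real \<Rightarrow> real" where
  "ball_profile p r = indicator {0..1} r * (1 - r\<^sup>2) powr p"

lemma ball_profile_facts:
  shows "ball_profile p \<in> borel_measurable borel" "0 \<le> ball_profile p r" "r > 1 \<Longrightarrow> ball_profile p r = 0"
proof -
  show "ball_profile p \<in> borel_measurable borel" unfolding ball_profile_def by measurable
qed (auto simp: ball_profile_def)

context even_C2_weight
begin

text \<open>The measure \<open>K\<close> on the radii is a point mass at 1 for the spherical mean and
  \<open>r\<^sup>m (1 - r\<^sup>2)\<^sup>p dr\<close> for the ball formula; all that matters is the identity \<open>ident\<close>.\<close>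

lemma EPD_solves_radial_average:
  assumes K: "compact_measure K"
    and ident: "\<And>x t. x \<in> orth_open \<Longrightarrow> t > 0 \<Longrightarrow>
      (\<integral>r. (k - sph_dim g) * (r\<^sup>2 * Pm x (t * r)) - (1 - r\<^sup>2) * Hm x \<bar>t * r\<bar> \<partial>K) = 0"
    and u: "\<And>x t. t > 0 \<Longrightarrow> u x t = C * (\<integral>r. Phi0 x \<bar>t * r\<bar> \<partial>K)"
    and C: "C * (measure K UNIV * (measure (sph_measure g) UNIV * measure (trans_measure g) UNIV)) = 1"
    and ff: "\<And>x. x \<in> orth_open \<Longrightarrow> f0 x = f x"
  shows "EPD_solves g k f0 u"
proof -
  let ?m = "sph_dim g"
  define ut where "ut x t = C * (\<integral>r. r * (t * r * Pm x (t * r)) \<partial>K)" for x t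
  define utt where "utt x t = C * (\<integral>r. r * (r * (Hm x \<bar>t * r\<bar> - ?m * Pm x (t * r))) \<partial>K)" for x t
  define ux where "ux i x t = C * (\<integral>r. Phi1 i x \<bar>t * r\<bar> \<partial>K)" for i x t
  define uxx where "uxx i x t = C * (\<integral>r. Phi2 i x \<bar>t * r\<bar> \<partial>K)" for i x t
  have Pc: "continuous_on A (\<lambda>w. Pm x (q w))" if "continuous_on A q" for A :: "'z::topological_space set" and q x
    by (rule continuous_on_compose2[OF cont_Pm that]) auto
  have space: "space K = UNIV" using K sets_eq_imp_space_eq[of K borel] by (simp add: compact_measure_def)
  have t_part: "(u x has_real_derivative ut x t) (at t)" "(ut x has_real_derivative utt x t) (at t)"
    if x: "x \<in> orth_open" and t: "t > 0" for x t
  proof -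
    have chain: "((\<lambda>s. q (s * r)) has_real_derivative r * q' (s * r)) (at s)"
      if "\<And>t. (q has_real_derivative q' t) (at t)" for q q' :: "real \<Rightarrow> real" and r s
      by (rule DERIV_cong[OF DERIV_chain2[where g="\<lambda>s. s * r", OF that]]) (auto intro!: derivative_eq_intros)
    have "((\<lambda>t. \<integral>r. Phi0 x \<bar>t * r\<bar> \<partial>K) has_real_derivative (\<integral>r. r * (t * r * Pm x (t * r)) \<partial>K)) (at t)"
      by (rule leibniz_compact_measure[OF K])
        (auto intro!: cont_Phi0 Pc continuous_intros chain[OF Phi0_abs_deriv[OF x]] simp: case_prod_unfold)
    hence "((\<lambda>t. C * (\<integral>r. Phi0 x \<bar>t * r\<bar> \<partial>K)) has_real_derivative ut x t) (at t)"
      unfolding ut_def by (rule DERIV_cmult)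
    thus "(u x has_real_derivative ut x t) (at t)"
      by (rule has_field_derivative_transform_within_open[where S="{0<..}"]) (use t u in auto)
    have "((\<lambda>t. \<integral>r. r * (t * r * Pm x (t * r)) \<partial>K) has_real_derivative (\<integral>r. r * (r * (Hm x \<bar>t * r\<bar> - ?m * Pm x (t * r))) \<partial>K)) (at t)"
      by (rule leibniz_compact_measure[OF K])
        (auto intro!: cont_Hm Pc continuous_intros DERIV_cmult chain[OF tPm_deriv] simp: case_prod_unfold)
    thus "(ut x has_real_derivative utt x t) (at t)"
      unfolding ut_def utt_def by (rule DERIV_cmult)
  qed
  have x_part: "((\<lambda>s. u (x + s *\<^sub>R axis i 1) t) has_real_derivative ux i x t) (at 0)"
    "((\<lambda>s. ux i (x + s *\<^sub>R axis i 1) t) has_real_derivative uxx i x t) (at 0)" if t: "t > 0" for x i t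
  proof -
    have "((\<lambda>s. \<integral>r. Phi0 (x + s *\<^sub>R axis i 1) \<bar>t * r\<bar> \<partial>K) has_real_derivative (\<integral>r. Phi1 i (x + 0 *\<^sub>R axis i 1) \<bar>t * r\<bar> \<partial>K)) (at 0)"
      by (rule leibniz_compact_measure[OF K])
        (auto intro!: cont_Phi0 cont_Phi1 continuous_intros DERIV_axis_shift[OF Phi0_deriv] simp: case_prod_unfold)
    thus "((\<lambda>s. u (x + s *\<^sub>R axis i 1) t) has_real_derivative ux i x t) (at 0)"
      unfolding u[OF t] ux_def by (intro DERIV_cmult) simp
    have "((\<lambda>s. \<integral>r. Phi1 i (x + s *\<^sub>R axis i 1) \<bar>t * r\<bar> \<partial>K) has_real_derivative (\<integral>r. Phi2 i (x + 0 *\<^sub>R axis i 1) \<bar>t * r\<bar> \<partial>K)) (at 0)"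
      by (rule leibniz_compact_measure[OF K])
        (auto intro!: cont_Phi1 cont_Phi2 continuous_intros DERIV_axis_shift[OF Phi1_deriv] simp: case_prod_unfold)
    thus "((\<lambda>s. ux i (x + s *\<^sub>R axis i 1) t) has_real_derivative uxx i x t) (at 0)"
      unfolding ux_def uxx_def by (intro DERIV_cmult) simp
  qed
  have pde: "utt x t + k / t * ut x t = (\<Sum>i\<in>UNIV. uxx i x t + g $ i / x $ i * ux i x t)"
    if x: "x \<in> orth_open" and t: "t > 0" for x t
  proof -
    have int: "integrable K (\<lambda>r. Phi1 i x \<bar>t * r\<bar>)" "integrable K (\<lambda>r. Phi2 i x \<bar>t * r\<bar>)" for i
      by (intro compact_measure_integrable[OF K] cont_Phi1 cont_Phi2 continuous_intros)+
    have intH: "integrable K (\<lambda>r. Hm x \<bar>t * r\<bar>)"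
      by (intro compact_measure_integrable[OF K] cont_Hm continuous_intros)
    have int2: "integrable K (\<lambda>r. r * (r * (Hm x \<bar>t * r\<bar> - ?m * Pm x (t * r))))" "integrable K (\<lambda>r. k * (r\<^sup>2 * Pm x (t * r)))"
      by (intro compact_measure_integrable[OF K] cont_Hm Pc continuous_intros)+
    have rhs: "(\<Sum>i\<in>UNIV. uxx i x t + g $ i / x $ i * ux i x t) = C * (\<integral>r. Hm x \<bar>t * r\<bar> \<partial>K)"
      unfolding Hm_def ux_def uxx_def using int by (simp add: sum_distrib_left algebra_simps)
    have "k / t * ut x t = C * (\<integral>r. k / t * (r * (t * r * Pm x (t * r))) \<partial>K)"
      unfolding ut_def integral_mult_right_zero by (rule mult.left_commute)
    also have "(\<lambda>r. k / t * (r * (t * r * Pm x (t * r)))) = (\<lambda>r. k * (r\<^sup>2 * Pm x (t * r)))"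
      using t by (auto simp: fun_eq_iff power2_eq_square)
    finally have "utt x t + k / t * ut x t - C * (\<integral>r. Hm x \<bar>t * r\<bar> \<partial>K) =
       C * ((\<integral>r. r * (r * (Hm x \<bar>t * r\<bar> - ?m * Pm x (t * r))) \<partial>K) + (\<integral>r. k * (r\<^sup>2 * Pm x (t * r)) \<partial>K) - (\<integral>r. Hm x \<bar>t * r\<bar> \<partial>K))"
      unfolding utt_def by (simp only: distrib_left right_diff_distrib)
    also have "(\<integral>r. r * (r * (Hm x \<bar>t * r\<bar> - ?m * Pm x (t * r))) \<partial>K) + (\<integral>r. k * (r\<^sup>2 * Pm x (t * r)) \<partial>K) - (\<integral>r. Hm x \<bar>t * r\<bar> \<partial>K) =
      (\<integral>r. r * (r * (Hm x \<bar>t * r\<bar> - ?m * Pm x (t * r))) + k * (r\<^sup>2 * Pm x (t * r)) - Hm x \<bar>t * r\<bar> \<partial>K)"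
      using int2 intH by (simp del: integral_mult_right_zero)
    \<comment> \<open>The two time derivatives of a function of \<open>t r\<close> contribute
      \<open>r^2 (H - m P)\<close> and \<open>k r^2 P\<close>. Subtracting \<open>H\<close> groups
      everything into the integrand of \<open>ident\<close>, where
      \<open>m = sph_dim g\<close>.\<close>
    also have "(\<lambda>r. r * (r * (Hm x \<bar>t * r\<bar> - ?m * Pm x (t * r))) + k * (r\<^sup>2 * Pm x (t * r)) - Hm x \<bar>t * r\<bar>) =
      (\<lambda>r. (k - ?m) * (r\<^sup>2 * Pm x (t * r)) - (1 - r\<^sup>2) * Hm x \<bar>t * r\<bar>)"
      by (auto simp: fun_eq_iff power2_eq_square algebra_simps)
    finally show ?thesis using rhs ident[OF x t] by simp
  qed
  have lim: "((\<lambda>t. u x t) \<longlongrightarrow> f0 x) (at_right 0)" "((\<lambda>t. ut x t) \<longlongrightarrow> 0) (at_right 0)" if x: "x \<in> orth_open" for x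
  proof -
    have "continuous_on UNIV (\<lambda>t. C * (\<integral>r. Phi0 x \<bar>t * r\<bar> \<partial>K))"
      by (intro continuous_intros continuous_compact_measure_integral[OF K])
        (auto intro!: cont_Phi0 continuous_intros simp: case_prod_unfold)
    hence "isCont (\<lambda>t. C * (\<integral>r. Phi0 x \<bar>t * r\<bar> \<partial>K)) 0" by (simp add: continuous_on_eq_continuous_at)
    hence "((\<lambda>t. C * (\<integral>r. Phi0 x \<bar>t * r\<bar> \<partial>K)) \<longlongrightarrow> C * (\<integral>r. Phi0 x \<bar>0 * r\<bar> \<partial>K)) (at_right 0)"
      unfolding isCont_def by (rule filterlim_mono) (auto simp: at_le)
    \<comment> \<open>At time 0 the translation argument is \<open>x\<close> itself, so all three
      integrals only contribute total masses, and \<open>C\<close> is normalized to cancel their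
      product.\<close>
    moreover have "C * (\<integral>r. Phi0 x \<bar>0 * r\<bar> \<partial>K) = f0 x"
    proof -
      have xc: "x \<in> orth_closed" using x by (auto simp: orth_open_def orth_closed_def less_imp_le)
      have "Phi0 x 0 = measure (sph_measure g) UNIV * (measure (trans_measure g) UNIV * f x)"
        unfolding Phi0_def v0_def by (simp add: tr_arg_0[OF xc])
      hence "C * (\<integral>r. Phi0 x \<bar>0 * r\<bar> \<partial>K) =
        (C * (measure K UNIV * (measure (sph_measure g) UNIV * measure (trans_measure g) UNIV))) * f x"
        by (simp add: space mult.assoc)
      thus ?thesis using C ff[OF x] by simp
    qed
    ultimately have "((\<lambda>t. C * (\<integral>r. Phi0 x \<bar>t * r\<bar> \<partial>K)) \<longlongrightarrow> f0 x) (at_right 0)" by simp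
    thus "((\<lambda>t. u x t) \<longlongrightarrow> f0 x) (at_right 0)"
    proof (rule Lim_transform_eventually)
      have "eventually (\<lambda>t::real. t > 0) (at_right 0)" by (rule eventually_at_right_less)
      thus "\<forall>\<^sub>F t in at_right 0. C * (\<integral>r. Phi0 x \<bar>t * r\<bar> \<partial>K) = u x t"
        by eventually_elim (simp add: u)
    qed
    have "continuous_on UNIV (ut x)" unfolding ut_def
      by (intro continuous_intros continuous_compact_measure_integral[OF K])
        (auto intro!: Pc continuous_intros simp: case_prod_unfold)
    hence "isCont (ut x) 0" by (simp add: continuous_on_eq_continuous_at)
    hence "(ut x \<longlongrightarrow> ut x 0) (at_right 0)"
      unfolding isCont_def by (rule filterlim_mono) (auto simp: at_le)
    moreover have "ut x 0 = 0" by (simp add: ut_def)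
    ultimately show "((\<lambda>t. ut x t) \<longlongrightarrow> 0) (at_right 0)" by simp
  qed
  show ?thesis unfolding EPD_solves_def
    by (intro exI[of _ ut] exI[of _ utt] exI[of _ ux] exI[of _ uxx] conjI ballI allI impI t_part x_part pde lim)
qed

section \<open>Mass and integral identity of the radial profile of the ball formula\<close>

lemma emeasure_ball_profile:
  assumes "p > -1"
  shows "emeasure (radial_measure (sph_dim g) (ball_profile p)) UNIV = ennreal (Beta ((sph_dim g + 1) / 2) (p + 1) / 2)"
proof -
  note [measurable] = ball_profile_facts(1)
  have "emeasure (radial_measure (sph_dim g) (ball_profile p)) UNIV =
    (\<integral>\<^sup>+r. ennreal (indicator {0<..} r * r powr sph_dim g * ball_profile p r) \<partial>lborel)"
    by (simp add: radial_measure_def emeasure_density)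
  also have "\<dots> = (\<integral>\<^sup>+r. ennreal (r powr sph_dim g * (1 - r\<^sup>2) powr p) * indicator {0<..<1} r \<partial>lborel)"
    by (intro nn_integral_cong) (auto simp: ball_profile_def indicator_def)
  also have "\<dots> = ennreal (Beta ((sph_dim g + 1) / 2) (p + 1) / 2)"
    using assms sph_dim_pos[OF g_pos] by (intro nn_integral_powr_ball) auto
  finally show ?thesis .
qed

lemma compact_measure_ball_profile:
  assumes "p > -1"
  shows "compact_measure (radial_measure (sph_dim g) (ball_profile p))"
proof (rule compact_measure_radial_measure[where R=1])
  note [measurable] = ball_profile_facts(1)
  show "(\<integral>\<^sup>+r. ennreal (indicator {0<..} r * r powr sph_dim g * ball_profile p r) \<partial>lborel) < \<infinity>"
    using emeasure_ball_profile[OF assms] by (simp add: radial_measure_def emeasure_density)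
qed (auto simp: ball_profile_facts)

text \<open>Against the profile the integrand is the derivative of \<open>J\<close>; differentiating
  \<open>(1 - r^2) powr (p + 1)\<close> produces the coefficient \<open>2 (p + 1) = k - m\<close>,
  where \<open>m = sph_dim g\<close>. \<open>J\<close> vanishes at 1 since \<open>p + 1 > 0\<close>
  and at 0 through its factor \<open>r powr m\<close>.\<close>

lemma ball_identity:
  assumes p: "p > -1" and k: "k - sph_dim g = 2 * (p + 1)" and t: "t > 0"
  shows "(\<integral>r. (k - sph_dim g) * (r\<^sup>2 * Pm x (t * r)) - (1 - r\<^sup>2) * Hm x \<bar>t * r\<bar>
    \<partial>radial_measure (sph_dim g) (ball_profile p)) = 0"
proof -
  let ?m = "sph_dim g"
  have m: "?m > 0" by (rule sph_dim_pos[OF g_pos])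
  have Pc: "continuous_on A (\<lambda>r. Pm x (t * r))" for A
    by (rule continuous_on_compose2[OF cont_Pm]) (auto intro!: continuous_intros)
  define F where "F r = (k - ?m) * (r\<^sup>2 * Pm x (t * r)) - (1 - r\<^sup>2) * Hm x \<bar>t * r\<bar>" for r
  define J where "J r = - ((1 - r\<^sup>2) powr (p + 1) * (r powr ?m * (t * r * Pm x (t * r)))) / t" for r
  have Fc: "continuous_on UNIV F" unfolding F_def by (intro continuous_intros Pc cont_Hm)
  have "(\<integral>r. F r \<partial>radial_measure ?m (ball_profile p)) = integral {0..1} (\<lambda>r. r powr ?m * ball_profile p r * F r)"
    by (rule integral_radial_measure[OF ball_profile_facts(1,2,3) m compact_measure_ball_profile[OF p] Fc])
  also have "((\<lambda>r. r powr ?m * ball_profile p r * F r) has_integral (J 1 - J 0)) {0..1}"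
  proof (rule fundamental_theorem_of_calculus_interior)
    show "continuous_on {0..1} J" unfolding J_def using m p t
      by (intro continuous_intros Pc continuous_on_powr') (auto simp: power_le_one)
    fix r :: real assume r: "r \<in> {0<..<1}"
    have r2: "0 < 1 - r\<^sup>2" using r by (simp add: power_less_one_iff)
    have D1: "((\<lambda>r. (1 - r\<^sup>2) powr (p + 1)) has_real_derivative (p + 1) * (1 - r\<^sup>2) powr p * (- 2 * r)) (at r)"
      by (rule DERIV_cong[OF DERIV_chain2[where g="\<lambda>r. 1 - r\<^sup>2", OF has_real_derivative_powr[OF r2]]])
        (auto intro!: derivative_eq_intros)
    have D2: "((\<lambda>r. r powr ?m) has_real_derivative ?m * r powr (?m - 1)) (at r)"
      using r by (intro has_real_derivative_powr) auto
    have D3: "((\<lambda>r. t * r * Pm x (t * r)) has_real_derivative (Hm x \<bar>t * r\<bar> - ?m * Pm x (t * r)) * t) (at r)"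
      by (rule DERIV_chain2[where g="\<lambda>r. t * r", OF tPm_deriv]) (auto intro!: derivative_eq_intros)
    have D: "(J has_real_derivative
      - ((p + 1) * (1 - r\<^sup>2) powr p * (- 2 * r) * (r powr ?m * (t * r * Pm x (t * r))) +
       ((?m * r powr (?m - 1)) * (t * r * Pm x (t * r)) + ((Hm x \<bar>t * r\<bar> - ?m * Pm x (t * r)) * t) * r powr ?m) * (1 - r\<^sup>2) powr (p + 1)) / t) (at r)"
      unfolding J_def by (intro DERIV_cdivide DERIV_minus DERIV_mult D1 D2 D3)
    have "r powr (?m - 1) * r = r powr ?m" "(1 - r\<^sup>2) powr (p + 1) = (1 - r\<^sup>2) powr p * (1 - r\<^sup>2)"
      using r r2 by (simp_all add: powr_add powr_diff)
    moreover have "- ((p + 1) * w * (- 2 * r) * (q * (t * r * P)) + ((M * q') * (t * r * P) + ((h - M * P) * t) * q) * (w * z)) / t =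
       q * w * (2 * (p + 1) * (r\<^sup>2 * P) - z * h)" if "q' * r = q" for w q q' P M h z
    proof -
      have "(M * q') * (t * r * P) = M * (q' * r) * t * P" by simp
      thus ?thesis using t that by (simp add: field_simps power2_eq_square)
    qed
    ultimately have "(J has_real_derivative r powr ?m * (1 - r\<^sup>2) powr p * (2 * (p + 1) * (r\<^sup>2 * Pm x (t * r)) - (1 - r\<^sup>2) * Hm x \<bar>t * r\<bar>)) (at r)"
      using D by simp
    thus "(J has_vector_derivative r powr ?m * ball_profile p r * F r) (at r)"
      using r by (simp add: has_real_derivative_iff_has_vector_derivative[symmetric] F_def k ball_profile_def)
  qed simp
  hence "integral {0..1} (\<lambda>r. r powr ?m * ball_profile p r * F r) = J 1 - J 0" by (rule integral_unique)
  also have "J 1 - J 0 = 0" using p m by (simp add: J_def)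
  finally show ?thesis unfolding F_def .
qed

end

section \<open>The Cauchy problem\<close>

definition gtrans_const :: "real ^ 'n \<Rightarrow> real" where
  "gtrans_const g = (\<Prod>i\<in>UNIV. Gamma ((g $ i + 1) / 2) / (Gamma (g $ i / 2) * Gamma (1 / 2)))"

text \<open>Each factor of the constant is the reciprocal of the Beta value of one angle integral;
  equivalently, the translation fixes constants.\<close>

lemma gtrans_const_mult:
  fixes g :: "real ^ 'n"
  assumes g: "\<forall>i. g $ i > 0"
  shows "gtrans_const g * measure (trans_measure g) UNIV = 1"
proof -
  have "measure (trans_measure g) UNIV = (\<Prod>i\<in>UNIV. Beta (g $ i / 2) (1 / 2))"
    using emeasure_trans_measure[OF g] g
    by (simp add: measure_def prod_nonneg less_imp_le Beta_real_pos)
  hence "gtrans_const g * measure (trans_measure g) UNIV =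
    (\<Prod>i\<in>UNIV. Gamma ((g $ i + 1) / 2) / (Gamma (g $ i / 2) * Gamma (1 / 2)) * Beta (g $ i / 2) (1 / 2))"
    by (simp only: gtrans_const_def prod.distrib)
  also have "\<dots> = (\<Prod>i\<in>(UNIV :: 'n set). 1)"
  proof (rule prod.cong)
    fix i
    have gi: "g $ i > 0" using g by blast
    have pos: "Gamma ((g $ i + 1) / 2) > 0" "Gamma (g $ i / 2) > 0" "Gamma (1 / 2 :: real) > 0"
      using gi by (auto intro!: Gamma_real_pos add_pos_pos)
    have e: "g $ i / 2 + 1 / 2 = (g $ i + 1) / 2" by (simp add: add_divide_distrib)
    have "a / (b * c) * (b * c / a) = 1" if "a > 0" "b > 0" "c > 0" for a b c :: real using that by simp
    from this[OF pos] show "Gamma ((g $ i + 1) / 2) / (Gamma (g $ i / 2) * Gamma (1 / 2)) * Beta (g $ i / 2) (1 / 2) = 1"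
      unfolding Beta_def e .
  qed simp
  finally show ?thesis by simp
qed

lemma sph_pos_weight_pos:
  fixes g :: "real ^ 'n"
  assumes "\<forall>i. g $ i > 0"
  shows "0 < sph_pos_weight g"
proof -
  have "0 < Gamma ((real CARD('n) + abs_multi g) / 2)"
    using sph_dim_pos[OF assms] by (intro Gamma_real_pos) (auto simp: sph_dim_def)
  moreover have "0 < (\<Prod>i\<in>UNIV. Gamma ((g $ i + 1) / 2))"
    using assms by (intro prod_pos ballI Gamma_real_pos) (auto intro!: add_pos_pos)
  ultimately show ?thesis by (simp add: sph_pos_weight_def)
qed

lemma measure_sph_measure:
  assumes "\<forall>i. g $ i > 0"
  shows "measure (sph_measure g) UNIV = sph_pos_weight g"
  using emeasure_sph_measure[OF assms] sph_pos_weight_pos[OF assms] by (simp add: measure_def)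

lemma normalize_orth_open_iff: "y /\<^sub>R norm y \<in> orth_open \<longleftrightarrow> y \<in> orth_open" for y :: "real ^ 'n"
proof (cases "y = 0")
  case False
  thus ?thesis by (auto simp: orth_open_def zero_less_mult_iff)
qed simp

section \<open>Rewriting the integrals of the statement as integrals against the measures\<close>

lemma sph_pos_integral_eq:
  fixes g :: "real ^ 'n" and q :: "real ^ 'n \<Rightarrow> real"
  assumes g: "\<forall>i. g $ i > 0" and q: "continuous_on UNIV q"
  shows "sph_pos_integral (\<lambda>z. q z * mpow z g) = (\<integral>z. q z \<partial>sph_measure g)"
proof -
  have [measurable]: "q \<in> borel_measurable borel" by (rule borel_measurable_continuous_onI[OF q])
  let ?S = "{y \<in> orth_open. norm y < 1} :: (real ^ 'n) set"
  let ?w = "\<lambda>y :: real ^ 'n. real CARD('n) * indicator {y. norm y < 1} y * orth_weight g (y /\<^sub>R norm y)"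
  have eq: "?w y * q (y /\<^sub>R norm y) = indicator ?S y *\<^sub>R (real CARD('n) * (q (y /\<^sub>R norm y) * mpow (y /\<^sub>R norm y) g))" for y
    by (auto simp: orth_weight_eq indicator_def normalize_orth_open_iff)
  have "integrable (sph_measure g) q"
    by (rule compact_measure_integrable[OF compact_measure_sph_measure[OF g] q])
  hence "integrable lborel (\<lambda>y. ?w y * q (y /\<^sub>R norm y))"
    unfolding sph_measure_def by (subst (asm) integrable_distr_eq; simp add: integrable_density)
  hence "set_integrable lborel ?S (\<lambda>y. real CARD('n) * (q (y /\<^sub>R norm y) * mpow (y /\<^sub>R norm y) g))"
    unfolding eq set_integrable_def .
  from set_borel_integral_eq_integral(2)[OF this]
  have "sph_pos_integral (\<lambda>z. q z * mpow z g) = (\<integral>y. ?w y * q (y /\<^sub>R norm y) \<partial>lborel)"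
    unfolding sph_pos_integral_def eq set_lebesgue_integral_def by simp
  also have "\<dots> = (\<integral>z. q z \<partial>sph_measure g)"
    unfolding sph_measure_def by (subst integral_distr; simp add: integral_density)
  finally show ?thesis .
qed

lemma orth_ball_integral_eq:
  fixes g :: "real ^ 'n" and q :: "real ^ 'n \<Rightarrow> real"
  assumes g: "\<forall>i. g $ i > 0" and meas: "c \<in> borel_measurable borel" and c: "\<And>r. 0 \<le> c r" "\<And>r. r > 1 \<Longrightarrow> c r = 0"
    and cm: "compact_measure (radial_measure (sph_dim g) c)" and q: "continuous_on UNIV q"
  shows "integral {y \<in> orth_open. norm y \<le> 1} (\<lambda>y. q y * c (norm y) * mpow y g) = (\<integral>y. q y \<partial>orth_measure g c)"
proof -
  have om: "compact_measure (orth_measure g c)"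
    by (rule compact_measure_orth_measure[OF g meas c cm])
  let ?S = "{y \<in> orth_open. norm y \<le> 1} :: (real ^ 'n) set"
  have eq: "q y * (orth_weight g y * c (norm y)) = indicator ?S y *\<^sub>R (q y * c (norm y) * mpow y g)" for y
    using c(2)[of "norm y"] by (auto simp: orth_weight_eq indicator_def not_le)
  have "set_integrable lborel ?S (\<lambda>y. q y * c (norm y) * mpow y g)"
    using integrable_orth_measure_lborel[OF g meas c(1) om q] unfolding eq set_integrable_def .
  from set_borel_integral_eq_integral(2)[OF this] show ?thesis
    unfolding integral_orth_measure_lborel[OF g meas c(1) om q] eq set_lebesgue_integral_def by simp
qed

theorem theorem3p1:
  fixes g :: "real ^ 'n" and k :: real and f :: "real ^ 'n \<Rightarrow> real"
  assumes "\<forall>i. g $ i > 0"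
    and "C2_ev f"
  shows "(k > real CARD('n) + abs_multi g - 1 \<longrightarrow> EPD_solves g k f (epd_ball g k f)) \<and>
         (k = real CARD('n) + abs_multi g - 1 \<longrightarrow> EPD_solves g k f (wmean g f))"
proof -
  obtain G E where "even_C2 (f \<circ> vabs) G E" using C2_ev_imp_even_C2[OF assms(2)] by blast
  then interpret even_C2_weight "f \<circ> vabs" G E g
    using assms(1) by (simp add: even_C2_weight_def even_C2_weight_axioms_def)
  let ?m = "sph_dim g"
  have m: "?m > 0" by (rule sph_dim_pos[OF g_pos])
  \<comment> \<open>Every \<open>tr_arg\<close> lies in the closed orthant, where
    \<open>vabs\<close> is the identity, so the even extension has the same translation as
    \<open>f\<close>.\<close>
  have gt: "gtrans g y f x = gtrans_const g * v0 x y" for x y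
  proof -
    have "continuous_on UNIV (\<lambda>a. (f \<circ> vabs) (tr_arg x y a))" by (intro cont_f_tr continuous_intros)
    hence "continuous_on UNIV (\<lambda>a. f (tr_arg x y a))" by simp
    thus ?thesis unfolding gtrans_const_def v0_def by (simp add: gtrans_eq_integral[OF g_pos])
  qed
  have ff: "f x = (f \<circ> vabs) x" if "x \<in> orth_open" for x
  proof -
    have "x \<in> orth_closed" using that by (auto simp: orth_open_def orth_closed_def less_imp_le)
    thus ?thesis by simp
  qed
  have v0c: "continuous_on UNIV (\<lambda>y. v0 x (t *\<^sub>R y))" for x and t :: real by (intro cont_v0 continuous_intros)
  have W: "sph_pos_weight g > 0" by (rule sph_pos_weight_pos[OF g_pos])
  have "EPD_solves g k f (epd_ball g k f)" if k: "k > real CARD('n) + abs_multi g - 1"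
  proof -
    \<comment> \<open>The exponent of the ball formula; the hypothesis on \<open>k\<close> is
      exactly \<open>p > -1\<close>, the condition for the profile to have finite mass.\<close>
    define p where "p = (k - real CARD('n) - abs_multi g - 1) / 2"
    have p: "p > -1" using k by (simp add: p_def field_simps)
    have kp: "k - ?m = 2 * (p + 1)" by (simp add: p_def sph_dim_def field_simps)
    let ?K = "radial_measure ?m (ball_profile p)"
    define D where "D = 2 ^ CARD('n) * Gamma ((k + 1) / 2) /
      (Gamma ((k - real CARD('n) - abs_multi g + 1) / 2) * (\<Prod>i\<in>UNIV. Gamma ((g $ i + 1) / 2)))"
    note cm = compact_measure_ball_profile[OF p]
    show ?thesis
    proof (rule EPD_solves_radial_average[where K="?K" and C="D * gtrans_const g"])
      show "compact_measure ?K" by (rule cm)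
      show "(\<integral>r. (k - ?m) * (r\<^sup>2 * Pm x (t * r)) - (1 - r\<^sup>2) * Hm x \<bar>t * r\<bar> \<partial>?K) = 0" if "t > 0" for x t
        by (rule ball_identity[OF p kp that])
      show "f x = (f \<circ> vabs) x" if "x \<in> orth_open" for x by (rule ff[OF that])
      show "epd_ball g k f x t = D * gtrans_const g * (\<integral>r. Phi0 x \<bar>t * r\<bar> \<partial>?K)" if t: "t > 0" for x t
      proof -
        let ?S = "{y \<in> orth_open. norm y \<le> 1} :: (real ^ 'n) set"
        have "epd_ball g k f x t = D * integral ?S (\<lambda>y. gtrans_const g * v0 x (t *\<^sub>R y) * (1 - (norm y)\<^sup>2) powr p * mpow y g)"
          unfolding epd_ball_def D_def gt p_def by simp
        also have "integral ?S (\<lambda>y. gtrans_const g * v0 x (t *\<^sub>R y) * (1 - (norm y)\<^sup>2) powr p * mpow y g) =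
           integral ?S (\<lambda>y. gtrans_const g * (v0 x (t *\<^sub>R y) * ball_profile p (norm y) * mpow y g))"
          by (rule integral_cong) (auto simp: ball_profile_def)
        also have "\<dots> = gtrans_const g * (\<integral>y. v0 x (t *\<^sub>R y) \<partial>orth_measure g (ball_profile p))"
          using orth_ball_integral_eq[OF g_pos ball_profile_facts(1,2,3) cm v0c] by simp
        also have "(\<integral>y. v0 x (t *\<^sub>R y) \<partial>orth_measure g (ball_profile p)) = (\<integral>r. Phi0 x (t * r) \<partial>?K)"
          unfolding Phi0_def using integral_orth_measure_polar[OF g_pos ball_profile_facts(1,2,3) cm v0c] by simp
        \<comment> \<open>Radii are positive almost everywhere, so the absolute value required by
          the averaging lemma changes nothing.\<close>
        also have "\<dots> = (\<integral>r. Phi0 x \<bar>t * r\<bar> \<partial>?K)"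
        proof (rule integral_cong_AE)
          have "AE r in ?K. r > 0"
            unfolding radial_measure_def using ball_profile_facts(1)
            by (subst AE_density) (auto simp: indicator_def intro!: AE_I2)
          thus "AE r in ?K. Phi0 x (t * r) = Phi0 x \<bar>t * r\<bar>" by eventually_elim (use t in simp)
        qed (auto intro!: compact_measure_measurable[OF cm] cont_Phi0 continuous_intros)
        finally show ?thesis by simp
      qed
      have Kmeas: "measure ?K UNIV = Beta ((?m + 1) / 2) (p + 1) / 2"
        using emeasure_ball_profile[OF p] p m by (simp add: measure_def Beta_real_pos less_imp_le)
      \<comment> \<open>The radial mass is half a Beta value whose factor
        \<open>Gamma ((m + 1) / 2)\<close>, with \<open>m = sph_dim g\<close>, cancels against the
        mass of the sphere, and its 1/2 raises the power \<open>2^(n-1)\<close> to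
        \<open>2^n\<close>. This explains the constant of the ball formula.\<close>
      have "D * (measure ?K UNIV * sph_pos_weight g) = 1"
      proof -
        define P where "P = (\<Prod>i\<in>UNIV. Gamma ((g $ i + 1) / 2))"
        have e1: "(k - real CARD('n) - abs_multi g + 1) / 2 = p + 1" by (simp add: p_def field_simps)
        have e2: "(real CARD('n) + abs_multi g) / 2 = (?m + 1) / 2" by (simp add: sph_dim_def)
        have e3: "(?m + 1) / 2 + (p + 1) = (k + 1) / 2" using kp by (simp add: field_simps)
        have "P > 0" unfolding P_def using g_pos by (intro prod_pos ballI Gamma_real_pos) (auto intro!: add_pos_pos)
        moreover have "k + 1 > 0" using kp p m unfolding distrib_left by linarith
        hence "Gamma (p + 1) > 0" "Gamma ((?m + 1) / 2) > 0" "Gamma ((k + 1) / 2) > 0"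
          using p m by (auto intro!: Gamma_real_pos)
        moreover have "(2::real) ^ CARD('n) = 2 ^ (CARD('n) - 1) * 2"
          using power_minus_mult[of "CARD('n)" "2::real"] by simp
        ultimately show ?thesis
          unfolding D_def Kmeas sph_pos_weight_def e1 e2 Beta_def e3 P_def[symmetric] by (simp add: field_simps)
      qed
      thus "D * gtrans_const g * (measure ?K UNIV * (measure (sph_measure g) UNIV * measure (trans_measure g) UNIV)) = 1"
        using gtrans_const_mult[OF g_pos] measure_sph_measure[OF g_pos]
        by (metis (no_types, lifting) mult.assoc mult.commute mult.right_neutral)
    qed
  qed
  moreover have "EPD_solves g k f (wmean g f)" if k: "k = real CARD('n) + abs_multi g - 1"
  proof (rule EPD_solves_radial_average[where K="return borel 1" and C="gtrans_const g / sph_pos_weight g"])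
    have km: "k - ?m = 0" using k by (simp add: sph_dim_def)
    show "compact_measure (return borel (1::real))"
      unfolding compact_measure_def
      by (auto intro!: exI[of _ "{1}"] prob_space.axioms(1) prob_space_return simp: AE_return)
    \<comment> \<open>Both terms vanish: \<open>k - m = 0\<close> by hypothesis, and
      \<open>1 - r^2 = 0\<close> at the point mass.\<close>
    show "(\<integral>r. (k - ?m) * (r\<^sup>2 * Pm x (t * r)) - (1 - r\<^sup>2) * Hm x \<bar>t * r\<bar> \<partial>return borel 1) = 0" for x t
    proof -
      have "(\<lambda>r. (1 - r\<^sup>2) * Hm x \<bar>t * r\<bar>) \<in> borel_measurable borel"
        by (intro borel_measurable_continuous_onI continuous_intros cont_Hm)
      thus ?thesis unfolding km by (subst integral_return) auto
    qed
    show "f x = (f \<circ> vabs) x" if "x \<in> orth_open" for x by (rule ff[OF that])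
    show "wmean g f x t = gtrans_const g / sph_pos_weight g * (\<integral>r. Phi0 x \<bar>t * r\<bar> \<partial>return borel 1)" if t: "t > 0" for x t
    proof -
      have "(\<lambda>r. Phi0 x \<bar>t * r\<bar>) \<in> borel_measurable borel"
        by (intro borel_measurable_continuous_onI continuous_intros cont_Phi0)
      hence "(\<integral>r. Phi0 x \<bar>t * r\<bar> \<partial>return borel 1) = Phi0 x t" using t by (subst integral_return) auto
      moreover have "sph_pos_integral (\<lambda>z. gtrans_const g * v0 x (t *\<^sub>R z) * mpow z g) = gtrans_const g * Phi0 x t"
        unfolding Phi0_def by (subst sph_pos_integral_eq[OF g_pos]) (auto intro!: continuous_intros v0c)
      ultimately show ?thesis unfolding wmean_def gt by simp
    qed
    show "gtrans_const g / sph_pos_weight g * (measure (return borel (1::real)) UNIV * (measure (sph_measure g) UNIV * measure (trans_measure g) UNIV)) = 1"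
      using gtrans_const_mult[OF g_pos] W by (simp add: measure_sph_measure[OF g_pos] measure_return)
  qed
  ultimately show ?thesis by blast
qed

end
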